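(* Let $G$ be a (Gromov) hyperbolic, one-ended, right-angled Coxeter group. Then $G$ is homogeneous; that is, for all finite tuples $\bar a,\bar b$ of the same length from $G$ with $tp^{G}(\bar a)=tp^{G}(\bar b)$, there is an automorphism of $G$ mapping $\bar a$ to $\bar b$.
   Context: A right-angled Coxeter group is a group with presentation $\langle S\mid (ss')^{m(s,s')}=e \text{ whenever } m(s,s')<\infty\rangle$, where $m:S\times S\to\{1,2,\infty\}$ is symmetric and $m(s,s')=1\Leftrightarrow s=s'$. A finitely generated group is one-ended if it does not split as an HNN-extension or as a non-trivial amalgamated free product with finite edge group. For a finite tuple $\bar a$ from $G$, $tp^G(\bar a)$ denotes the complete first-order type of $\bar a$ over $\emptyset$ in the language of groups, i.e., the set of all parameter-free first-order formulas satisfied by $\bar a$ in $G$. *)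

theory Defs
  imports Complex_Main "HOL-Library.Extended_Nat" "HOL-Algebra.Generated_Groups"
begin

section \<open>Groups given by presentations\<close>

text \<open>
  A letter \<open>(s, True)\<close> stands for the generator \<open>s\<close> and \<open>(s, False)\<close> for its formal inverse.
  The group \<open>\<langle>S | R\<rangle>\<close> consists of the words over \<open>S\<close> and its inverses modulo the
  congruence generated by free cancellation and by \<open>r = 1\<close> for \<open>r \<in> R\<close>.  Relators that are
  not words over \<open>S\<close> are ignored.
\<close>

type_synonym 's word = "('s \<times> bool) list"

definition words :: "'s set \<Rightarrow> 's word set" where
  "words S = lists (S \<times> UNIV)"

inductive pres_eq :: "'s set \<Rightarrow> 's word set \<Rightarrow> 's word \<Rightarrow> 's word \<Rightarrow> bool"
  for S :: "'s set" and R :: "'s word set"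
where
  refl: "u \<in> words S \<Longrightarrow> pres_eq S R u u"
| sym: "pres_eq S R u v \<Longrightarrow> pres_eq S R v u"
| trans: "pres_eq S R u v \<Longrightarrow> pres_eq S R v w \<Longrightarrow> pres_eq S R u w"
| cancel: "u \<in> words S \<Longrightarrow> v \<in> words S \<Longrightarrow> s \<in> S \<Longrightarrow>
    pres_eq S R (u @ [(s, b), (s, \<not> b)] @ v) (u @ v)"
| relator: "u \<in> words S \<Longrightarrow> v \<in> words S \<Longrightarrow> r \<in> R \<Longrightarrow> r \<in> words S \<Longrightarrow>
    pres_eq S R (u @ r @ v) (u @ v)"

definition pres_rel :: "'s set \<Rightarrow> 's word set \<Rightarrow> ('s word \<times> 's word) set" where
  "pres_rel S R = {(u, v). pres_eq S R u v}"

definition presented_group :: "'s set \<Rightarrow> 's word set \<Rightarrow> 's word set monoid" where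
  "presented_group S R =
     \<lparr>carrier = words S // pres_rel S R,
      mult = (\<lambda>X Y. \<Union>x\<in>X. \<Union>y\<in>Y. pres_rel S R `` {x @ y}),
      one = pres_rel S R `` {[]}\<rparr>"

lemma words_Nil [simp]: "[] \<in> words S"
  by (simp add: words_def)

lemma words_append [simp]: "u @ v \<in> words S \<longleftrightarrow> u \<in> words S \<and> v \<in> words S"
  by (auto simp: words_def)

lemma words_Cons [simp]: "x # v \<in> words S \<longleftrightarrow> fst x \<in> S \<and> v \<in> words S"
  by (cases x) (auto simp: words_def)

lemma pres_eq_words: "pres_eq S R u v \<Longrightarrow> u \<in> words S \<and> v \<in> words S"
  by (induction rule: pres_eq.induct) auto

lemma pres_eq_context:
  "pres_eq S R u v \<Longrightarrow> a \<in> words S \<Longrightarrow> b \<in> words S \<Longrightarrow> pres_eq S R (a @ u @ b) (a @ v @ b)"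
proof (induction rule: pres_eq.induct)
  case (cancel u v s c)
  then show ?case using pres_eq.cancel[of "a @ u" S "v @ b" s R c] by simp
next
  case (relator u v r)
  then show ?case using pres_eq.relator[of "a @ u" S "v @ b" r R] by simp
next
  case (trans u v w)
  then show ?case by (meson pres_eq.trans)
qed (auto intro: pres_eq.refl pres_eq.sym)

lemma pres_eq_append:
  assumes "pres_eq S R u u'" "pres_eq S R v v'"
  shows "pres_eq S R (u @ v) (u' @ v')"
proof -
  have w: "u' \<in> words S" "v \<in> words S"
    using assms pres_eq_words by blast+
  have "pres_eq S R (u @ v) (u' @ v)"
    using pres_eq_context[OF assms(1), of "[]" v] w by simp
  moreover have "pres_eq S R (u' @ v) (u' @ v')"
    using pres_eq_context[OF assms(2), of u' "[]"] w by simp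
  ultimately show ?thesis by (rule pres_eq.trans)
qed

lemma equiv_pres_rel: "equiv (words S) (pres_rel S R)"
proof (rule equivI)
  show "pres_rel S R \<subseteq> words S \<times> words S"
    using pres_eq_words by (fastforce simp: pres_rel_def)
  show "refl_on (words S) (pres_rel S R)"
    by (auto simp: pres_rel_def refl_on_def intro: pres_eq.refl)
  show "sym (pres_rel S R)"
    by (auto simp: pres_rel_def sym_def intro: pres_eq.sym)
  show "trans (pres_rel S R)"
    unfolding pres_rel_def trans_def using pres_eq.trans by fast
qed

lemma presented_mult:
  assumes "u \<in> words S" "v \<in> words S"
  shows "mult (presented_group S R) (pres_rel S R `` {u}) (pres_rel S R `` {v})
    = pres_rel S R `` {u @ v}"
proof -
  let ?C = "\<lambda>x. pres_rel S R `` {x}"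
  have C: "?C (x @ y) = ?C (u @ v)" if "x \<in> ?C u" "y \<in> ?C v" for x y
  proof -
    have "pres_eq S R u x" "pres_eq S R v y"
      using that by (simp_all add: pres_rel_def)
    then have "(u @ v, x @ y) \<in> pres_rel S R"
      by (simp add: pres_rel_def pres_eq_append)
    from equiv_class_eq[OF equiv_pres_rel this] show ?thesis by (rule HOL.sym)
  qed
  have u: "u \<in> ?C u" and v: "v \<in> ?C v"
    using assms by (simp_all add: pres_rel_def pres_eq.refl)
  have "(\<Union>x\<in>?C u. \<Union>y\<in>?C v. ?C (x @ y)) = (\<Union>x\<in>?C u. \<Union>y\<in>?C v. ?C (u @ v))"
    by (intro SUP_cong HOL.refl C)
  also have "\<dots> = ?C (u @ v)"
    using u v by blast
  finally show ?thesis
    by (simp add: presented_group_def)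
qed

lemma pres_eq_inverse:
  "u \<in> words S \<Longrightarrow> pres_eq S R (rev (map (\<lambda>(s, b). (s, \<not> b)) u) @ u) []"
proof (induction u)
  case (Cons x u)
  obtain s b where x: "x = (s, b)" by fastforce
  let ?w = "rev (map (\<lambda>(s, b). (s, \<not> b)) u)"
  have w: "?w \<in> words S"
    using Cons.prems by (auto simp: words_def)
  have "pres_eq S R (?w @ [(s, \<not> b), (s, \<not> \<not> b)] @ u) (?w @ u)"
    using Cons.prems w by (intro pres_eq.cancel) (auto simp: x)
  then show ?case
    using Cons pres_eq.trans[of S R "?w @ [(s, \<not> b), (s, b)] @ u" "?w @ u" "[]"]
    by (simp add: x)
qed (auto intro: pres_eq.refl)

lemma group_presented_group: "group (presented_group S R)"
proof (rule groupI)
  let ?P = "presented_group S R"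
  have car: "X \<in> carrier ?P \<longleftrightarrow> (\<exists>u\<in>words S. X = pres_rel S R `` {u})" for X
    by (auto simp: presented_group_def quotient_def)
  have one: "one ?P = pres_rel S R `` {[]}"
    by (simp add: presented_group_def)
  show "mult ?P x y \<in> carrier ?P" if "x \<in> carrier ?P" "y \<in> carrier ?P" for x y
  proof -
    from that obtain u v where "u \<in> words S" "v \<in> words S"
      "x = pres_rel S R `` {u}" "y = pres_rel S R `` {v}" unfolding car by blast
    moreover from this have "u @ v \<in> words S" by simp
    ultimately show ?thesis unfolding car by (metis presented_mult)
  qed
  show "one ?P \<in> carrier ?P"
    unfolding car one by (rule bexI[of _ "[]"]) auto
  show "mult ?P (mult ?P x y) z = mult ?P x (mult ?P y z)"
    if "x \<in> carrier ?P" "y \<in> carrier ?P" "z \<in> carrier ?P" for x y z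
    using that unfolding car by (auto simp: presented_mult)
  show "mult ?P (one ?P) x = x" if "x \<in> carrier ?P" for x
    using that unfolding car one by (auto simp: presented_mult)
  show "\<exists>y\<in>carrier ?P. mult ?P y x = one ?P" if x: "x \<in> carrier ?P" for x
  proof -
    obtain u where u: "u \<in> words S" "x = pres_rel S R `` {u}"
      using x unfolding car by blast
    let ?w = "rev (map (\<lambda>(s, b). (s, \<not> b)) u)"
    have w: "?w \<in> words S"
      using u by (auto simp: words_def)
    have "mult ?P (pres_rel S R `` {?w}) x = one ?P"
      unfolding one u(2) presented_mult[OF w u(1)]
      using pres_eq_inverse[OF u(1)]
      by (intro equiv_class_eq[OF equiv_pres_rel]) (simp add: pres_rel_def)
    moreover have "pres_rel S R `` {?w} \<in> carrier ?P"
      unfolding car using w by metis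
    ultimately show ?thesis by (rule bexI)
  qed
qed


section \<open>Right-angled Coxeter groups\<close>

definition right_angled_coxeter_matrix :: "'s set \<Rightarrow> ('s \<Rightarrow> 's \<Rightarrow> enat) \<Rightarrow> bool" where
  "right_angled_coxeter_matrix S m \<longleftrightarrow>
     (\<forall>s\<in>S. \<forall>s'\<in>S. m s s' \<in> {1, 2, \<infinity>} \<and> m s s' = m s' s \<and> (m s s' = 1 \<longleftrightarrow> s = s'))"

definition coxeter_relators :: "'s set \<Rightarrow> ('s \<Rightarrow> 's \<Rightarrow> enat) \<Rightarrow> 's word set" where
  "coxeter_relators S m =
     {concat (replicate k [(s, True), (s', True)]) | s s' k. s \<in> S \<and> s' \<in> S \<and> m s s' = enat k}"

definition coxeter_group :: "'s set \<Rightarrow> ('s \<Rightarrow> 's \<Rightarrow> enat) \<Rightarrow> 's word set monoid" where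
  "coxeter_group S m = presented_group S (coxeter_relators S m)"


section \<open>Splittings and one-endedness\<close>

definition finitely_generated :: "('a, 'b) monoid_scheme \<Rightarrow> bool" where
  "finitely_generated G \<longleftrightarrow>
     (\<exists>X. finite X \<and> X \<subseteq> carrier G \<and> generate G X = carrier G)"

text \<open>
  The multiplication table of \<open>A\<close>, as relators \<open>x y (x y)\<^sup>-\<^sup>1\<close> over an alphabet into which
  \<open>A\<close> is embedded by \<open>f\<close>.
\<close>
definition table_relators :: "('a \<Rightarrow> 's) \<Rightarrow> ('a, 'b) monoid_scheme \<Rightarrow> 's word set" where
  "table_relators f A =
     {[(f x, True), (f y, True), (f (x \<otimes>\<^bsub>A\<^esub> y), False)] | x y. x \<in> carrier A \<and> y \<in> carrier A}"

text \<open>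
  The pushout of \<open>\<phi> : C \<rightarrow> A\<close> and \<open>\<psi> : C \<rightarrow> B\<close>; the amalgamated free product
  when \<open>\<phi>\<close> and \<open>\<psi>\<close> are injective homomorphisms.
\<close>
definition amalgamated_product ::
    "'a monoid \<Rightarrow> 'a monoid \<Rightarrow> 'a monoid \<Rightarrow> ('a \<Rightarrow> 'a) \<Rightarrow> ('a \<Rightarrow> 'a) \<Rightarrow> ('a + 'a) word set monoid"
where
  "amalgamated_product A B C \<phi> \<psi> =
     presented_group (carrier A <+> carrier B)
       (table_relators Inl A \<union> table_relators Inr B \<union>
        {[(Inl (\<phi> c), True), (Inr (\<psi> c), False)] | c. c \<in> carrier C})"

text \<open>The stable letter \<open>t\<close> is \<open>None\<close>; the added relators are \<open>t c t\<^sup>-\<^sup>1 \<phi>(c)\<^sup>-\<^sup>1\<close>.\<close>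
definition hnn_extension ::
    "'a monoid \<Rightarrow> 'a set \<Rightarrow> ('a \<Rightarrow> 'a) \<Rightarrow> 'a option word set monoid"
where
  "hnn_extension A C \<phi> =
     presented_group (insert None (Some ` carrier A))
       (table_relators Some A \<union>
        {[(None, True), (Some c, True), (None, False), (Some (\<phi> c), False)] | c. c \<in> C})"

text \<open>
  The factors of a splitting of \<open>G\<close> embed into \<open>G\<close>, so nothing is lost by
  taking their elements from the element type of \<open>G\<close>.
\<close>
definition splits_as_amalgam_over_finite :: "('a, 'b) monoid_scheme \<Rightarrow> bool" where
  "splits_as_amalgam_over_finite G \<longleftrightarrow>
     (\<exists>(A :: 'a monoid) (B :: 'a monoid) (C :: 'a monoid) \<phi> \<psi>.
        group A \<and> group B \<and> group C \<and> finite (carrier C) \<and>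
        \<phi> \<in> hom C A \<and> inj_on \<phi> (carrier C) \<and> \<phi> ` carrier C \<noteq> carrier A \<and>
        \<psi> \<in> hom C B \<and> inj_on \<psi> (carrier C) \<and> \<psi> ` carrier C \<noteq> carrier B \<and>
        G \<cong> amalgamated_product A B C \<phi> \<psi>)"

definition splits_as_hnn_over_finite :: "('a, 'b) monoid_scheme \<Rightarrow> bool" where
  "splits_as_hnn_over_finite G \<longleftrightarrow>
     (\<exists>(A :: 'a monoid) C \<phi>.
        group A \<and> subgroup C A \<and> finite C \<and>
        \<phi> \<in> hom (A\<lparr>carrier := C\<rparr>) A \<and> inj_on \<phi> C \<and>
        G \<cong> hnn_extension A C \<phi>)"

text \<open>With this definition finite groups count as one-ended.\<close>
definition one_ended :: "('a, 'b) monoid_scheme \<Rightarrow> bool" where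
  "one_ended G \<longleftrightarrow>
     finitely_generated G \<and>
     \<not> splits_as_hnn_over_finite G \<and> \<not> splits_as_amalgam_over_finite G"


section \<open>Hyperbolic groups\<close>

definition word_length :: "('a, 'b) monoid_scheme \<Rightarrow> 'a set \<Rightarrow> 'a \<Rightarrow> nat" where
  "word_length G X g =
     (LEAST n. \<exists>xs. length xs = n \<and> set xs \<subseteq> X \<union> (m_inv G ` X) \<and> foldr (mult G) xs \<one>\<^bsub>G\<^esub> = g)"

definition word_dist :: "('a, 'b) monoid_scheme \<Rightarrow> 'a set \<Rightarrow> 'a \<Rightarrow> 'a \<Rightarrow> real" where
  "word_dist G X g h = real (word_length G X (inv\<^bsub>G\<^esub> g \<otimes>\<^bsub>G\<^esub> h))"

definition gromov_product :: "('a \<Rightarrow> 'a \<Rightarrow> real) \<Rightarrow> 'a \<Rightarrow> 'a \<Rightarrow> 'a \<Rightarrow> real" where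
  "gromov_product d w x y = (d x w + d y w - d x y) / 2"

definition gromov_hyperbolic_space :: "'a set \<Rightarrow> ('a \<Rightarrow> 'a \<Rightarrow> real) \<Rightarrow> bool" where
  "gromov_hyperbolic_space M d \<longleftrightarrow>
     (\<exists>\<delta>\<ge>0. \<forall>w\<in>M. \<forall>x\<in>M. \<forall>y\<in>M. \<forall>z\<in>M.
        gromov_product d w x z \<ge> min (gromov_product d w x y) (gromov_product d w y z) - \<delta>)"

definition hyperbolic_group :: "('a, 'b) monoid_scheme \<Rightarrow> bool" where
  "hyperbolic_group G \<longleftrightarrow>
     (\<exists>X. finite X \<and> X \<subseteq> carrier G \<and> generate G X = carrier G \<and>
          gromov_hyperbolic_space (carrier G) (word_dist G X))"


section \<open>First-order types in the language of groups\<close>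

datatype group_term = Var nat | One | Mul group_term group_term | Inv group_term

datatype group_formula =
    Eq group_term group_term
  | Neg group_formula
  | Conj group_formula group_formula
  | All nat group_formula

primrec term_vars :: "group_term \<Rightarrow> nat set" where
  "term_vars (Var i) = {i}"
| "term_vars One = {}"
| "term_vars (Mul s t) = term_vars s \<union> term_vars t"
| "term_vars (Inv t) = term_vars t"

primrec free_vars :: "group_formula \<Rightarrow> nat set" where
  "free_vars (Eq s t) = term_vars s \<union> term_vars t"
| "free_vars (Neg p) = free_vars p"
| "free_vars (Conj p q) = free_vars p \<union> free_vars q"
| "free_vars (All i p) = free_vars p - {i}"

primrec term_value :: "('a, 'b) monoid_scheme \<Rightarrow> (nat \<Rightarrow> 'a) \<Rightarrow> group_term \<Rightarrow> 'a" where
  "term_value G e (Var i) = e i"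
| "term_value G e One = \<one>\<^bsub>G\<^esub>"
| "term_value G e (Mul s t) = term_value G e s \<otimes>\<^bsub>G\<^esub> term_value G e t"
| "term_value G e (Inv t) = inv\<^bsub>G\<^esub> (term_value G e t)"

primrec sat :: "('a, 'b) monoid_scheme \<Rightarrow> (nat \<Rightarrow> 'a) \<Rightarrow> group_formula \<Rightarrow> bool" where
  "sat G e (Eq s t) \<longleftrightarrow> term_value G e s = term_value G e t"
| "sat G e (Neg p) \<longleftrightarrow> \<not> sat G e p"
| "sat G e (Conj p q) \<longleftrightarrow> sat G e p \<and> sat G e q"
| "sat G e (All i p) \<longleftrightarrow> (\<forall>x\<in>carrier G. sat G (e(i := x)) p)"

text \<open>
  The variable with index \<open>i < length as\<close> denotes the \<open>i\<close>-th entry of the tuple.  The values of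
  \<open>as ! i\<close> for other \<open>i\<close> are irrelevant, since those variables do not occur free.
\<close>
definition tp :: "('a, 'b) monoid_scheme \<Rightarrow> 'a list \<Rightarrow> group_formula set" where
  "tp G as = {p. free_vars p \<subseteq> {..<length as} \<and> sat G (\<lambda>i. as ! i) p}"

definition homogeneous :: "('a, 'b) monoid_scheme \<Rightarrow> bool" where
  "homogeneous G \<longleftrightarrow>
     (\<forall>as bs. set as \<subseteq> carrier G \<and> set bs \<subseteq> carrier G \<and> length as = length bs \<and> tp G as = tp G bs
        \<longrightarrow> (\<exists>\<sigma>\<in>iso G G. map \<sigma> as = bs))"

end

theory Submission
  imports Defs "HOL-Combinatorics.Cycles"
begin

text \<open>
  Let \<open>W\<close> be the Coxeter group.  If two tuples have the same type, then one is the image of the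
  other under an endomorphism \<open>\<phi>\<close> of \<open>W\<close>, and \<open>\<phi>\<close> can be chosen injective on conjugacy classes of
  involutions, since there are only finitely many of these.  Some power of \<open>\<phi>\<close> then maps every
  generator to a conjugate of itself, and it suffices to show that such an endomorphism is
  bijective.  Look at the walls of the images of the generators.  Composing with
  partial conjugations and inner automorphisms brings these walls closer to the identity, until all
  images are the generators themselves, or else one finds either a clique that separates the
  defining graph, hence a splitting of \<open>W\<close> over a finite group, or two commuting infinite dihedral
  groups generated by reflections, which the four-point condition excludes.
\<close>

section \<open>Actions of a right-angled Coxeter group\<close>

text \<open>A formula imposes only finitely many conditions on the images of the generators. The
  defining relations alone still admit endomorphisms that send some generators to the identity, and
  injectivity of the whole map is an infinite list of inequations. Non-conjugacy of finitely many
  pairs is expressible, and the classes of involutions, with the identity counted among them, supply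
  such pairs. Once a power preserves these classes, an endomorphism becomes a picture in the Cayley
  graph: the edge from \<open>w\<close> to \<open>w \<otimes> \<sigma> s\<close> lies on the wall of
  the reflection \<open>cj w (\<sigma> s)\<close>, and the images of the generators give one wall
  per generator, of the same type and with the same crossing pattern as the standard ones.
  Bijectivity of the power then passes back to the original map. One-endedness enters through
  finiteness of \<open>S\<close> and \<open>no_separating_clique\<close>, hyperbolicity through
  \<open>no_reflection_flat\<close>.\<close>

context group
begin

lemma inv_cancel_left [simp]:
  "x \<in> carrier G \<Longrightarrow> y \<in> carrier G \<Longrightarrow> inv x \<otimes> (x \<otimes> y) = y"
  "x \<in> carrier G \<Longrightarrow> y \<in> carrier G \<Longrightarrow> x \<otimes> (inv x \<otimes> y) = y"
  by (simp_all flip: m_assoc)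

definition cj :: "'a \<Rightarrow> 'a \<Rightarrow> 'a" where
  "cj g x = g \<otimes> x \<otimes> inv g"

lemma cj_closed [simp]: "g \<in> carrier G \<Longrightarrow> x \<in> carrier G \<Longrightarrow> cj g x \<in> carrier G"
  by (simp add: cj_def)

lemma cj_one [simp]: "x \<in> carrier G \<Longrightarrow> cj \<one> x = x"
  by (simp add: cj_def)

lemma cj_one_right [simp]: "g \<in> carrier G \<Longrightarrow> cj g \<one> = \<one>"
  by (simp add: cj_def)

lemma cj_mult:
  "g \<in> carrier G \<Longrightarrow> h \<in> carrier G \<Longrightarrow> x \<in> carrier G \<Longrightarrow> cj (g \<otimes> h) x = cj g (cj h x)"
  by (simp add: cj_def m_assoc inv_mult_group)

lemma cj_distrib:
  "g \<in> carrier G \<Longrightarrow> x \<in> carrier G \<Longrightarrow> y \<in> carrier G \<Longrightarrow> cj g (x \<otimes> y) = cj g x \<otimes> cj g y"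
  by (simp add: cj_def m_assoc)

lemma cj_cancel [simp]:
  "g \<in> carrier G \<Longrightarrow> x \<in> carrier G \<Longrightarrow> cj (inv g) (cj g x) = x"
  "g \<in> carrier G \<Longrightarrow> x \<in> carrier G \<Longrightarrow> cj g (cj (inv g) x) = x"
  by (simp_all flip: cj_mult)

lemma cj_inject [simp]:
  "g \<in> carrier G \<Longrightarrow> x \<in> carrier G \<Longrightarrow> y \<in> carrier G \<Longrightarrow> cj g x = cj g y \<longleftrightarrow> x = y"
  by (metis cj_cancel(1))

lemma cj_mult_right: "g \<in> carrier G \<Longrightarrow> x \<in> carrier G \<Longrightarrow> cj g x \<otimes> g = g \<otimes> x"
  by (simp add: cj_def m_assoc)

lemma cj_eq_iff:
  "g \<in> carrier G \<Longrightarrow> x \<in> carrier G \<Longrightarrow> y \<in> carrier G \<Longrightarrow> cj g x = y \<longleftrightarrow> g \<otimes> x = y \<otimes> g"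
  by (metis cj_def inv_solve_right m_closed)

lemma cj_commute: "g \<in> carrier G \<Longrightarrow> x \<in> carrier G \<Longrightarrow> g \<otimes> x = x \<otimes> g \<Longrightarrow> cj g x = x"
  by (simp add: cj_eq_iff)

lemma cj_hom: "g \<in> carrier G \<Longrightarrow> cj g \<in> hom G G"
  by (auto simp: hom_def cj_distrib)

lemma bij_cj: "g \<in> carrier G \<Longrightarrow> bij_betw (cj g) (carrier G) (carrier G)"
  by (rule bij_betwI[where g = "cj (inv g)"]) auto

end

text \<open>The word map \<open>p\<close> stands for the composite of the class map with an
  isomorphism from the presented group, so that all later arguments take place inside
  \<open>G\<close> itself.\<close>

locale racg = group G for G :: "('a, 'b) monoid_scheme" (structure) +
  fixes S :: "'s set" and m :: "'s \<Rightarrow> 's \<Rightarrow> enat" and p :: "'s word \<Rightarrow> 'a"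
  assumes ra: "right_angled_coxeter_matrix S m"
    and p_closed: "u \<in> words S \<Longrightarrow> p u \<in> carrier G"
    and p_surj: "g \<in> carrier G \<Longrightarrow> \<exists>u\<in>words S. p u = g"
    and p_append: "u \<in> words S \<Longrightarrow> v \<in> words S \<Longrightarrow> p (u @ v) = p u \<otimes> p v"
    and p_eq_iff: "u \<in> words S \<Longrightarrow> v \<in> words S \<Longrightarrow>
      p u = p v \<longleftrightarrow> pres_eq S (coxeter_relators S m) u v"
begin

definition adj :: "'s \<Rightarrow> 's \<Rightarrow> bool" where
  "adj s t \<longleftrightarrow> s \<in> S \<and> t \<in> S \<and> m s t = 2"

definition \<sigma> :: "'s \<Rightarrow> 'a" where
  "\<sigma> s = p [(s, True)]"

lemma m_cases:
  assumes "s \<in> S" "t \<in> S"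
  shows "m s t \<in> {1, 2, \<infinity>}" "m s t = m t s" "m s t = 1 \<longleftrightarrow> s = t"
  using ra assms unfolding right_angled_coxeter_matrix_def by blast+

lemma adj_sym: "adj s t \<Longrightarrow> adj t s"
  using m_cases(2) unfolding adj_def by metis

lemma adj_irrefl [simp]: "\<not> adj s s"
proof
  assume s: "adj s s"
  then have "m s s = 1"
    using m_cases(3)[of s s] by (simp add: adj_def)
  with s show False
    by (simp add: adj_def one_enat_def numeral_eq_enat)
qed

lemma adjD: "adj s t \<Longrightarrow> s \<in> S \<and> t \<in> S \<and> s \<noteq> t"
  using adj_irrefl unfolding adj_def by blast

lemma \<sigma>_closed [simp]: "s \<in> S \<Longrightarrow> \<sigma> s \<in> carrier G"
  by (simp add: \<sigma>_def p_closed)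

lemma p_Nil [simp]: "p [] = \<one>"
proof -
  have "p [] \<otimes> p [] = p []"
    using p_append[of "[]" "[]"] by simp
  then show ?thesis
    using p_closed[of "[]"] by simp
qed

lemma p_relator:
  assumes "r \<in> coxeter_relators S m" "r \<in> words S"
  shows "p r = \<one>"
  using pres_eq.relator[of "[]" S "[]" r "coxeter_relators S m"] assms p_eq_iff[of r "[]"] by simp

lemma \<sigma>_square [simp]: "s \<in> S \<Longrightarrow> \<sigma> s \<otimes> \<sigma> s = \<one>"
proof -
  assume s: "s \<in> S"
  then have "m s s = enat 1"
    using ra by (auto simp: right_angled_coxeter_matrix_def one_enat_def)
  then have "concat (replicate 1 [(s, True), (s, True)]) \<in> coxeter_relators S m"
    unfolding coxeter_relators_def using s by blast
  then show ?thesis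
    using p_relator[of "[(s, True), (s, True)]"] p_append[of "[(s, True)]" "[(s, True)]"] s
    by (simp add: \<sigma>_def)
qed

lemma \<sigma>_square_left [simp]: "s \<in> S \<Longrightarrow> x \<in> carrier G \<Longrightarrow> \<sigma> s \<otimes> (\<sigma> s \<otimes> x) = x"
  by (simp flip: m_assoc)

lemma inv_\<sigma> [simp]: "s \<in> S \<Longrightarrow> inv (\<sigma> s) = \<sigma> s"
  by (simp add: inv_equality)

lemma p_letter: "s \<in> S \<Longrightarrow> p [(s, b)] = \<sigma> s"
proof (cases b)
  case False
  assume s: "s \<in> S"
  have "p [(s, False), (s, True)] = p []"
    using s p_eq_iff[of "[(s, False), (s, True)]" "[]"]
      pres_eq.cancel[of "[]" S "[]" s "coxeter_relators S m" False] by simp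
  then have "p [(s, False)] \<otimes> \<sigma> s = \<one>"
    using s p_append[of "[(s, False)]" "[(s, True)]"] by (simp add: \<sigma>_def)
  then show ?thesis
    using s False p_closed[of "[(s, False)]"] inv_equality[of "p [(s, False)]" "\<sigma> s"] by simp
qed (simp add: \<sigma>_def)

lemma \<sigma>_commute: "adj s t \<Longrightarrow> \<sigma> s \<otimes> \<sigma> t = \<sigma> t \<otimes> \<sigma> s"
proof -
  assume a: "adj s t"
  then have st: "s \<in> S" "t \<in> S" "m s t = enat 2"
    by (auto simp: adj_def numeral_eq_enat)
  then have "concat (replicate 2 [(s, True), (t, True)]) \<in> coxeter_relators S m"
    unfolding coxeter_relators_def by blast
  then have "p ([(s, True), (t, True)] @ [(s, True), (t, True)]) = \<one>"
    using st by (intro p_relator) (simp_all add: numeral_2_eq_2)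
  moreover have "p [(s, True), (t, True)] = \<sigma> s \<otimes> \<sigma> t"
    using st p_append[of "[(s, True)]" "[(t, True)]"] by (simp add: \<sigma>_def)
  ultimately have "(\<sigma> s \<otimes> \<sigma> t) \<otimes> (\<sigma> s \<otimes> \<sigma> t) = \<one>"
    using st p_append[of "[(s, True), (t, True)]" "[(s, True), (t, True)]"] by simp
  then have "inv (\<sigma> s \<otimes> \<sigma> t) = \<sigma> s \<otimes> \<sigma> t"
    using st by (intro inv_equality) auto
  then show ?thesis
    using st by (simp add: inv_mult_group)
qed

definition ev :: "'s list \<Rightarrow> 'a" where
  "ev xs = foldr (\<lambda>s g. \<sigma> s \<otimes> g) xs \<one>"

lemma ev_Nil [simp]: "ev [] = \<one>"
  by (simp add: ev_def)

lemma ev_Cons [simp]: "ev (s # xs) = \<sigma> s \<otimes> ev xs"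
  by (simp add: ev_def)

lemma ev_closed [simp]: "set xs \<subseteq> S \<Longrightarrow> ev xs \<in> carrier G"
  by (induction xs) auto

lemma ev_append: "set xs \<subseteq> S \<Longrightarrow> set ys \<subseteq> S \<Longrightarrow> ev (xs @ ys) = ev xs \<otimes> ev ys"
  by (induction xs) (auto simp: m_assoc)

lemma p_ev: "u \<in> words S \<Longrightarrow> p u = ev (map fst u)"
proof (induction u)
  case (Cons x u)
  then show ?case
    using p_append[of "[x]" u] p_letter[of "fst x" "snd x"] by simp
qed simp

lemma words_fst: "u \<in> words S \<Longrightarrow> set (map fst u) \<subseteq> S"
  by (auto simp: words_def)

lemma ev_surj:
  assumes "g \<in> carrier G"
  obtains xs where "set xs \<subseteq> S" "ev xs = g"
  using p_surj[OF assms] p_ev words_fst by metis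

lemma racg_induct [consumes 1, case_names one step]:
  assumes "g \<in> carrier G" "P \<one>"
    and "\<And>w s. w \<in> carrier G \<Longrightarrow> s \<in> S \<Longrightarrow> P w \<Longrightarrow> P (w \<otimes> \<sigma> s)"
  shows "P g"
proof -
  obtain xs where xs: "set xs \<subseteq> S" "ev xs = g"
    using ev_surj[OF assms(1)] .
  have "set xs \<subseteq> S \<Longrightarrow> P (ev xs)"
    by (induction xs rule: rev_induct) (use assms in \<open>auto simp: ev_append\<close>)
  then show ?thesis
    using xs by simp
qed

text \<open>The moves \<open>f q s\<close> are performed along an arbitrarily chosen word for
  \<open>g\<close>. The result is independent of the choice once the moves respect the Coxeter
  relations.\<close>

definition act :: "('q \<Rightarrow> 's \<Rightarrow> 'q) \<Rightarrow> 'q \<Rightarrow> 'a \<Rightarrow> 'q" where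
  "act f q g = foldl (\<lambda>q x. f q (fst x)) q (SOME u. u \<in> words S \<and> p u = g)"

text \<open>
  Homomorphisms, types of reflections and walls are all obtained from the right action \<open>act\<close>.
\<close>
lemma
  assumes Q: "\<And>q s. q \<in> Q \<Longrightarrow> s \<in> S \<Longrightarrow> f q s \<in> Q"
    and inv: "\<And>q s. q \<in> Q \<Longrightarrow> s \<in> S \<Longrightarrow> f (f q s) s = q"
    and comm: "\<And>q s t. q \<in> Q \<Longrightarrow> adj s t \<Longrightarrow> f (f q s) t = f (f q t) s"
    and q: "q \<in> Q"
  shows act_one: "act f q \<one> = q"
    and act_closed: "g \<in> carrier G \<Longrightarrow> act f q g \<in> Q"
    and act_step: "g \<in> carrier G \<Longrightarrow> s \<in> S \<Longrightarrow> act f q (g \<otimes> \<sigma> s) = f (act f q g) s"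
proof -
  let ?F = "foldl (\<lambda>q x. f q (fst x))"
  have cl: "?F q u \<in> Q" if "u \<in> words S" "q \<in> Q" for q u
    using that by (induction u arbitrary: q) (auto simp: Q)
  have rel: "?F q r = q" if r: "r \<in> coxeter_relators S m" and q: "q \<in> Q" for q r
  proof -
    obtain s t k where k: "s \<in> S" "t \<in> S" "m s t = enat k"
      "r = concat (replicate k [(s, True), (t, True)])"
      using r by (auto simp: coxeter_relators_def)
    \<comment> \<open>Entries equal to infinity contribute no relator, so a relator is either
      \<open>ss\<close> or \<open>stst\<close> with \<open>s\<close> and \<open>t\<close> adjacent;
      the involution and commutation properties of the moves take care of these.\<close>
    then have "k = 1 \<and> s = t \<or> k = 2 \<and> adj s t"
      using ra by (force simp: right_angled_coxeter_matrix_def adj_def numeral_eq_enat one_enat_def)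
    then show ?thesis
    proof (elim disjE conjE)
      assume "k = 1" "s = t"
      then show ?thesis using k inv q by simp
    next
      assume "k = 2" "adj s t"
      then have "?F q r = f (f (f (f q s) t) s) t"
        using k by (simp add: numeral_2_eq_2)
      also have "\<dots> = q"
        using comm[OF q \<open>adj s t\<close>] inv Q q k by simp
      finally show ?thesis .
    qed
  qed
  have eq: "\<forall>q\<in>Q. ?F q u = ?F q v" if "pres_eq S (coxeter_relators S m) u v" for u v
    using that
  proof induction
    case (cancel u v s b)
    then show ?case using cl inv by simp
  next
    case (relator u v r)
    then show ?case using cl rel by simp
  qed auto
  have F: "act f q (p u) = ?F q u" if "u \<in> words S" for u
  proof -
    let ?v = "SOME v. v \<in> words S \<and> p v = p u"
    have "?v \<in> words S \<and> p ?v = p u"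
      using that by (rule_tac someI[of _ u]) simp
    then show ?thesis
      unfolding act_def using eq[of ?v u] p_eq_iff[of ?v u] that q by simp
  qed
  show "act f q \<one> = q"
    using F[of "[]"] by simp
  show "act f q g \<in> Q" if "g \<in> carrier G"
    using p_surj[OF that] F cl q by auto
  show "act f q (g \<otimes> \<sigma> s) = f (act f q g) s" if g: "g \<in> carrier G" and s: "s \<in> S"
  proof -
    obtain u where u: "u \<in> words S" "p u = g"
      using p_surj[OF g] by auto
    have "p (u @ [(s, True)]) = g \<otimes> \<sigma> s"
      using u s p_append[of u "[(s, True)]"] by (simp add: \<sigma>_def)
    then show ?thesis
      using F[of "u @ [(s, True)]"] F[of u] u s by simp
  qed
qed

text \<open>\<open>H\<close> acts on itself by right multiplication with the elements
  \<open>f s\<close>; the orbit map of the identity is the homomorphism.\<close>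

lemma hom_extend:
  fixes H :: "('c, 'd) monoid_scheme"
  assumes "group H" and f: "\<And>s. s \<in> S \<Longrightarrow> f s \<in> carrier H"
    and sq: "\<And>s. s \<in> S \<Longrightarrow> f s \<otimes>\<^bsub>H\<^esub> f s = \<one>\<^bsub>H\<^esub>"
    and comm: "\<And>s t. adj s t \<Longrightarrow> f s \<otimes>\<^bsub>H\<^esub> f t = f t \<otimes>\<^bsub>H\<^esub> f s"
  shows "\<exists>F\<in>hom G H. \<forall>s\<in>S. F (\<sigma> s) = f s"
proof -
  interpret H: group H by fact
  define F where "F = act (\<lambda>q s. q \<otimes>\<^bsub>H\<^esub> f s) \<one>\<^bsub>H\<^esub>"
  note a = act_one[of "carrier H" "\<lambda>q s. q \<otimes>\<^bsub>H\<^esub> f s" "\<one>\<^bsub>H\<^esub>"]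
    act_closed[of "carrier H" "\<lambda>q s. q \<otimes>\<^bsub>H\<^esub> f s" "\<one>\<^bsub>H\<^esub>"]
    act_step[of "carrier H" "\<lambda>q s. q \<otimes>\<^bsub>H\<^esub> f s" "\<one>\<^bsub>H\<^esub>"]
  have comm': "q \<otimes>\<^bsub>H\<^esub> f s \<otimes>\<^bsub>H\<^esub> f t = q \<otimes>\<^bsub>H\<^esub> f t \<otimes>\<^bsub>H\<^esub> f s"
    if "q \<in> carrier H" "adj s t" for q s t
    using comm[OF that(2)] adjD[OF that(2)] that(1) f by (simp add: H.m_assoc)
  have sq': "q \<otimes>\<^bsub>H\<^esub> f s \<otimes>\<^bsub>H\<^esub> f s = q" if "q \<in> carrier H" "s \<in> S" for q s
    using sq f that by (simp add: H.m_assoc)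
  have F1: "F \<one> = \<one>\<^bsub>H\<^esub>"
    unfolding F_def by (rule a(1)) (auto simp: f sq' intro: comm')
  have Fc: "F g \<in> carrier H" if "g \<in> carrier G" for g
    unfolding F_def by (rule a(2)) (auto simp: f sq' that intro: comm')
  have Fs: "F (g \<otimes> \<sigma> s) = F g \<otimes>\<^bsub>H\<^esub> f s" if "g \<in> carrier G" "s \<in> S" for g s
    unfolding F_def by (rule a(3)) (auto simp: f sq' that intro: comm')
  have "F (g \<otimes> h) = F g \<otimes>\<^bsub>H\<^esub> F h" if "g \<in> carrier G" "h \<in> carrier G" for g h
    using that(2,1) by (induction h rule: racg_induct) (auto simp: F1 Fc Fs f H.m_assoc simp flip: m_assoc)
  then have "F \<in> hom G H"
    using Fc by (auto simp: hom_def)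
  moreover have "F (\<sigma> s) = f s" if "s \<in> S" for s
    using Fs[of \<one> s] that F1 f by simp
  ultimately show ?thesis
    by blast
qed

lemma hom_eqI:
  fixes H :: "('c, 'd) monoid_scheme"
  assumes "group H" "F \<in> hom G H" "F' \<in> hom G H" "\<And>s. s \<in> S \<Longrightarrow> F (\<sigma> s) = F' (\<sigma> s)"
    and g: "g \<in> carrier G"
  shows "F g = F' g"
  using g
proof (induction rule: racg_induct)
  case one
  then show ?case
    using assms by (metis hom_one group_axioms)
next
  case (step w s)
  then show ?case
    using hom_mult[OF assms(2), of w "\<sigma> s"] hom_mult[OF assms(3), of w "\<sigma> s"] assms(4)[of s]
    by simp
qed

text \<open>The homomorphism to the group of order two that counts the letter \<open>s\<close>
  modulo 2. Being constant on conjugacy classes, it separates the classes of different generators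
  and so gives every reflection a well-defined type.\<close>

definition par :: "'s \<Rightarrow> 'a \<Rightarrow> bool" where
  "par s = act (\<lambda>b t. b \<noteq> (t = s)) False"

lemma par_one [simp]: "\<not> par s \<one>"
proof -
  have "par s \<one> = False"
    unfolding par_def by (rule act_one[of UNIV]) auto
  then show ?thesis by simp
qed

lemma par_step: "g \<in> carrier G \<Longrightarrow> t \<in> S \<Longrightarrow> par s (g \<otimes> \<sigma> t) \<longleftrightarrow> par s g \<noteq> (t = s)"
  unfolding par_def by (rule act_step[of UNIV]) auto

lemma par_mult: "h \<in> carrier G \<Longrightarrow> g \<in> carrier G \<Longrightarrow> par s (g \<otimes> h) \<longleftrightarrow> par s g \<noteq> par s h"
proof (induction h rule: racg_induct)
  case (step w t)
  then show ?case
    using par_step[of "g \<otimes> w" t s] par_step[of w t s] by (auto simp: m_assoc)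
qed simp

lemma par_\<sigma> [simp]: "t \<in> S \<Longrightarrow> par s (\<sigma> t) \<longleftrightarrow> t = s"
  using par_step[of \<one> t s] by simp

lemma par_cj [simp]: "g \<in> carrier G \<Longrightarrow> x \<in> carrier G \<Longrightarrow> par s (cj g x) = par s x"
  using par_mult[of g "cj g x" s] par_mult[of x g s] cj_mult_right[of g x] by auto

lemma \<sigma>_inject [simp]: "s \<in> S \<Longrightarrow> t \<in> S \<Longrightarrow> \<sigma> s = \<sigma> t \<longleftrightarrow> s = t"
  by (metis par_\<sigma>)

lemma cj_\<sigma>_type:
  "g \<in> carrier G \<Longrightarrow> h \<in> carrier G \<Longrightarrow> s \<in> S \<Longrightarrow> t \<in> S \<Longrightarrow> cj g (\<sigma> s) = cj h (\<sigma> t) \<Longrightarrow> s = t"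
  by (metis par_\<sigma> par_cj \<sigma>_closed)

end


section \<open>Walls\<close>

context racg
begin

definition reflections :: "'a set" where
  "reflections = {cj w (\<sigma> s) | w s. w \<in> carrier G \<and> s \<in> S}"

lemma reflectionsI [intro]: "w \<in> carrier G \<Longrightarrow> s \<in> S \<Longrightarrow> cj w (\<sigma> s) \<in> reflections"
  unfolding reflections_def by blast

lemma reflections_closed [simp]: "r \<in> reflections \<Longrightarrow> r \<in> carrier G"
  unfolding reflections_def by auto

lemma reflectionsE:
  assumes "r \<in> reflections"
  obtains w s where "w \<in> carrier G" "s \<in> S" "r = cj w (\<sigma> s)"
  using assms unfolding reflections_def by blast

lemma \<sigma>_reflection [simp]: "s \<in> S \<Longrightarrow> \<sigma> s \<in> reflections"
  using reflectionsI[of \<one> s] by simp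

lemma cj_reflection [simp]: "g \<in> carrier G \<Longrightarrow> r \<in> reflections \<Longrightarrow> cj g r \<in> reflections"
proof -
  assume g: "g \<in> carrier G" and "r \<in> reflections"
  then obtain w s where w: "w \<in> carrier G" "s \<in> S" "r = cj w (\<sigma> s)"
    by (elim reflectionsE)
  then have "cj g r = cj (g \<otimes> w) (\<sigma> s)"
    using g by (simp add: cj_mult)
  then show ?thesis
    using g w reflectionsI[of "g \<otimes> w" s] by simp
qed

lemma reflection_square [simp]: "r \<in> reflections \<Longrightarrow> r \<otimes> r = \<one>"
  by (elim reflectionsE) (simp flip: cj_distrib)

lemma reflection_square_left [simp]: "r \<in> reflections \<Longrightarrow> x \<in> carrier G \<Longrightarrow> r \<otimes> (r \<otimes> x) = x"
  by (simp flip: m_assoc)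

lemma inv_reflection [simp]: "r \<in> reflections \<Longrightarrow> inv r = r"
  by (simp add: inv_equality)

lemma reflection_commute_iff:
  "r \<in> reflections \<Longrightarrow> x \<in> carrier G \<Longrightarrow> cj r x = x \<longleftrightarrow> r \<otimes> x = x \<otimes> r"
  by (simp add: cj_eq_iff)

lemma cj_reflection_self [simp]: "r \<in> reflections \<Longrightarrow> cj r r = r"
  by (simp add: cj_def)

text \<open>\<open>side r w\<close> says that the wall of \<open>r\<close> separates \<open>\<one>\<close> from \<open>w\<close>.\<close>
definition side :: "'a \<Rightarrow> 'a \<Rightarrow> bool" where
  "side r w = snd (act (\<lambda>(w, b) s. (w \<otimes> \<sigma> s, b \<noteq> (cj w (\<sigma> s) = r))) (\<one>, False) w)"

lemma cj_adj_commute: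
  assumes "w \<in> carrier G" "adj s t"
  shows "cj (w \<otimes> \<sigma> s) (\<sigma> t) = cj w (\<sigma> t)" "w \<otimes> \<sigma> s \<otimes> \<sigma> t = w \<otimes> \<sigma> t \<otimes> \<sigma> s"
  using assms adjD[OF assms(2)] \<sigma>_commute[OF assms(2)]
  by (simp_all add: cj_mult cj_commute m_assoc)

lemma cj_step_self: "w \<in> carrier G \<Longrightarrow> s \<in> S \<Longrightarrow> cj (w \<otimes> \<sigma> s) (\<sigma> s) = cj w (\<sigma> s)"
  by (simp add: cj_mult cj_commute)

text \<open>A label is changed by \<open>h r\<close> each time a path crosses the wall of
  \<open>r\<close>. Opposite edges of a square lie on the same wall, so the final label depends only
  on the endpoint, provided that the maps are involutions and commute for walls meeting in a square.
  Bits as labels give \<open>side\<close>; integers serve to show that walls cross.\<close>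

lemma wall_act:
  fixes h :: "'a \<Rightarrow> 'q \<Rightarrow> 'q" and q0 :: 'q
  defines "A \<equiv> act (\<lambda>(w, q) s. (w \<otimes> \<sigma> s, h (cj w (\<sigma> s)) q)) (\<one>, q0)"
  assumes inv: "\<And>r q. h r (h r q) = q"
    and comm: "\<And>w s t q. w \<in> carrier G \<Longrightarrow> adj s t \<Longrightarrow>
      h (cj w (\<sigma> t)) (h (cj w (\<sigma> s)) q) = h (cj w (\<sigma> s)) (h (cj w (\<sigma> t)) q)"
  shows "snd (A \<one>) = q0"
    and "w \<in> carrier G \<Longrightarrow> s \<in> S \<Longrightarrow> snd (A (w \<otimes> \<sigma> s)) = h (cj w (\<sigma> s)) (snd (A w))"
proof -
  let ?f = "\<lambda>(w, q) s. (w \<otimes> \<sigma> s, h (cj w (\<sigma> s)) q)"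
  let ?Q = "carrier G \<times> UNIV"
  have 1: "?f q s \<in> ?Q" if "q \<in> ?Q" "s \<in> S" for q s
    using that by auto
  have 2: "?f (?f q s) s = q" if "q \<in> ?Q" "s \<in> S" for q s
    using that by (auto simp: inv cj_step_self m_assoc)
  have 3: "?f (?f q s) t = ?f (?f q t) s" if "q \<in> ?Q" "adj s t" for q s t
    using that cj_adj_commute comm adj_sym by auto
  have 4: "(\<one>, q0) \<in> ?Q"
    by simp
  have one: "A \<one> = (\<one>, q0)"
    unfolding A_def by (rule act_one[OF 1 2 3 4]) auto
  have step: "A (w \<otimes> \<sigma> s) = ?f (A w) s" if "w \<in> carrier G" "s \<in> S" for w s
    unfolding A_def by (rule act_step[OF 1 2 3 4]) (use that in auto)
  have fst: "fst (A w) = w" if "w \<in> carrier G" for w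
    using that by (induction rule: racg_induct) (auto simp: one step split_beta)
  show "snd (A \<one>) = q0"
    by (simp add: one)
  show "snd (A (w \<otimes> \<sigma> s)) = h (cj w (\<sigma> s)) (snd (A w))" if "w \<in> carrier G" "s \<in> S"
    using step[OF that] fst[OF that(1)] by (simp add: split_beta)
qed

lemma side_one [simp]: "\<not> side r \<one>"
  using wall_act(1)[of "\<lambda>a b. b \<noteq> (a = r)" False] unfolding side_def by auto

lemma side_step:
  "w \<in> carrier G \<Longrightarrow> s \<in> S \<Longrightarrow> side r (w \<otimes> \<sigma> s) \<longleftrightarrow> side r w \<noteq> (cj w (\<sigma> s) = r)"
  using wall_act(2)[of "\<lambda>a b. b \<noteq> (a = r)" w s False] unfolding side_def by auto

text \<open>A cocycle identity: a path to \<open>g \<otimes> w\<close> is a path to \<open>g\<close>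
  followed by the translate by \<open>g\<close> of a path to \<open>w\<close>, and translating back
  turns the wall of \<open>r\<close> into that of \<open>cj (inv g) r\<close>.\<close>

lemma side_mult:
  assumes "w \<in> carrier G" "g \<in> carrier G" "r \<in> carrier G"
  shows "side r (g \<otimes> w) \<longleftrightarrow> side r g \<noteq> side (cj (inv g) r) w"
  using assms(1)
proof (induction rule: racg_induct)
  case (step w s)
  have "cj (g \<otimes> w) (\<sigma> s) = r \<longleftrightarrow> cj w (\<sigma> s) = cj (inv g) r"
    using step assms by (metis cj_mult cj_cancel cj_closed \<sigma>_closed inv_closed)
  then show ?case
    using step assms side_step[of "g \<otimes> w" s r] side_step[of w s "cj (inv g) r"]
    by (auto simp: m_assoc)
qed (use assms in simp)

lemma side_self [simp]: "r \<in> reflections \<Longrightarrow> side r r"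
proof -
  assume r: "r \<in> reflections"
  then obtain w s where w: "w \<in> carrier G" "s \<in> S" "r = cj w (\<sigma> s)"
    by (elim reflectionsE)
  then have "r \<otimes> w = w \<otimes> \<sigma> s"
    by (simp add: cj_mult_right)
  then show ?thesis
    using side_mult[of w r r] side_step[of w s r] w r by auto
qed

lemma side_flip [simp]: "r \<in> reflections \<Longrightarrow> x \<in> carrier G \<Longrightarrow> side r (r \<otimes> x) \<longleftrightarrow> \<not> side r x"
  by (simp add: side_mult)

text \<open>For an edge at \<open>w\<close> on the wall of \<open>r\<close>, passing from
  \<open>w\<close> to \<open>r \<otimes> w\<close> crosses no other wall. Since \<open>r\<close>
  preserves the wall of \<open>t\<close>, the cocycle identity carries this from \<open>w\<close> to
  every \<open>x\<close>.\<close>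

lemma side_commute:
  assumes r: "r \<in> reflections" and t: "t \<in> reflections" and "r \<noteq> t" "r \<otimes> t = t \<otimes> r"
    and x: "x \<in> carrier G"
  shows "side t (r \<otimes> x) \<longleftrightarrow> side t x"
proof -
  have c: "cj r t = t"
    using assms by (simp add: reflection_commute_iff)
  obtain w s where w: "w \<in> carrier G" "s \<in> S" "r = cj w (\<sigma> s)"
    using r by (elim reflectionsE)
  then have "r \<otimes> w = w \<otimes> \<sigma> s"
    by (simp add: cj_mult_right)
  then have "\<not> side t r"
    using side_mult[of w r t] side_step[of w s t] w r t c \<open>r \<noteq> t\<close> by auto
  then show ?thesis
    using side_mult[of x r t] r t x c by simp
qed

text \<open>Half-spaces are connected: a path from \<open>x\<close> to \<open>y\<close> is folded
  along the wall of \<open>r\<close>. Its parts on the far side are reflected, its edges on the wall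
  collapse, and the remaining edges stay in the half-space of \<open>x\<close>.\<close>

lemma half_space_induct:
  assumes r: "r \<in> reflections" and x: "x \<in> carrier G" and y: "y \<in> carrier G"
    and same: "side r x = side r y" and base: "P x"
    and step: "\<And>w s. w \<in> carrier G \<Longrightarrow> side r w = side r x \<Longrightarrow> s \<in> S \<Longrightarrow> cj w (\<sigma> s) \<noteq> r \<Longrightarrow>
      P w \<Longrightarrow> P (w \<otimes> \<sigma> s)"
  shows "P y"
proof -
  define f where "f w = (if side r w = side r x then w else r \<otimes> w)" for w
  have f: "f w \<in> carrier G \<and> side r (f w) = side r x" if "w \<in> carrier G" for w
    using that r by (auto simp: f_def)
  have "P (f (x \<otimes> v))" if "v \<in> carrier G" for v
    using that
  proof (induction rule: racg_induct)
    case one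
    then show ?case using x base by (simp add: f_def)
  next
    case (step v s)
    let ?w = "x \<otimes> v"
    have w: "?w \<in> carrier G"
      using step x by simp
    have eq: "x \<otimes> (v \<otimes> \<sigma> s) = ?w \<otimes> \<sigma> s"
      using step x by (simp add: m_assoc)
    show ?case
    proof (cases "cj ?w (\<sigma> s) = r")
      case True
      then have 1: "r \<otimes> ?w = ?w \<otimes> \<sigma> s"
        using w step by (metis cj_mult_right \<sigma>_closed)
      then have 2: "r \<otimes> (?w \<otimes> \<sigma> s) = ?w"
        using r w by (metis reflection_square_left)
      have "side r (?w \<otimes> \<sigma> s) \<noteq> side r ?w"
        using side_step[OF w \<open>s \<in> S\<close>, of r] True by auto
      then have "f (?w \<otimes> \<sigma> s) = f ?w"
        using 1 2 by (auto simp: f_def)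
      then show ?thesis
        using step eq by simp
    next
      case False
      then have "side r (?w \<otimes> \<sigma> s) = side r ?w"
        using side_step[OF w \<open>s \<in> S\<close>, of r] by auto
      then have fs: "f (?w \<otimes> \<sigma> s) = f ?w \<otimes> \<sigma> s"
        using r w step by (simp add: f_def m_assoc)
      have "cj (f ?w) (\<sigma> s) \<noteq> r"
      proof
        assume a: "cj (f ?w) (\<sigma> s) = r"
        then have "cj r (cj ?w (\<sigma> s)) = r"
          using False r w step by (auto simp: f_def cj_mult split: if_splits)
        then have "cj r (cj ?w (\<sigma> s)) = cj r r"
          using r by simp
        then show False
          using False r w step by (subst (asm) cj_inject) auto
      qed
      then show ?thesis
        using assms(6)[of "f ?w" s] f[OF w] step eq fs by simp
    qed
  qed
  from this[of "inv x \<otimes> y"] show ?thesis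
    using x y same by (simp add: f_def)
qed

section \<open>Crossing walls and commuting reflections\<close>

definition crossing :: "'a \<Rightarrow> 'a \<Rightarrow> bool" where
  "crossing r t \<longleftrightarrow> (\<exists>w s s'. w \<in> carrier G \<and> adj s s' \<and> r = cj w (\<sigma> s) \<and> t = cj w (\<sigma> s'))"

lemma crossing_sym: "crossing r t \<Longrightarrow> crossing t r"
  unfolding crossing_def using adj_sym by blast

text \<open>\<open>zig\<close> and \<open>zag\<close> exchange the endpoints of alternate edges of
  the integer line, as the two generators of the infinite dihedral group do on its Cayley graph.
  Applying both twice, alternately, moves every integer by 4.\<close>

definition zig :: "int \<Rightarrow> int" where "zig n = (if even n then n + 1 else n - 1)"
definition zag :: "int \<Rightarrow> int" where "zag n = (if even n then n - 1 else n + 1)"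

lemma zig_zig [simp]: "zig (zig n) = n" and zag_zag [simp]: "zag (zag n) = n"
  and zig_zag_loop: "zig (zag (zig (zag n))) \<noteq> n"
  by (auto simp: zig_def zag_def)

text \<open>
  When \<open>r\<close> and \<open>t\<close> never bound a common square, recording the crossings of their two walls along
  a path gives a position on the line on which the infinite dihedral group \<open>\<langle>zig, zag\<rangle>\<close> acts.
  A loop through the four quadrants would fix a point of that line.
\<close>
lemma four_quadrants_crossing:
  assumes r: "r \<in> reflections" and t: "t \<in> reflections" and "r \<noteq> t"
    and x: "x1 \<in> carrier G" "x2 \<in> carrier G" "x3 \<in> carrier G" "x4 \<in> carrier G"
    and r12: "side r x1 = side r x2" and t23: "side t x2 = side t x3"
    and r34: "side r x3 = side r x4" and t41: "side t x4 = side t x1"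
    and r13: "side r x1 \<noteq> side r x3" and t13: "side t x1 \<noteq> side t x3"
  shows "crossing r t"
proof (rule ccontr)
  assume nc: "\<not> crossing r t"
  define h where "h a n = (if a = r then zig n else if a = t then zag n else n)" for a n
  define Z where "Z w = snd (act (\<lambda>(w, q) s. (w \<otimes> \<sigma> s, h (cj w (\<sigma> s)) q)) (\<one>, 0) w)" for w
  have comm: "h (cj w (\<sigma> s')) (h (cj w (\<sigma> s)) q) = h (cj w (\<sigma> s)) (h (cj w (\<sigma> s')) q)"
    if "w \<in> carrier G" "adj s s'" for w s s' q
  proof -
    have "\<not> (cj w (\<sigma> s) = r \<and> cj w (\<sigma> s') = t)" "\<not> (cj w (\<sigma> s) = t \<and> cj w (\<sigma> s') = r)"
      using nc crossing_sym that unfolding crossing_def by metis+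
    then show ?thesis
      by (auto simp: h_def)
  qed
  have Z: "Z (w \<otimes> \<sigma> s) = h (cj w (\<sigma> s)) (Z w)" if "w \<in> carrier G" "s \<in> S" for w s
    unfolding Z_def by (rule wall_act(2)[where h = h, OF _ comm that]) (auto simp: h_def)
  have zag: "Z y = zag (Z x)"
    if xy: "x \<in> carrier G" "y \<in> carrier G" "side r x = side r y" "side t x \<noteq> side t y" for x y
  proof -
    \<comment> \<open>Inside a half-space of \<open>r\<close> the map \<open>zig\<close> is never
      applied. As \<open>zag\<close> is an involution, the position depends only on the side of the
      wall of \<open>t\<close>.\<close>
    have "if side t y = side t x then Z y = Z x else Z y = zag (Z x)"
      by (rule half_space_induct[OF r xy(1-3)])
        (use \<open>r \<noteq> t\<close> in \<open>auto simp: Z h_def side_step split: if_splits\<close>)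
    then show ?thesis
      using that by (auto split: if_splits)
  qed
  have zig: "Z y = zig (Z x)"
    if xy: "x \<in> carrier G" "y \<in> carrier G" "side t x = side t y" "side r x \<noteq> side r y" for x y
  proof -
    have "if side r y = side r x then Z y = Z x else Z y = zig (Z x)"
      by (rule half_space_induct[OF t xy(1-3)])
        (use \<open>r \<noteq> t\<close> in \<open>auto simp: Z h_def side_step split: if_splits\<close>)
    then show ?thesis
      using that by (auto split: if_splits)
  qed
  have "Z x2 = zag (Z x1)" "Z x3 = zig (Z x2)" "Z x4 = zag (Z x3)" "Z x1 = zig (Z x4)"
    using assms zig zag by metis+
  then show False
    using zig_zag_loop by metis
qed

text \<open>If \<open>r\<close> and \<open>t\<close> commute and differ, then \<open>\<one>\<close>,
  \<open>t\<close>, \<open>r \<otimes> t\<close> and \<open>r\<close> visit the four quadrants in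
  cyclic order.\<close>

lemma crossing_iff:
  assumes r: "r \<in> reflections" and t: "t \<in> reflections"
  shows "crossing r t \<longleftrightarrow> r \<noteq> t \<and> r \<otimes> t = t \<otimes> r"
proof
  assume "crossing r t"
  then show "r \<noteq> t \<and> r \<otimes> t = t \<otimes> r"
    using adjD \<sigma>_commute by (auto simp: crossing_def simp flip: cj_distrib)
next
  assume a: "r \<noteq> t \<and> r \<otimes> t = t \<otimes> r"
  have "side r (t \<otimes> r)" "\<not> side r t" "side t (r \<otimes> t)" "\<not> side t r"
    using side_commute[of t r \<one>] side_commute[of t r r] side_commute[of r t \<one>] side_commute[of r t t]
      a r t by auto
  then show "crossing r t"
    using a r t by (intro four_quadrants_crossing[of r t \<one> t "r \<otimes> t" r]) auto
qed

text \<open>Crossing walls have a common conjugator that takes both reflections to adjacent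
  generators, and the types of reflections are unique.\<close>

lemma commute_adj:
  assumes "r \<in> reflections" "t \<in> reflections" "r \<noteq> t" "r \<otimes> t = t \<otimes> r"
    and "g \<in> carrier G" "h \<in> carrier G" "s \<in> S" "s' \<in> S" "r = cj g (\<sigma> s)" "t = cj h (\<sigma> s')"
  shows "adj s s'"
proof -
  have "crossing r t"
    using assms crossing_iff by simp
  then show ?thesis
    using assms cj_\<sigma>_type adjD unfolding crossing_def by metis
qed

text \<open>An edge on the wall of \<open>t\<close> crosses no other wall, so its two ends agree
  about \<open>r\<close> and differ about \<open>t\<close>. Two such edges on different sides of
  \<open>r\<close> would thus have their four ends in the four quadrants.\<close>

lemma wall_on_one_side:
  assumes r: "r \<in> reflections" and t: "t \<in> reflections" and nc: "r \<otimes> t \<noteq> t \<otimes> r"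
    and v: "v \<in> carrier G" "s \<in> S" "t = cj v (\<sigma> s)" and w: "w \<in> carrier G" "s' \<in> S" "t = cj w (\<sigma> s')"
  shows "side r v = side r w"
proof (rule ccontr)
  assume ne: "side r v \<noteq> side r w"
  have "r \<noteq> t"
    using nc by auto
  have "t \<otimes> v = v \<otimes> \<sigma> s"
    using v by (simp add: cj_mult_right)
  moreover have "t \<otimes> w = w \<otimes> \<sigma> s'"
    using w by (simp add: cj_mult_right)
  ultimately have sr: "side r (t \<otimes> v) = side r v" "side r (t \<otimes> w) = side r w"
    using side_step[of v s r] side_step[of w s' r] v w \<open>r \<noteq> t\<close> by auto
  have "crossing r t"
  proof (cases "side t v = side t w")
    case True
    then show ?thesis
      using ne sr \<open>r \<noteq> t\<close> r t v w
      by (intro four_quadrants_crossing[of r t v "t \<otimes> v" "t \<otimes> w" w]) auto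
  next
    case False
    then show ?thesis
      using ne sr \<open>r \<noteq> t\<close> r t v w
      by (intro four_quadrants_crossing[of r t v "t \<otimes> v" w "t \<otimes> w"]) auto
  qed
  then show False
    using nc crossing_iff r t by simp
qed

text \<open>The wall of \<open>r\<close> separates \<open>\<one>\<close> from the wall of \<open>t\<close>.\<close>
definition beyond :: "'a \<Rightarrow> 'a \<Rightarrow> bool" where
  "beyond r t \<longleftrightarrow> r \<otimes> t \<noteq> t \<otimes> r \<and> (\<exists>w s. w \<in> carrier G \<and> s \<in> S \<and> t = cj w (\<sigma> s) \<and> side r w)"

lemma beyond_side:
  assumes "beyond r t" "r \<in> reflections" "w \<in> carrier G" "s \<in> S" "t = cj w (\<sigma> s)"
  shows "side r w"
proof -
  from assms(1) obtain v s' where v: "r \<otimes> t \<noteq> t \<otimes> r" "v \<in> carrier G" "s' \<in> S" "t = cj v (\<sigma> s')" "side r v"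
    unfolding beyond_def by blast
  have t: "t \<in> reflections"
    using assms by auto
  show ?thesis
    using wall_on_one_side[OF assms(2) t v(1) v(2-4) assms(3-5)] v by simp
qed

lemma crossing_wall:
  assumes "set xs \<subseteq> S" "g \<in> carrier G" "side r (g \<otimes> ev xs) \<noteq> side r g"
  shows "\<exists>ys s zs. xs = ys @ s # zs \<and> cj (g \<otimes> ev ys) (\<sigma> s) = r"
  using assms
proof (induction xs arbitrary: g)
  case (Cons u xs)
  show ?case
  proof (cases "cj g (\<sigma> u) = r")
    case True
    then show ?thesis
      using Cons by (intro exI[of _ "[]"]) simp
  next
    case False
    then have "side r (g \<otimes> \<sigma> u) = side r g"
      using side_step[of g u r] Cons.prems by auto
    then have "side r (g \<otimes> \<sigma> u \<otimes> ev xs) \<noteq> side r (g \<otimes> \<sigma> u)"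
      using Cons.prems by (simp add: m_assoc)
    then obtain ys s zs where "xs = ys @ s # zs" "cj (g \<otimes> \<sigma> u \<otimes> ev ys) (\<sigma> s) = r"
      using Cons.IH[of "g \<otimes> \<sigma> u"] Cons.prems by auto
    then show ?thesis
      using Cons.prems by (intro exI[of _ "u # ys"]) (simp add: m_assoc)
  qed
qed simp

text \<open>The exchange condition: reflecting the rest of the path after the edge on the wall of
  \<open>r\<close> removes the letter of that edge.\<close>

lemma crossing_shorten:
  assumes "set xs \<subseteq> S" "g \<in> carrier G" "r \<in> reflections" "side r (g \<otimes> ev xs) \<noteq> side r g"
  obtains ys where "length ys < length xs" "set ys \<subseteq> S" "r \<otimes> (g \<otimes> ev xs) = g \<otimes> ev ys"
proof -
  obtain ys s zs where xs: "xs = ys @ s # zs" and r: "cj (g \<otimes> ev ys) (\<sigma> s) = r"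
    using crossing_wall[OF assms(1,2,4)] by blast
  have c: "set ys \<subseteq> S" "s \<in> S" "set zs \<subseteq> S"
    using assms xs by auto
  have "r \<otimes> (g \<otimes> ev ys) = g \<otimes> ev ys \<otimes> \<sigma> s"
    using cj_mult_right[of "g \<otimes> ev ys" "\<sigma> s"] r assms c by simp
  then have "r \<otimes> (g \<otimes> ev xs) = (g \<otimes> ev ys \<otimes> \<sigma> s) \<otimes> (\<sigma> s \<otimes> ev zs)"
    using assms c by (simp add: xs ev_append flip: m_assoc)
  also have "\<dots> = g \<otimes> ev (ys @ zs)"
    using assms c by (simp add: ev_append m_assoc)
  finally show ?thesis
    using that[of "ys @ zs"] c xs by simp
qed

section \<open>Distance from the identity to a wall\<close>

definition depth :: "'a \<Rightarrow> nat" where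
  "depth t = (LEAST n. \<exists>xs s. length xs = n \<and> set xs \<subseteq> S \<and> s \<in> S \<and> t = cj (ev xs) (\<sigma> s))"

lemma depth_le: "set xs \<subseteq> S \<Longrightarrow> s \<in> S \<Longrightarrow> depth (cj (ev xs) (\<sigma> s)) \<le> length xs"
  unfolding depth_def by (rule Least_le) auto

lemma depth_witness:
  assumes "t \<in> reflections"
  obtains xs s where "length xs = depth t" "set xs \<subseteq> S" "s \<in> S" "t = cj (ev xs) (\<sigma> s)"
proof -
  obtain w s where w: "w \<in> carrier G" "s \<in> S" "t = cj w (\<sigma> s)"
    using assms by (elim reflectionsE)
  obtain xs where "set xs \<subseteq> S" "ev xs = w"
    using ev_surj[OF w(1)] .
  then have "\<exists>n xs s. length xs = n \<and> set xs \<subseteq> S \<and> s \<in> S \<and> t = cj (ev xs) (\<sigma> s)"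
    using w by blast
  then have "\<exists>xs s. length xs = depth t \<and> set xs \<subseteq> S \<and> s \<in> S \<and> t = cj (ev xs) (\<sigma> s)"
    unfolding depth_def by (rule LeastI_ex)
  then show ?thesis
    using that by blast
qed

text \<open>A shortest word reaching the wall of \<open>t\<close> crosses that of \<open>r\<close>;
  the exchange condition turns it into a shorter word reaching the reflected wall.\<close>

lemma depth_beyond:
  assumes b: "beyond r t" and r: "r \<in> reflections" and t: "t \<in> reflections"
  shows "depth (cj r t) < depth t"
proof -
  obtain xs s where xs: "length xs = depth t" "set xs \<subseteq> S" "s \<in> S" "t = cj (ev xs) (\<sigma> s)"
    using depth_witness[OF t] .
  have "side r (\<one> \<otimes> ev xs) \<noteq> side r \<one>"
    using beyond_side[OF b r] xs by simp
  then obtain ys where ys: "length ys < length xs" "set ys \<subseteq> S" "r \<otimes> (\<one> \<otimes> ev xs) = \<one> \<otimes> ev ys"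
    using crossing_shorten[OF xs(2) _ r] by blast
  then have "cj r t = cj (ev ys) (\<sigma> s)"
    using xs r by (metis cj_mult ev_closed l_one reflections_closed \<sigma>_closed)
  then show ?thesis
    using depth_le[of ys s] ys xs by simp
qed

text \<open>\<open>u\<close> is the first letter of a shortest word to the wall. If
  \<open>\<sigma> u\<close> commuted with \<open>t\<close>, that letter could be dropped; if its
  wall did not separate, the word would cross it a second time and could be shortened.\<close>

lemma depth_pos_beyond:
  assumes t: "t \<in> reflections" and "depth t > 0"
  obtains u where "u \<in> S" "beyond (\<sigma> u) t"
proof -
  obtain xs s where xs: "length xs = depth t" "set xs \<subseteq> S" "s \<in> S" "t = cj (ev xs) (\<sigma> s)"
    using depth_witness[OF t] .
  then obtain u us where us: "xs = u # us"
    using assms(2) by (cases xs) auto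
  have u: "u \<in> S" "set us \<subseteq> S"
    using us xs by auto
  have "\<sigma> u \<otimes> t \<noteq> t \<otimes> \<sigma> u"
  proof
    assume "\<sigma> u \<otimes> t = t \<otimes> \<sigma> u"
    then have "t = cj (\<sigma> u) t"
      using u t by (simp add: cj_commute)
    also have "\<dots> = cj (ev us) (\<sigma> s)"
      using u xs us by (simp flip: cj_mult)
    finally show False
      using depth_le[OF u(2) xs(3)] xs(1) us by simp
  qed
  moreover have "side (\<sigma> u) (ev xs)"
  proof (rule ccontr)
    assume "\<not> side (\<sigma> u) (ev xs)"
    then have "side (\<sigma> u) (\<sigma> u \<otimes> ev us) \<noteq> side (\<sigma> u) (\<sigma> u)"
      using u us by simp
    then obtain ys where ys: "length ys < length us" "set ys \<subseteq> S"
      "\<sigma> u \<otimes> (\<sigma> u \<otimes> ev us) = \<sigma> u \<otimes> ev ys"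
      using crossing_shorten[of us "\<sigma> u" "\<sigma> u"] u by auto
    then have "ev xs = ev ys"
      using u us by (metis \<sigma>_closed \<sigma>_square_left ev_Cons ev_closed)
    then show False
      using depth_le[OF ys(2) xs(3)] xs ys us by simp
  qed
  ultimately have "beyond (\<sigma> u) t"
    unfolding beyond_def using xs by (auto intro!: exI[of _ "ev xs"])
  then show ?thesis
    using that u by blast
qed

end


section \<open>Endomorphisms that preserve the types of reflections\<close>

lemma (in group) hom_cj:
  assumes "f \<in> hom G G" "g \<in> carrier G" "x \<in> carrier G"
  shows "f (cj g x) = cj (f g) (f x)"
proof -
  interpret group_hom G G f
    using assms by unfold_locales
  show ?thesis
    using assms by (simp add: cj_def)
qed

context racg
begin

definition clique :: "'s set \<Rightarrow> bool" where
  "clique T \<longleftrightarrow> T \<subseteq> S \<and> (\<forall>s\<in>T. \<forall>t\<in>T. s \<noteq> t \<longrightarrow> adj s t)"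

text \<open>The clique may be empty, so connectedness of the graph of commuting generators is
  included whenever it has at least two vertices.\<close>

definition no_separating_clique :: bool where
  "no_separating_clique \<longleftrightarrow> (\<forall>T1 T2. T1 \<subseteq> S \<and> T2 \<subseteq> S \<and> T1 \<noteq> {} \<and> T2 \<noteq> {} \<and> T1 \<inter> T2 = {} \<and>
     (\<forall>s\<in>T1. \<forall>t\<in>T2. \<not> adj s t) \<longrightarrow> \<not> clique (S - T1 - T2))"

text \<open>Two non-commuting reflections generate an infinite dihedral group. A violation would
  thus give two such groups commuting with each other.\<close>

definition no_reflection_flat :: bool where
  "no_reflection_flat \<longleftrightarrow>
     (\<forall>a0\<in>reflections. \<forall>a1\<in>reflections. \<forall>b0\<in>reflections. \<forall>b1\<in>reflections.
        a0 \<otimes> b0 = b0 \<otimes> a0 \<and> a0 \<otimes> b1 = b1 \<otimes> a0 \<and> a1 \<otimes> b0 = b0 \<otimes> a1 \<and> a1 \<otimes> b1 = b1 \<otimes> a1 \<longrightarrow>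
        a0 \<otimes> a1 = a1 \<otimes> a0 \<or> b0 \<otimes> b1 = b1 \<otimes> b0)"

text \<open>The walls of \<open>t\<close> and \<open>t'\<close> both have an edge at the corner
  \<open>w\<close> of a common square, and this corner lies beyond \<open>r\<close>.\<close>

lemma beyond_crossing:
  assumes "beyond r t" "crossing t t'" "r \<in> reflections" "r \<otimes> t' \<noteq> t' \<otimes> r"
  shows "beyond r t'"
proof -
  obtain w s s' where w: "w \<in> carrier G" "adj s s'" "t = cj w (\<sigma> s)" "t' = cj w (\<sigma> s')"
    using assms(2) unfolding crossing_def by blast
  then have "side r w"
    using beyond_side[OF assms(1,3)] adjD by blast
  then show ?thesis
    using assms(4) w adjD unfolding beyond_def by blast
qed

text \<open>Taking \<open>t' = s\<close> in the closure condition shows that \<open>K\<close>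
  contains no neighbour of \<open>s\<close>; hence \<open>K\<close> is a union of components of the
  graph with \<open>s\<close> and its neighbours removed. An edge leaving \<open>K\<close> ends in a
  generator commuting with \<open>s\<close>, so conjugating only \<open>K\<close> respects the
  relations. As \<open>\<sigma> s\<close> itself is fixed, doing this twice undoes it.\<close>

lemma partial_conjugation:
  assumes s: "s \<in> S" and K: "K \<subseteq> S" "s \<notin> K"
    and closed: "\<And>t t'. t \<in> K \<Longrightarrow> adj t t' \<Longrightarrow> t' \<in> K \<or> adj s t'"
  obtains \<alpha> where "\<alpha> \<in> hom G G" "\<And>g. g \<in> carrier G \<Longrightarrow> \<alpha> (\<alpha> g) = g"
    "\<And>t. t \<in> S \<Longrightarrow> \<alpha> (\<sigma> t) = (if t \<in> K then cj (\<sigma> s) (\<sigma> t) else \<sigma> t)"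
proof -
  define f where "f t = (if t \<in> K then cj (\<sigma> s) (\<sigma> t) else \<sigma> t)" for t
  have half: "cj (\<sigma> s) (\<sigma> t) \<otimes> \<sigma> t' = \<sigma> t' \<otimes> cj (\<sigma> s) (\<sigma> t)"
    if "t \<in> K" "t' \<notin> K" "adj t t'" for t t'
  proof -
    have st: "t \<in> S" "t' \<in> S" "adj s t'"
      using adjD[OF that(3)] closed that by auto
    then have "cj (\<sigma> s) (\<sigma> t') = \<sigma> t'"
      using s \<sigma>_commute by (intro cj_commute) auto
    then show ?thesis
      using \<sigma>_commute[OF that(3)] cj_distrib[of "\<sigma> s" "\<sigma> t" "\<sigma> t'"]
        cj_distrib[of "\<sigma> s" "\<sigma> t'" "\<sigma> t"] s st by simp
  qed
  have sq: "f t \<otimes> f t = \<one>" if "t \<in> S" for t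
    using that s by (simp add: f_def)
  have "f t \<otimes> f t' = f t' \<otimes> f t" if "adj t t'" for t t'
  proof -
    have "t \<in> S" "t' \<in> S"
      using adjD[OF that] by auto
    then have "cj (\<sigma> s) (\<sigma> t) \<otimes> cj (\<sigma> s) (\<sigma> t') = cj (\<sigma> s) (\<sigma> t') \<otimes> cj (\<sigma> s) (\<sigma> t)"
      using s \<sigma>_commute[OF that] by (metis cj_distrib \<sigma>_closed)
    then show ?thesis
      using half[OF _ _ that] half[OF _ _ adj_sym[OF that]] \<sigma>_commute[OF that]
      unfolding f_def by presburger
  qed
  note comm = this
  have fc: "f t \<in> carrier G" if "t \<in> S" for t
    using that s by (simp add: f_def)
  obtain \<alpha> where \<alpha>: "\<alpha> \<in> hom G G" "\<And>t. t \<in> S \<Longrightarrow> \<alpha> (\<sigma> t) = f t"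
    using hom_extend[where f = f, OF is_group fc sq comm] by blast
  have "(\<alpha> \<circ> \<alpha>) g = id g" if "g \<in> carrier G" for g
  proof (rule hom_eqI[OF is_group _ _ _ that])
    show "\<alpha> \<circ> \<alpha> \<in> hom G G"
      using \<alpha>(1) by (simp add: hom_def Pi_iff)
    show "id \<in> hom G G"
      by (simp add: hom_def)
    show "(\<alpha> \<circ> \<alpha>) (\<sigma> t) = id (\<sigma> t)" if "t \<in> S" for t
      using hom_cj[OF \<alpha>(1), of "\<sigma> s" "\<sigma> t"] that s K \<alpha>(2)[of s] \<alpha>(2)[of t]
      by (auto simp: f_def simp flip: cj_mult)
  qed
  then show ?thesis
    using that[of \<alpha>] \<alpha> f_def by simp
qed

text \<open>
  Induction on the total distance of the walls of \<open>\<phi> s\<close> from \<open>\<one>\<close>.  It drops under a partial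
  conjugation if one of these walls separates \<open>\<one>\<close> from another one, and otherwise under
  conjugation by a generator \<open>u\<close> towards some wall, unless that moves away from some other wall.
  In the last case the walls crossing that of \<open>u\<close> separate the graph; two of them that do not
  cross span, together with \<open>u\<close> and \<open>\<phi> u\<close>, a product of two infinite dihedral groups.
\<close>
theorem type_preserving_bij:
  assumes fin: "finite S" and sep: no_separating_clique and flat: no_reflection_flat
    and "\<phi> \<in> hom G G" and "\<And>s. s \<in> S \<Longrightarrow> \<exists>g\<in>carrier G. \<phi> (\<sigma> s) = cj g (\<sigma> s)"
  shows "bij_betw \<phi> (carrier G) (carrier G)"
  using assms(4,5)
proof (induction \<phi> rule: measure_induct_rule[of "\<lambda>\<phi>. \<Sum>s\<in>S. depth (\<phi> (\<sigma> s))"])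
  case (less \<phi>)
  define r where "r s = \<phi> (\<sigma> s)" for s
  have r: "\<exists>g\<in>carrier G. r s = cj g (\<sigma> s)" if "s \<in> S" for s
    using less.prems(2) that by (simp add: r_def)
  then have refl [simp]: "r s \<in> reflections" if "s \<in> S" for s
    using that by fastforce
  have r_adj: "adj s t" if "s \<in> S" "t \<in> S" "r s \<noteq> r t" "r s \<otimes> r t = r t \<otimes> r s" for s t
    using r[OF that(1)] r[OF that(2)] commute_adj[OF _ _ that(3,4)] that(1,2) refl by blast
  have adj_r: "r s \<otimes> r t = r t \<otimes> r s" if "adj s t" for s t
    using \<sigma>_commute[OF that] adjD[OF that] hom_mult[OF less.prems(1)] unfolding r_def
    by (metis \<sigma>_closed)
  have r_eq: "s = t" if "r s = r t" "s \<in> S" "t \<in> S" for s t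
    using r[OF that(2)] r[OF that(3)] cj_\<sigma>_type that by metis
  have r_\<sigma>: "s = t" if "r s = \<sigma> t" "s \<in> S" "t \<in> S" for s t
    using r[OF that(2)] cj_\<sigma>_type[of _ \<one> s t] that by auto
  have cross: "crossing (r s) (r t)" if "adj s t" for s t
    using adj_r[OF that] r_eq[of s t] adjD[OF that] crossing_iff by auto
  show ?case
  proof (cases "\<exists>s\<in>S. \<exists>t\<in>S. beyond (r s) (r t)")
    case True
    then obtain s t0 where s: "s \<in> S" and t0: "t0 \<in> S" "beyond (r s) (r t0)"
      by blast
    define K where "K = {t \<in> S. beyond (r s) (r t)}"
    \<comment> \<open>A wall crossing one beyond \<open>r s\<close> is itself beyond
      \<open>r s\<close> unless it crosses \<open>r s\<close>; crossing images come from adjacent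
      generators.\<close>
    have "t' \<in> K \<or> adj s t'" if "t \<in> K" "adj t t'" for t t'
    proof (cases "t' \<in> K")
      case False
      have t: "t \<in> S" "beyond (r s) (r t)" "t' \<in> S"
        using that adjD[OF that(2)] by (auto simp: K_def)
      then have c: "r s \<otimes> r t' = r t' \<otimes> r s"
        using beyond_crossing[OF t(2) cross[OF that(2)]] False s by (auto simp: K_def)
      moreover have "r s \<noteq> r t'"
        using adj_r[OF that(2)] t(2) by (auto simp: beyond_def)
      ultimately show ?thesis
        using r_adj s t by blast
    qed simp
    moreover have "K \<subseteq> S" "s \<notin> K"
      by (auto simp: K_def beyond_def)
    ultimately obtain \<alpha> where \<alpha>: "\<alpha> \<in> hom G G" "\<And>g. g \<in> carrier G \<Longrightarrow> \<alpha> (\<alpha> g) = g"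
      "\<And>t. t \<in> S \<Longrightarrow> \<alpha> (\<sigma> t) = (if t \<in> K then cj (\<sigma> s) (\<sigma> t) else \<sigma> t)"
      using partial_conjugation[OF s, of K] by blast
    have \<alpha>_closed: "\<alpha> g \<in> carrier G" if "g \<in> carrier G" for g
      using \<alpha>(1) that by (rule hom_in_carrier)
    \<comment> \<open>Precomposing with a conjugation by \<open>\<sigma> s\<close> conjugates the
      images by \<open>r s\<close>: exactly the walls beyond that of \<open>r s\<close> are
      reflected in it, and so come closer.\<close>
    have \<phi>\<alpha>: "(\<phi> \<circ> \<alpha>) (\<sigma> t) = (if t \<in> K then cj (r s) (r t) else r t)" if "t \<in> S" for t
      using hom_cj[OF less.prems(1), of "\<sigma> s" "\<sigma> t"] that s \<alpha>(3)[OF that] by (simp add: r_def)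
    have "bij_betw (\<phi> \<circ> \<alpha>) (carrier G) (carrier G)"
    proof (rule less.IH)
      show "(\<Sum>t\<in>S. depth ((\<phi> \<circ> \<alpha>) (\<sigma> t))) < (\<Sum>t\<in>S. depth (\<phi> (\<sigma> t)))"
      proof (rule sum_strict_mono_ex1[OF fin])
        show "\<forall>t\<in>S. depth ((\<phi> \<circ> \<alpha>) (\<sigma> t)) \<le> depth (\<phi> (\<sigma> t))"
          using \<phi>\<alpha> depth_beyond[of "r s"] s by (auto simp: K_def less_imp_le simp flip: r_def)
        show "\<exists>t\<in>S. depth ((\<phi> \<circ> \<alpha>) (\<sigma> t)) < depth (\<phi> (\<sigma> t))"
          using \<phi>\<alpha>[OF t0(1)] depth_beyond[OF t0(2)] s t0
          by (intro bexI[of _ t0]) (auto simp: K_def simp flip: r_def)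
      qed
      show "\<phi> \<circ> \<alpha> \<in> hom G G"
        using \<alpha>(1) less.prems(1) by (simp add: hom_def Pi_iff)
      show "\<exists>g\<in>carrier G. (\<phi> \<circ> \<alpha>) (\<sigma> t) = cj g (\<sigma> t)" if t: "t \<in> S" for t
      proof -
        obtain g where "g \<in> carrier G" "r t = cj g (\<sigma> t)"
          using r[OF t] by blast
        then show ?thesis
          using \<phi>\<alpha>[OF t] s t by (auto simp flip: cj_mult)
      qed
    qed
    moreover have "bij_betw \<alpha> (carrier G) (carrier G)"
      by (rule bij_betwI[of _ _ _ \<alpha>]) (use \<alpha>_closed \<alpha>(2) in auto)
    ultimately have "bij_betw ((\<phi> \<circ> \<alpha>) \<circ> \<alpha>) (carrier G) (carrier G)"
      using bij_betw_trans by blast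
    then show ?thesis
      by (rule bij_betw_cong[THEN iffD1, rotated]) (simp add: \<alpha>(2))
  next
    case nb: False
    show ?thesis
    proof (cases "\<forall>s\<in>S. depth (r s) = 0")
      case True
      have "\<phi> (\<sigma> s) = id (\<sigma> s)" if s: "s \<in> S" for s
      proof -
        obtain xs s' where "length xs = depth (r s)" "s' \<in> S" "r s = cj (ev xs) (\<sigma> s')"
          using depth_witness[OF refl[OF s]] by blast
        then have "r s = \<sigma> s'" "s' \<in> S"
          using True s by auto
        then show ?thesis
          using r_\<sigma>[of s s'] s by (simp add: r_def)
      qed
      then have "\<phi> g = id g" if "g \<in> carrier G" for g
        using hom_eqI[OF is_group less.prems(1), of id] that by (simp add: hom_def)
      then show ?thesis
        by (subst bij_betw_cong[of _ _ id]) auto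
    next
      case False
      then obtain s where s: "s \<in> S" "depth (r s) > 0"
        by auto
      obtain u where u: "u \<in> S" "beyond (\<sigma> u) (r s)"
        using depth_pos_beyond[OF refl[OF s(1)] s(2)] .
      \<comment> \<open>Otherwise the image \<open>r u\<close> itself would separate
        \<open>\<one>\<close> from the wall of \<open>r s\<close>, which this case excludes.\<close>
      have ru: "r u \<noteq> \<sigma> u"
        using nb u s by metis
      \<comment> \<open>The image walls are sorted by their position relative to the wall of
        \<open>u\<close>: beyond it in \<open>T1\<close>, crossing it in \<open>T0\<close>, and on
        the side of \<open>\<one>\<close> in \<open>T2\<close>.\<close>
      define T1 where "T1 = {t \<in> S. beyond (\<sigma> u) (r t)}"
      define T0 where "T0 = {t \<in> S. \<sigma> u \<otimes> r t = r t \<otimes> \<sigma> u}"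
      define T2 where "T2 = S - T0 - T1"
      have sT1: "s \<in> T1"
        using s u by (simp add: T1_def)
      have T01: "T0 \<inter> T1 = {}"
        by (auto simp: T0_def T1_def beyond_def)
      have T0_adj: "adj u t" if "t \<in> T0" for t
      proof -
        have t: "t \<in> S" "\<sigma> u \<otimes> r t = r t \<otimes> \<sigma> u"
          using that by (auto simp: T0_def)
        have "\<sigma> u \<noteq> r t"
          using r_\<sigma>[of t u] t u ru by metis
        moreover obtain g where "g \<in> carrier G" "r t = cj g (\<sigma> t)"
          using r[OF t(1)] by blast
        ultimately show ?thesis
          using commute_adj[of "\<sigma> u" "r t" \<one> g u t] t u by simp
      qed
      show ?thesis
      proof (cases "T2 = {}")
        case True
        have \<phi>u: "(cj (\<sigma> u) \<circ> \<phi>) (\<sigma> t) = cj (\<sigma> u) (r t)" for t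
          by (simp add: r_def)
        have le: "depth (cj (\<sigma> u) (r t)) \<le> depth (r t)" if "t \<in> S" for t
        proof (cases "t \<in> T0")
          case True
          then have "cj (\<sigma> u) (r t) = r t"
            using that u by (intro cj_commute) (auto simp: T0_def)
          then show ?thesis by simp
        next
          case False
          then have "beyond (\<sigma> u) (r t)"
            using \<open>T2 = {}\<close> that by (auto simp: T2_def T1_def)
          then show ?thesis
            using depth_beyond that u by (simp add: less_imp_le)
        qed
        have "bij_betw (cj (\<sigma> u) \<circ> \<phi>) (carrier G) (carrier G)"
        proof (rule less.IH)
          show "(\<Sum>t\<in>S. depth ((cj (\<sigma> u) \<circ> \<phi>) (\<sigma> t))) < (\<Sum>t\<in>S. depth (\<phi> (\<sigma> t)))"
            unfolding \<phi>u r_def[symmetric]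
            using le depth_beyond[OF u(2)] u s by (intro sum_strict_mono_ex1[OF fin]) auto
          show "cj (\<sigma> u) \<circ> \<phi> \<in> hom G G"
            using Group.hom_compose[OF less.prems(1) cj_hom] u by simp
          show "\<exists>g\<in>carrier G. (cj (\<sigma> u) \<circ> \<phi>) (\<sigma> t) = cj g (\<sigma> t)" if t: "t \<in> S" for t
          proof -
            obtain g where "g \<in> carrier G" "r t = cj g (\<sigma> t)"
              using r[OF t] by blast
            then show ?thesis
              unfolding \<phi>u using u t by (auto simp flip: cj_mult)
          qed
        qed
        then have "bij_betw (cj (\<sigma> u) \<circ> (cj (\<sigma> u) \<circ> \<phi>)) (carrier G) (carrier G)"
          using bij_betw_trans bij_cj u \<sigma>_closed by blast
        moreover have "(cj (\<sigma> u) \<circ> (cj (\<sigma> u) \<circ> \<phi>)) g = \<phi> g" if "g \<in> carrier G" for g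
          using hom_in_carrier[OF less.prems(1) that] u by (simp flip: cj_mult)
        ultimately show ?thesis
          using bij_betw_cong by blast
      next
        case T2: False
        have "\<not> adj t t'" if t: "t \<in> T1" "t' \<in> T2" for t t'
        proof
          assume "adj t t'"
          then have "beyond (\<sigma> u) (r t')"
            using beyond_crossing[OF _ cross[OF \<open>adj t t'\<close>]] u t by (auto simp: T1_def T2_def T0_def)
          then show False
            using t by (auto simp: T2_def T1_def)
        qed
        moreover have "S - T1 - T2 = T0"
          using T01 by (auto simp: T2_def T0_def)
        ultimately have "\<not> clique T0"
          using sep[unfolded no_separating_clique_def, rule_format, of T1 T2] T2 sT1
          by (auto simp: T1_def T2_def)
        then obtain x y where xy: "x \<in> T0" "y \<in> T0" "x \<noteq> y" "\<not> adj x y"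
          by (auto simp: clique_def T0_def)
        then have S: "x \<in> S" "y \<in> S" and c: "\<sigma> u \<otimes> r x = r x \<otimes> \<sigma> u" "\<sigma> u \<otimes> r y = r y \<otimes> \<sigma> u"
          by (auto simp: T0_def)
        have "r x \<otimes> r y \<noteq> r y \<otimes> r x"
          using r_adj[OF S] r_eq[of x y] S xy by blast
        \<comment> \<open>If they commuted, \<open>u\<close> would belong to \<open>T0\<close> and
          hence be adjacent to itself.\<close>
        moreover have "\<sigma> u \<otimes> r u \<noteq> r u \<otimes> \<sigma> u"
          using T0_adj[of u] u by (auto simp: T0_def)
        ultimately show ?thesis
          using flat[unfolded no_reflection_flat_def, rule_format, of "r x" "r y" "\<sigma> u" "r u"]
            c adj_r[OF T0_adj[OF xy(1)]] adj_r[OF T0_adj[OF xy(2)]] S u by simp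
      qed
    qed
  qed
qed

end


section \<open>Involutions\<close>

context group
begin

definition conjugate :: "'a \<Rightarrow> 'a \<Rightarrow> bool" where
  "conjugate x y \<longleftrightarrow> (\<exists>g\<in>carrier G. y = cj g x)"

lemma conjugate_refl: "x \<in> carrier G \<Longrightarrow> conjugate x x"
  unfolding conjugate_def by (rule bexI[of _ \<one>]) auto

lemma conjugate_sym: "x \<in> carrier G \<Longrightarrow> conjugate x y \<Longrightarrow> conjugate y x"
  unfolding conjugate_def by (metis cj_cancel(1) inv_closed)

lemma conjugate_trans: "x \<in> carrier G \<Longrightarrow> conjugate x y \<Longrightarrow> conjugate y z \<Longrightarrow> conjugate x z"
  unfolding conjugate_def by (metis cj_mult m_closed)

lemma conjugate_hom:
  "f \<in> hom G G \<Longrightarrow> x \<in> carrier G \<Longrightarrow> conjugate x y \<Longrightarrow> conjugate (f x) (f y)"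
  unfolding conjugate_def by (metis hom_cj hom_in_carrier)

lemma conjugacy_representatives:
  assumes "finite P" "P \<subseteq> carrier G"
  obtains R where "R \<subseteq> P" "\<And>x. x \<in> P \<Longrightarrow> \<exists>y\<in>R. conjugate y x"
    "\<And>x y. x \<in> R \<Longrightarrow> y \<in> R \<Longrightarrow> conjugate x y \<Longrightarrow> x = y"
  using assms
proof (induction arbitrary: thesis rule: finite_induct)
  case empty
  then show ?case by blast
next
  case (insert a P)
  then obtain R where R: "R \<subseteq> P" "\<And>x. x \<in> P \<Longrightarrow> \<exists>y\<in>R. conjugate y x"
    "\<And>x y. x \<in> R \<Longrightarrow> y \<in> R \<Longrightarrow> conjugate x y \<Longrightarrow> x = y"
    by blast
  show ?case
  proof (cases "\<exists>y\<in>R. conjugate y a")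
    case True
    then show ?thesis
      using insert.prems(1)[of R] R by blast
  next
    case False
    have "x = y" if "x \<in> insert a R" "y \<in> insert a R" "conjugate x y" for x y
    proof -
      have "conjugate y x"
        using that insert.prems R by (intro conjugate_sym[of x y]) auto
      then show ?thesis
        using that R False by auto
    qed
    moreover have "\<exists>y\<in>insert a R. conjugate y x" if "x \<in> insert a P" for x
      using that R conjugate_refl[of a] insert.prems by auto
    ultimately show ?thesis
      using insert.prems(1)[of "insert a R"] R by blast
  qed
qed

lemma funpow_hom: "f \<in> hom G G \<Longrightarrow> (f ^^ n) \<in> hom G G"
  by (induction n) (auto simp: hom_def Pi_iff)

text \<open>The induced map on conjugacy classes of involutions is a permutation, so it has finite order.\<close>
lemma power_preserves_classes:
  assumes f: "f \<in> hom G G" and fin: "finite R" and RG: "R \<subseteq> carrier G"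
    and R2: "\<And>x. x \<in> R \<Longrightarrow> x \<otimes> x = \<one>"
    and cover: "\<And>x. x \<in> carrier G \<Longrightarrow> x \<otimes> x = \<one> \<Longrightarrow> \<exists>y\<in>R. conjugate y x"
    and inj: "\<And>x y. x \<in> R \<Longrightarrow> y \<in> R \<Longrightarrow> conjugate (f x) (f y) \<Longrightarrow> x = y"
  obtains n where "n > 0" "\<And>x. x \<in> carrier G \<Longrightarrow> x \<otimes> x = \<one> \<Longrightarrow> conjugate x ((f ^^ n) x)"
proof -
  have fc: "f x \<in> carrier G" if "x \<in> carrier G" for x
    using f that by (rule hom_in_carrier)
  have "f x \<otimes> f x = \<one>" if "x \<in> R" for x
    using hom_mult[OF f, of x x] hom_one[OF f is_group is_group] R2[OF that] RG that by auto
  then have "\<forall>x\<in>R. \<exists>y\<in>R. conjugate y (f x)"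
    using cover fc RG by blast
  then obtain h where h: "\<And>x. x \<in> R \<Longrightarrow> h x \<in> R \<and> conjugate (h x) (f x)"
    by metis
  have "inj_on h R"
  proof (rule inj_onI)
    fix x y assume xy: "x \<in> R" "y \<in> R" "h x = h y"
    then have "conjugate (f x) (h x)" "conjugate (h x) (f y)"
      using h[of x] h[of y] RG by (auto intro!: conjugate_sym[of "h y" "f x"])
    then show "x = y"
      using xy inj conjugate_trans[OF fc] RG by blast
  qed
  moreover have hR: "h ` R \<subseteq> R"
    using h by blast
  ultimately have "bij_betw h R R"
    using endo_inj_surj[OF fin] by (simp add: bij_betw_def)
  \<comment> \<open>The map is extended by the identity outside \<open>R\<close> to become a
    permutation of the whole type, as required for its nilpotency.\<close>
  then have "bij_betw (\<lambda>x. if x \<in> R then h x else x) R R"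
    by (rule bij_betw_cong[THEN iffD1, rotated]) simp
  then have "(\<lambda>x. if x \<in> R then h x else x) permutes R"
    by (rule bij_imp_permutes) simp
  then have "permutation (\<lambda>x. if x \<in> R then h x else x)"
    using fin by (auto simp: permutation_permutes)
  then obtain n where n: "((\<lambda>x. if x \<in> R then h x else x) ^^ n) = id" "n > 0"
    using permutation_is_nilpotent by metis
  have pow: "((\<lambda>x. if x \<in> R then h x else x) ^^ k) x \<in> R \<and>
      conjugate (((\<lambda>x. if x \<in> R then h x else x) ^^ k) x) ((f ^^ k) x)" if "x \<in> R" for k x
  proof (induction k)
    case 0
    then show ?case using that RG conjugate_refl by auto
  next
    case (Suc k)
    let ?y = "((\<lambda>x. if x \<in> R then h x else x) ^^ k) x"
    have "conjugate (h ?y) (f ?y)" "conjugate (f ?y) (f ((f ^^ k) x))"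
      using h Suc conjugate_hom[OF f] RG by auto
    then have "conjugate (h ?y) (f ((f ^^ k) x))"
      using conjugate_trans[of "h ?y"] h Suc RG by blast
    then show ?case
      using Suc h by simp
  qed
  have R: "conjugate x ((f ^^ n) x)" if "x \<in> R" for x
    using pow[OF that, of n] n by simp
  have "conjugate x ((f ^^ n) x)" if x: "x \<in> carrier G" "x \<otimes> x = \<one>" for x
  proof -
    obtain y where y: "y \<in> R" "conjugate y x"
      using cover[OF x] by blast
    then have yG: "y \<in> carrier G"
      using RG by blast
    have "conjugate x y"
      using conjugate_sym[OF yG] y by blast
    moreover have "conjugate ((f ^^ n) y) ((f ^^ n) x)"
      using conjugate_hom[OF funpow_hom[OF f] yG y(2)] .
    ultimately show ?thesis
      using R[OF y(1)] conjugate_trans x(1) yG by blast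
  qed
  then show ?thesis
    using that n by blast
qed

end

context racg
begin

section \<open>Word length, descents and conjugacy classes of involutions\<close>

lemma inv_ev: "set xs \<subseteq> S \<Longrightarrow> inv (ev xs) = ev (rev xs)"
  by (induction xs) (auto simp: inv_mult_group ev_append)

definition len :: "'a \<Rightarrow> nat" where
  "len g = (LEAST n. \<exists>xs. length xs = n \<and> set xs \<subseteq> S \<and> ev xs = g)"

lemma len_le: "set xs \<subseteq> S \<Longrightarrow> len (ev xs) \<le> length xs"
  unfolding len_def by (rule Least_le) auto

lemma len_witness:
  assumes "g \<in> carrier G"
  obtains xs where "length xs = len g" "set xs \<subseteq> S" "ev xs = g"
proof -
  have "\<exists>n xs. length xs = n \<and> set xs \<subseteq> S \<and> ev xs = g"
    using ev_surj[OF assms] by metis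
  then have "\<exists>xs. length xs = len g \<and> set xs \<subseteq> S \<and> ev xs = g"
    unfolding len_def by (rule LeastI_ex)
  then show ?thesis
    using that by blast
qed

lemma len_descent:
  assumes u: "u \<in> S" and g: "g \<in> carrier G" and s: "side (\<sigma> u) g"
  shows "len (\<sigma> u \<otimes> g) < len g"
proof -
  obtain xs where xs: "length xs = len g" "set xs \<subseteq> S" "ev xs = g"
    using len_witness[OF g] .
  have "side (\<sigma> u) (\<one> \<otimes> ev xs) \<noteq> side (\<sigma> u) \<one>"
    using s xs g by simp
  then obtain ys where "length ys < length xs" "set ys \<subseteq> S" "\<sigma> u \<otimes> (\<one> \<otimes> ev xs) = \<one> \<otimes> ev ys"
    using crossing_shorten[OF xs(2) one_closed \<sigma>_reflection[OF u]] by blast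
  then show ?thesis
    using len_le[of ys] xs g by simp
qed

lemma descent_exists:
  assumes g: "g \<in> carrier G" "g \<noteq> \<one>"
  obtains u where "u \<in> S" "side (\<sigma> u) g"
proof -
  obtain xs where xs: "length xs = len g" "set xs \<subseteq> S" "ev xs = g"
    using len_witness[OF g(1)] .
  then obtain u us where us: "xs = u # us"
    using g(2) by (cases xs) auto
  have u: "u \<in> S" "set us \<subseteq> S" "g = \<sigma> u \<otimes> ev us"
    using us xs by auto
  have "side (\<sigma> u) g"
  proof (rule ccontr)
    assume "\<not> side (\<sigma> u) g"
    then have "side (\<sigma> u) (ev us)"
      using u by simp
    then have "len g < len (ev us)"
      using len_descent[of u "ev us"] u by simp
    then show False
      using len_le[OF u(2)] xs us by simp
  qed
  then show ?thesis
    using that u by blast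
qed

text \<open>Split off one descent \<open>u\<close>, leaving \<open>h\<close>. A descent
  \<open>v\<close> of \<open>h\<close> is still one of \<open>g\<close>, because the step from
  \<open>h\<close> to \<open>g\<close> crosses only the wall of \<open>u\<close>. Then
  \<open>\<one>\<close>, \<open>\<sigma> u\<close>, \<open>g\<close>, \<open>h\<close> lie in the
  four quadrants of the two walls, so \<open>v\<close> commutes with \<open>u\<close> and therefore
  with \<open>h\<close>, and the induction continues. The letters are distinct since
  \<open>u\<close> is no descent of \<open>h\<close>.\<close>

lemma central_descents_product:
  assumes "g \<in> carrier G" "g \<otimes> g = \<one>"
    and "\<And>u. u \<in> S \<Longrightarrow> side (\<sigma> u) g \<Longrightarrow> \<sigma> u \<otimes> g = g \<otimes> \<sigma> u"
  shows "\<exists>xs. distinct xs \<and> set xs \<subseteq> {u \<in> S. side (\<sigma> u) g} \<and> ev xs = g"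
  using assms
proof (induction g rule: measure_induct_rule[of len])
  case (less g)
  show ?case
  proof (cases "g = \<one>")
    case True
    then show ?thesis
      by (intro exI[of _ "[]"]) simp
  next
    case False
    obtain u where u: "u \<in> S" "side (\<sigma> u) g"
      using descent_exists[OF less.prems(1) False] .
    define h where "h = \<sigma> u \<otimes> g"
    have ug: "\<sigma> u \<otimes> g = g \<otimes> \<sigma> u"
      using less.prems(3) u by blast
    have h: "h \<in> carrier G" "g = \<sigma> u \<otimes> h" "\<not> side (\<sigma> u) h"
      using less.prems(1) u by (simp_all add: h_def)
    have gh: "g = h \<otimes> \<sigma> u"
      using less.prems(1) u by (simp add: h_def ug m_assoc)
    have uh: "\<sigma> u \<otimes> h = h \<otimes> \<sigma> u"
      using h(2) gh by simp
    have h2: "h \<otimes> h = \<one>"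
    proof -
      have "h \<otimes> h = (g \<otimes> \<sigma> u) \<otimes> (\<sigma> u \<otimes> g)"
        unfolding h_def by (metis ug)
      then show ?thesis
        using less.prems(1,2) u by (simp add: m_assoc)
    qed
    have key: "v \<noteq> u \<and> side (\<sigma> v) g \<and> \<sigma> v \<otimes> h = h \<otimes> \<sigma> v" if v: "v \<in> S" "side (\<sigma> v) h" for v
    proof -
      have vu: "v \<noteq> u"
        using h v by auto
      have "cj h (\<sigma> u) = \<sigma> u"
        using h u uh by (simp add: cj_eq_iff)
      then have sg: "side (\<sigma> v) g"
        using side_step[of h u "\<sigma> v"] h(1) gh u v vu by auto
      have su: "\<not> side (\<sigma> v) (\<sigma> u)"
        using side_step[of \<one> u "\<sigma> v"] u v vu by auto
      have "crossing (\<sigma> v) (\<sigma> u)"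
        using u v h vu sg su less.prems(1)
        by (intro four_quadrants_crossing[of _ _ \<one> "\<sigma> u" g h]) auto
      then have vuc: "\<sigma> v \<otimes> \<sigma> u = \<sigma> u \<otimes> \<sigma> v"
        using crossing_iff u v by simp
      have vg: "\<sigma> v \<otimes> g = g \<otimes> \<sigma> v"
        using less.prems(3) v sg by blast
      have "\<sigma> v \<otimes> h = \<sigma> u \<otimes> \<sigma> v \<otimes> g"
        using u v less.prems(1) vuc by (simp add: h_def flip: m_assoc)
      also have "\<dots> = h \<otimes> \<sigma> v"
        using u v less.prems(1) vg by (simp add: h_def m_assoc)
      finally show ?thesis
        using vu sg by simp
    qed
    have "len h < len g"
      unfolding h_def using len_descent u less.prems(1) by blast
    then obtain xs where xs: "distinct xs" "set xs \<subseteq> {u \<in> S. side (\<sigma> u) h}" "ev xs = h"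
      using less.IH[of h] h h2 key by blast
    then have "set (u # xs) \<subseteq> {u \<in> S. side (\<sigma> u) g}" "distinct (u # xs)"
      using key u by auto
    moreover have "ev (u # xs) = g"
      using xs h by simp
    ultimately show ?thesis
      by blast
  qed
qed

text \<open>In a shortest conjugate \<open>h\<close> every descent \<open>u\<close> commutes with
  \<open>h\<close>. Conjugation by \<open>\<sigma> u\<close> cannot shorten \<open>h\<close>, which
  forces \<open>h\<close> and \<open>h \<otimes> \<sigma> u\<close> to opposite sides of the wall of
  \<open>u\<close>; the edge between them then lies on that wall, that is,
  \<open>cj h (\<sigma> u) = \<sigma> u\<close>.\<close>

lemma involution_conjugate:
  assumes g: "g \<in> carrier G" "g \<otimes> g = \<one>"
  obtains xs where "distinct xs" "set xs \<subseteq> S" "ev xs \<otimes> ev xs = \<one>" "conjugate (ev xs) g"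
proof -
  define C where "C = {h \<in> carrier G. conjugate h g}"
  have "g \<in> C"
    using g conjugate_refl by (simp add: C_def)
  then obtain h where h: "h \<in> C" "\<And>k. k \<in> C \<Longrightarrow> len h \<le> len k"
    using ex_has_least_nat[of "\<lambda>k. k \<in> C" g len] by blast
  have hG: "h \<in> carrier G" and hg: "conjugate h g"
    using h by (auto simp: C_def)
  have h2: "h \<otimes> h = \<one>"
  proof -
    obtain w where "w \<in> carrier G" "h = cj w g"
      using conjugate_sym[OF hG hg] by (auto simp: conjugate_def)
    then show ?thesis
      using g by (simp flip: cj_distrib)
  qed
  have hinv: "inv h = h"
    using h2 hG by (simp add: inv_equality)
  have "\<sigma> u \<otimes> h = h \<otimes> \<sigma> u" if u: "u \<in> S" "side (\<sigma> u) h" for u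
  proof -
    have lt: "len (\<sigma> u \<otimes> h) < len h"
      using len_descent u hG by blast
    obtain ys where ys: "length ys = len (\<sigma> u \<otimes> h)" "set ys \<subseteq> S" "ev ys = \<sigma> u \<otimes> h"
      using len_witness[of "\<sigma> u \<otimes> h"] hG u by auto
    \<comment> \<open>\<open>h\<close> is its own inverse, so \<open>h \<otimes> \<sigma> u\<close>
      is the inverse of \<open>\<sigma> u \<otimes> h\<close> and no longer than it.\<close>
    have rys: "ev (rev ys) = h \<otimes> \<sigma> u"
      using inv_ev[OF ys(2)] ys(3) hG u hinv by (simp add: inv_mult_group)
    have "\<not> side (\<sigma> u) (h \<otimes> \<sigma> u)"
    proof
      assume "side (\<sigma> u) (h \<otimes> \<sigma> u)"
      then have "len (\<sigma> u \<otimes> (h \<otimes> \<sigma> u)) < len (h \<otimes> \<sigma> u)"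
        using len_descent u hG by simp
      also have "\<dots> \<le> len (\<sigma> u \<otimes> h)"
        using len_le[of "rev ys"] rys ys by simp
      finally have "len (cj (\<sigma> u) h) < len h"
        using lt u hG by (simp add: cj_def m_assoc)
      moreover have "conjugate (cj (\<sigma> u) h) h"
        unfolding conjugate_def using hG u
        by (intro bexI[of _ "\<sigma> u"]) (simp_all flip: cj_mult)
      then have "cj (\<sigma> u) h \<in> C"
        using conjugate_trans[OF _ _ hg] hG u by (simp add: C_def)
      ultimately show False
        using h(2) by fastforce
    qed
    then have "cj h (\<sigma> u) = \<sigma> u"
      using side_step[OF hG u(1), of "\<sigma> u"] u by auto
    then show ?thesis
      using cj_mult_right[OF hG] u by (metis \<sigma>_closed)
  qed
  then obtain xs where "distinct xs" "set xs \<subseteq> {u \<in> S. side (\<sigma> u) h}" "ev xs = h"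
    using central_descents_product[OF hG h2] by blast
  then show ?thesis
    using that[of xs] hg h2 by auto
qed

text \<open>Words without repeated letters suffice, and there are finitely many. The identity
  satisfies \<open>x \<otimes> x = \<one>\<close> and is one of the representatives; a map that is
  injective on classes therefore sends no nontrivial involution to \<open>\<one>\<close>.\<close>

lemma involution_representatives:
  assumes "finite S"
  obtains R where "finite R" "R \<subseteq> carrier G" "\<And>x. x \<in> R \<Longrightarrow> x \<otimes> x = \<one>"
    "\<And>x. x \<in> carrier G \<Longrightarrow> x \<otimes> x = \<one> \<Longrightarrow> \<exists>y\<in>R. conjugate y x"
    "\<And>x y. x \<in> R \<Longrightarrow> y \<in> R \<Longrightarrow> conjugate x y \<Longrightarrow> x = y"
proof -
  define P where "P = {ev xs | xs. distinct xs \<and> set xs \<subseteq> S \<and> ev xs \<otimes> ev xs = \<one>}"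
  have "P \<subseteq> ev ` {xs. distinct xs \<and> set xs \<subseteq> S}"
    by (auto simp: P_def)
  moreover have "finite {xs. distinct xs \<and> set xs \<subseteq> S}"
    using finite_subset_distinct[OF assms] by (simp add: conj_commute)
  ultimately have fin: "finite P"
    using finite_surj by blast
  have PG: "P \<subseteq> carrier G"
    by (auto simp: P_def)
  obtain R where R: "R \<subseteq> P" "\<And>x. x \<in> P \<Longrightarrow> \<exists>y\<in>R. conjugate y x"
    "\<And>x y. x \<in> R \<Longrightarrow> y \<in> R \<Longrightarrow> conjugate x y \<Longrightarrow> x = y"
    using conjugacy_representatives[OF fin PG] by blast
  show ?thesis
  proof (rule that)
    show "finite R" "R \<subseteq> carrier G"
      using R fin PG finite_subset by auto
    show "x \<otimes> x = \<one>" if "x \<in> R" for x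
      using that R by (auto simp: P_def)
    show "\<exists>y\<in>R. conjugate y x" if x: "x \<in> carrier G" "x \<otimes> x = \<one>" for x
    proof -
      obtain xs where xs: "distinct xs" "set xs \<subseteq> S" "ev xs \<otimes> ev xs = \<one>" "conjugate (ev xs) x"
        using involution_conjugate[OF x] .
      then have "ev xs \<in> P"
        by (auto simp: P_def)
      then show ?thesis
        using R(1,2) PG conjugate_trans[OF _ _ xs(4)] by blast
    qed
    show "x = y" if "x \<in> R" "y \<in> R" "conjugate x y" for x y
      using that R by blast
  qed
qed

text \<open>A positive power preserves the class of every generator and is therefore bijective. With
  \<open>f\<close> as its innermost factor this gives injectivity, with \<open>f\<close> as its
  outermost factor surjectivity.\<close>

theorem involution_class_injective_bij:
  assumes fin: "finite S" and sep: no_separating_clique and flat: no_reflection_flat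
    and f: "f \<in> hom G G"
    and R: "finite R" "R \<subseteq> carrier G" "\<And>x. x \<in> R \<Longrightarrow> x \<otimes> x = \<one>"
    "\<And>x. x \<in> carrier G \<Longrightarrow> x \<otimes> x = \<one> \<Longrightarrow> \<exists>y\<in>R. conjugate y x"
    and inj: "\<And>x y. x \<in> R \<Longrightarrow> y \<in> R \<Longrightarrow> conjugate (f x) (f y) \<Longrightarrow> x = y"
  shows "bij_betw f (carrier G) (carrier G)"
proof -
  obtain n where n: "n > 0"
    "\<And>x. x \<in> carrier G \<Longrightarrow> x \<otimes> x = \<one> \<Longrightarrow> conjugate x ((f ^^ n) x)"
    using power_preserves_classes[OF f R inj] by blast
  then obtain k where k: "n = Suc k"
    by (cases n) auto
  have bij: "bij_betw (f ^^ n) (carrier G) (carrier G)"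
    using n(2) by (intro type_preserving_bij[OF fin sep flat funpow_hom[OF f]])
      (auto simp: conjugate_def)
  have fc: "f x \<in> carrier G" "(f ^^ k) x \<in> carrier G" if "x \<in> carrier G" for x
    using hom_in_carrier[OF f that] hom_in_carrier[OF funpow_hom[OF f] that] by auto
  have "inj_on f (carrier G)"
  proof (rule inj_onI)
    fix x y assume "x \<in> carrier G" "y \<in> carrier G" "f x = f y"
    then show "x = y"
      using bij by (auto simp: k funpow_Suc_right bij_betw_def inj_on_def simp del: funpow.simps)
  qed
  moreover have "f ` carrier G = carrier G"
  proof
    show "carrier G \<subseteq> f ` carrier G"
    proof
      fix y assume "y \<in> carrier G"
      then obtain x where "x \<in> carrier G" "y = (f ^^ n) x"
        using bij by (auto simp: bij_betw_def)
      then show "y \<in> f ` carrier G"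
        using fc by (auto simp: k)
    qed
  qed (use fc in auto)
  ultimately show ?thesis
    by (simp add: bij_betw_def)
qed

end


section \<open>Splittings over cliques\<close>

definition word_value :: "('c, 'd) monoid_scheme \<Rightarrow> ('l \<Rightarrow> 'c) \<Rightarrow> 'l word \<Rightarrow> 'c" where
  "word_value H f u = foldr (\<lambda>(s, b) g. (if b then f s else inv\<^bsub>H\<^esub> (f s)) \<otimes>\<^bsub>H\<^esub> g) u \<one>\<^bsub>H\<^esub>"

lemma word_value_Nil [simp]: "word_value H f [] = \<one>\<^bsub>H\<^esub>"
  by (simp add: word_value_def)

lemma word_value_Cons [simp]:
  "word_value H f ((s, b) # u) = (if b then f s else inv\<^bsub>H\<^esub> (f s)) \<otimes>\<^bsub>H\<^esub> word_value H f u"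
  by (simp add: word_value_def)

text \<open>The universal property of a presentation: equivalent words have equal values in
  \<open>H\<close>, so any representative of a class may be evaluated.\<close>

lemma presented_group_lift:
  assumes "group H" and f: "\<And>s. s \<in> L \<Longrightarrow> f s \<in> carrier H"
    and rel: "\<And>r. r \<in> R \<Longrightarrow> r \<in> words L \<Longrightarrow> word_value H f r = \<one>\<^bsub>H\<^esub>"
  shows "\<exists>F\<in>hom (presented_group L R) H. \<forall>u\<in>words L. F (pres_rel L R `` {u}) = word_value H f u"
proof -
  interpret H: group H by fact
  let ?v = "word_value H f"
  have cl: "?v u \<in> carrier H" if "u \<in> words L" for u
    using that by (induction u) (auto simp: f)
  have app: "?v (u @ w) = ?v u \<otimes>\<^bsub>H\<^esub> ?v w" if "u \<in> words L" "w \<in> words L" for u w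
    using that by (induction u) (auto simp: f cl H.m_assoc)
  have eq: "?v u = ?v w" if "pres_eq L R u w" for u w
    using that
  proof induction
    case (cancel u v s b)
    then show ?case
      by (cases b) (auto simp: app cl f)
  next
    case (relator u v r)
    then show ?case
      by (simp add: app cl rel)
  qed auto
  define F where "F X = ?v (SOME u. u \<in> X)" for X
  have F: "F (pres_rel L R `` {u}) = ?v u" if "u \<in> words L" for u
  proof -
    have "u \<in> pres_rel L R `` {u}"
      using that by (simp add: pres_rel_def pres_eq.refl)
    then have "(SOME w. w \<in> pres_rel L R `` {u}) \<in> pres_rel L R `` {u}"
      by (rule someI)
    then show ?thesis
      unfolding F_def using eq by (auto simp: pres_rel_def)
  qed
  have car: "\<exists>u\<in>words L. X = pres_rel L R `` {u}" if "X \<in> carrier (presented_group L R)" for X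
    using that by (auto simp: presented_group_def quotient_def)
  have "F (X \<otimes>\<^bsub>presented_group L R\<^esub> Y) = F X \<otimes>\<^bsub>H\<^esub> F Y"
    if XY: "X \<in> carrier (presented_group L R)" "Y \<in> carrier (presented_group L R)" for X Y
  proof -
    obtain u w where "u \<in> words L" "w \<in> words L" "X = pres_rel L R `` {u}" "Y = pres_rel L R `` {w}"
      using car XY by metis
    then show ?thesis
      using F[of "u @ w"] by (simp add: presented_mult F app)
  qed
  moreover have "F X \<in> carrier H" if "X \<in> carrier (presented_group L R)" for X
    using car[OF that] F cl by auto
  ultimately have "F \<in> hom (presented_group L R) H"
    by (simp add: hom_def)
  then show ?thesis
    using F by blast
qed

lemma presented_class_closed:
  "u \<in> words L \<Longrightarrow> pres_rel L R `` {u} \<in> carrier (presented_group L R)"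
  by (auto simp: presented_group_def quotient_def)

lemma presented_class_cases:
  assumes "X \<in> carrier (presented_group L R)"
  obtains u where "u \<in> words L" "X = pres_rel L R `` {u}"
  using assms by (auto simp: presented_group_def quotient_def)

lemma presented_class_eqI: "pres_eq L R u v \<Longrightarrow> pres_rel L R `` {u} = pres_rel L R `` {v}"
  by (intro equiv_class_eq[OF equiv_pres_rel]) (simp add: pres_rel_def)

lemma presented_one: "\<one>\<^bsub>presented_group L R\<^esub> = pres_rel L R `` {[]}"
  by (simp add: presented_group_def)

lemma presented_inv_letter:
  assumes "s \<in> L"
  shows "pres_rel L R `` {[(s, False)]} = inv\<^bsub>presented_group L R\<^esub> (pres_rel L R `` {[(s, True)]})"
proof -
  interpret P: group "presented_group L R"
    by (rule group_presented_group)
  have "pres_eq L R ([] @ [(s, False), (s, \<not> False)] @ []) ([] @ [])"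
    using assms by (intro pres_eq.cancel) auto
  then have "pres_rel L R `` {[(s, False), (s, True)]} = pres_rel L R `` {[]}"
    by (intro presented_class_eqI) simp
  then show ?thesis
    using assms presented_mult[of "[(s, False)]" L "[(s, True)]" R]
    by (intro P.inv_equality[symmetric]) (auto simp: presented_one presented_class_closed)
qed

lemma presented_relator:
  "r \<in> R \<Longrightarrow> r \<in> words L \<Longrightarrow> pres_rel L R `` {r} = \<one>\<^bsub>presented_group L R\<^esub>"
  using pres_eq.relator[of "[]" L "[]" r R] presented_class_eqI[of L R r "[]"]
  by (simp add: presented_one)

lemma table_relators_hom:
  assumes "table_relators f A \<subseteq> R" "f ` carrier A \<subseteq> L" "group A"
  shows "(\<lambda>a. pres_rel L R `` {[(f a, True)]}) \<in> hom A (presented_group L R)"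
proof -
  interpret A: group A by fact
  interpret P: group "presented_group L R"
    by (rule group_presented_group)
  let ?c = "\<lambda>a. pres_rel L R `` {[(f a, True)]}"
  have cl: "?c a \<in> carrier (presented_group L R)" if "a \<in> carrier A" for a
    using that assms(2) by (intro presented_class_closed) auto
  have "?c (a \<otimes>\<^bsub>A\<^esub> b) = ?c a \<otimes>\<^bsub>presented_group L R\<^esub> ?c b"
    if ab: "a \<in> carrier A" "b \<in> carrier A" for a b
  proof -
    let ?r = "[(f a, True), (f b, True), (f (a \<otimes>\<^bsub>A\<^esub> b), False)]"
    have L: "f a \<in> L" "f b \<in> L" "f (a \<otimes>\<^bsub>A\<^esub> b) \<in> L"
      using ab assms(2) by auto
    have "?r \<in> table_relators f A"
      unfolding table_relators_def using ab by blast
    then have "pres_rel L R `` {?r} = \<one>\<^bsub>presented_group L R\<^esub>"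
      using assms(1) L by (intro presented_relator) auto
    moreover have "pres_rel L R `` {?r} = ?c a \<otimes>\<^bsub>presented_group L R\<^esub> ?c b
        \<otimes>\<^bsub>presented_group L R\<^esub> inv\<^bsub>presented_group L R\<^esub> ?c (a \<otimes>\<^bsub>A\<^esub> b)"
      using L by (simp add: presented_mult flip: presented_inv_letter)
    ultimately show ?thesis
      using cl ab by (metis A.m_closed P.inv_closed P.inv_equality P.inv_inv P.m_closed)
  qed
  then show ?thesis
    using cl by (simp add: hom_def)
qed

context racg
begin

lemma par_inv: "g \<in> carrier G \<Longrightarrow> par s (inv g) = par s g"
  using par_mult[of "inv g" g s] by simp

text \<open>A generator \<open>s\<close> missing from the words chosen for \<open>X\<close> would
  have \<open>par s\<close> trivial on \<open>X\<close>, hence on all of \<open>G\<close>, yet it is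
  nontrivial on \<open>\<sigma> s\<close>.\<close>

lemma finite_generators:
  assumes "finitely_generated G"
  shows "finite S"
proof -
  obtain X where X: "finite X" "X \<subseteq> carrier G" "generate G X = carrier G"
    using assms by (auto simp: finitely_generated_def)
  have "\<exists>xs. set xs \<subseteq> S \<and> ev xs = x" if "x \<in> X" for x
    using ev_surj X(2) that by blast
  then obtain w where w: "\<And>x. x \<in> X \<Longrightarrow> set (w x) \<subseteq> S \<and> ev (w x) = x"
    by metis
  have "s \<in> (\<Union>x\<in>X. set (w x))" if s: "s \<in> S" for s
  proof (rule ccontr)
    assume n: "s \<notin> (\<Union>x\<in>X. set (w x))"
    have ev: "\<not> par s (ev xs)" if "set xs \<subseteq> S" "s \<notin> set xs" for xs
      using that by (induction xs) (auto simp: par_mult)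
    have X': "\<not> par s x" if "x \<in> X" for x
      using ev[of "w x"] w[OF that] n that by auto
    have "g \<in> carrier G \<and> \<not> par s g" if "g \<in> generate G X" for g
      using that
    proof induction
      case (inv h)
      then show ?case using X' X(2) par_inv[of h s] by auto
    next
      case (eng h1 h2)
      then show ?case by (simp add: par_mult)
    qed (use X' X(2) in auto)
    then show False
      using X(3) s \<sigma>_closed[OF s] par_\<sigma>[OF s, of s] by blast
  qed
  then have "S \<subseteq> (\<Union>x\<in>X. set (w x))"
    by blast
  then show ?thesis
    using X(1) finite_subset by blast
qed

text \<open>The subgroup generated by \<open>T\<close>. It is a record of type
  \<open>'a monoid\<close>, the type of the factors in the splitting predicates, whereas
  \<open>G\<close> may carry further fields.\<close>

definition special :: "'s set \<Rightarrow> 'a monoid" where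
  "special T = \<lparr>carrier = ev ` lists T, monoid.mult = (\<otimes>), one = \<one>\<rparr>"

lemma special_simps [simp]: "monoid.mult (special T) = (\<otimes>)" "one (special T) = \<one>"
  by (simp_all add: special_def)

lemma specialI [simp]: "set xs \<subseteq> T \<Longrightarrow> ev xs \<in> carrier (special T)"
  unfolding special_def by (auto intro!: imageI)

lemma specialE:
  assumes "g \<in> carrier (special T)"
  obtains xs where "set xs \<subseteq> T" "g = ev xs"
  using assms unfolding special_def by auto

lemma special_letter: "s \<in> T \<Longrightarrow> T \<subseteq> S \<Longrightarrow> \<sigma> s \<in> carrier (special T)"
  using specialI[of "[s]" T] by auto

lemma special_mono: "T \<subseteq> T' \<Longrightarrow> g \<in> carrier (special T) \<Longrightarrow> g \<in> carrier (special T')"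
  by (elim specialE) (use specialI in blast)

lemma special_closed: "T \<subseteq> S \<Longrightarrow> g \<in> carrier (special T) \<Longrightarrow> g \<in> carrier G"
  by (elim specialE) (use ev_closed in blast)

lemma special_mult:
  assumes "T \<subseteq> S" "g \<in> carrier (special T)" "h \<in> carrier (special T)"
  shows "g \<otimes> h \<in> carrier (special T)"
proof -
  obtain xs ys where "set xs \<subseteq> T" "g = ev xs" "set ys \<subseteq> T" "h = ev ys"
    using assms by (elim specialE)
  then show ?thesis
    using ev_append[of xs ys] specialI[of "xs @ ys" T] assms(1) by auto
qed

lemma group_special:
  assumes "T \<subseteq> S"
  shows "group (special T)"
proof (rule groupI)
  show "\<exists>y\<in>carrier (special T). y \<otimes>\<^bsub>special T\<^esub> x = \<one>\<^bsub>special T\<^esub>" if "x \<in> carrier (special T)" for x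
  proof -
    obtain xs where xs: "set xs \<subseteq> T" "x = ev xs"
      using \<open>x \<in> carrier (special T)\<close> by (rule specialE)
    then have "ev (rev xs) \<otimes> ev xs = \<one>"
      using assms inv_ev[of xs] l_inv[of "ev xs"] by auto
    then show ?thesis
      using xs by (intro bexI[of _ "ev (rev xs)"]) auto
  qed
  show "\<one>\<^bsub>special T\<^esub> \<in> carrier (special T)"
    using specialI[of "[]" T] by simp
qed (use assms special_mult special_closed in \<open>auto simp: m_assoc\<close>)

lemma special_hom_incl: "T \<subseteq> T' \<Longrightarrow> id \<in> hom (special T) (special T')"
  using special_mono by (auto simp: hom_def)

text \<open>Letters of a clique commute and square to the identity, so a second occurrence of a
  letter cancels and words without repetition suffice.\<close>

lemma finite_special_clique:
  assumes "clique T" "finite T"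
  shows "finite (carrier (special T))"
proof -
  have TS: "T \<subseteq> S"
    using assms by (simp add: clique_def)
  have comm: "\<sigma> t \<otimes> ev xs = ev xs \<otimes> \<sigma> t" if "t \<in> T" "set xs \<subseteq> T" for t xs
    using that(2)
  proof (induction xs)
    case (Cons x xs)
    have "\<sigma> t \<otimes> \<sigma> x = \<sigma> x \<otimes> \<sigma> t"
      using assms(1) that(1) Cons.prems \<sigma>_commute by (cases "t = x") (auto simp: clique_def)
    then have "\<sigma> t \<otimes> (\<sigma> x \<otimes> ev xs) = \<sigma> x \<otimes> (\<sigma> t \<otimes> ev xs)"
      using TS that(1) Cons.prems by (simp add: subset_iff flip: m_assoc)
    then show ?case
      using Cons TS that(1) by (simp add: subset_iff m_assoc)
  qed (use TS that in auto)
  have "\<exists>ys. distinct ys \<and> set ys \<subseteq> T \<and> ev xs = ev ys" if "set xs \<subseteq> T" for xs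
    using that
  proof (induction xs)
    case (Cons t xs)
    then obtain ys where ys: "distinct ys" "set ys \<subseteq> T" "ev xs = ev ys"
      by auto
    show ?case
    proof (cases "t \<in> set ys")
      case True
      then obtain as bs where ab: "ys = as @ t # bs"
        by (auto simp: in_set_conv_decomp)
      have sub: "set as \<subseteq> S" "set bs \<subseteq> S" "t \<in> S" "set as \<subseteq> T" "t \<in> T"
        using ab ys TS by auto
      have "ev (t # xs) = \<sigma> t \<otimes> ev as \<otimes> (\<sigma> t \<otimes> ev bs)"
        using ys ab sub by (simp add: ev_append m_assoc)
      also have "\<dots> = ev as \<otimes> \<sigma> t \<otimes> (\<sigma> t \<otimes> ev bs)"
        using comm[of t as] sub by simp
      also have "\<dots> = ev (as @ bs)"
        using sub by (simp add: ev_append m_assoc)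
      finally show ?thesis
        using ys ab by (intro exI[of _ "as @ bs"]) auto
    next
      case False
      then show ?thesis
        using ys Cons.prems by (intro exI[of _ "t # ys"]) auto
    qed
  qed (auto intro!: exI[of _ "[]"])
  then have "carrier (special T) \<subseteq> ev ` {ys. distinct ys \<and> set ys \<subseteq> T}"
    by (smt (verit) image_eqI mem_Collect_eq specialE subsetI)
  moreover have "finite {ys. distinct ys \<and> set ys \<subseteq> T}"
    using finite_subset_distinct[OF assms(2)] by (simp add: conj_commute)
  ultimately show ?thesis
    using finite_surj by blast
qed

lemma special_proper:
  assumes "T \<subseteq> S" "T' \<subseteq> S" "s \<in> T'" "s \<notin> T"
  shows "carrier (special T) \<noteq> carrier (special T')"
proof -
  have "\<not> par s (ev xs)" if "set xs \<subseteq> T" for xs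
    using that assms by (induction xs) (auto simp: par_mult subset_iff)
  moreover have "par s (\<sigma> s)"
    using assms by auto
  ultimately have "\<sigma> s \<notin> carrier (special T)"
    by (metis specialE)
  moreover have "\<sigma> s \<in> carrier (special T')"
    using assms special_letter by blast
  ultimately show ?thesis
    by blast
qed

text \<open>Every commutation relation of \<open>G\<close> involves two generators from one of the
  factors, since \<open>T1\<close> and \<open>T2\<close> are not adjacent. So the relations hold in
  the amalgam and give a map \<open>K\<close> into it; the inclusions of the factors give a map
  \<open>F\<close> back. The two are inverse to each other because they are so on
  generators.\<close>

lemma separating_clique_amalgam:
  assumes T: "T1 \<subseteq> S" "T2 \<subseteq> S" "T1 \<inter> T2 = {}" and nadj: "\<And>s t. s \<in> T1 \<Longrightarrow> t \<in> T2 \<Longrightarrow> \<not> adj s t"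
  defines "T0 \<equiv> S - T1 - T2"
  shows "G \<cong> amalgamated_product (special (T0 \<union> T1)) (special (T0 \<union> T2)) (special T0) id id"
proof -
  let ?A = "special (T0 \<union> T1)" and ?B = "special (T0 \<union> T2)" and ?C = "special T0"
  define L where "L = carrier ?A <+> carrier ?B"
  define R where "R = table_relators Inl ?A \<union> table_relators Inr ?B \<union>
        {[(Inl (id c), True), (Inr (id c), False)] | c. c \<in> carrier ?C}"
  let ?P = "presented_group L R"
  let ?cl = "\<lambda>u. pres_rel L R `` {u}"
  have L [simp]: "Inl a \<in> L \<longleftrightarrow> a \<in> carrier ?A" "Inr a \<in> L \<longleftrightarrow> a \<in> carrier ?B" for a
    by (auto simp: L_def)
  have R: "table_relators Inl ?A \<subseteq> R" "table_relators Inr ?B \<subseteq> R"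
    "\<And>c. c \<in> carrier ?C \<Longrightarrow> [(Inl c, True), (Inr c, False)] \<in> R"
    by (auto simp: R_def)
  have sub: "T0 \<union> T1 \<subseteq> S" "T0 \<union> T2 \<subseteq> S" "T0 \<subseteq> S" "S = T0 \<union> T1 \<union> T2"
    using T by (auto simp: T0_def)
  interpret A: group ?A by (rule group_special) (rule sub)
  interpret B: group ?B by (rule group_special) (rule sub)
  interpret P: group ?P by (rule group_presented_group)
  define \<iota> where "\<iota> a = ?cl [(Inl a, True)]" for a
  define \<kappa> where "\<kappa> b = ?cl [(Inr b, True)]" for b
  have \<iota>: "\<iota> \<in> hom ?A ?P"
    unfolding \<iota>_def using R(1) by (rule table_relators_hom) (auto simp: A.is_group)
  have \<kappa>: "\<kappa> \<in> hom ?B ?P"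
    unfolding \<kappa>_def using R(2) by (rule table_relators_hom) (auto simp: B.is_group)
  have \<iota>\<kappa>: "\<iota> c = \<kappa> c" if c: "c \<in> carrier ?C" for c
  proof -
    have cAB: "c \<in> carrier ?A" "c \<in> carrier ?B"
      using c special_mono by blast+
    have "?cl [(Inl c, True), (Inr c, False)] = \<one>\<^bsub>?P\<^esub>"
      using R(3)[OF c] cAB by (intro presented_relator) simp_all
    moreover have "?cl [(Inl c, True), (Inr c, False)] = \<iota> c \<otimes>\<^bsub>?P\<^esub> inv\<^bsub>?P\<^esub> \<kappa> c"
      using cAB presented_mult[of "[(Inl c, True)]" L "[(Inr c, False)]" R]
        presented_inv_letter[of "Inr c" L R] by (simp add: \<iota>_def \<kappa>_def)
    ultimately show ?thesis
      using hom_in_carrier[OF \<iota> cAB(1)] hom_in_carrier[OF \<kappa> cAB(2)]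
      by (metis P.inv_closed P.inv_equality P.inv_inv)
  qed
  \<comment> \<open>On \<open>T0\<close> both embeddings agree by the amalgamation relators, so the
    preference for the first factor is harmless.\<close>
  define f where "f s = (if s \<in> T0 \<union> T1 then \<iota> (\<sigma> s) else \<kappa> (\<sigma> s))" for s
  have f1: "f s = \<iota> (\<sigma> s) \<and> \<sigma> s \<in> carrier ?A" if "s \<in> T0 \<union> T1" for s
    using that special_letter[OF that sub(1)] by (simp add: f_def)
  have f2: "f s = \<kappa> (\<sigma> s) \<and> \<sigma> s \<in> carrier ?B" if "s \<in> T0 \<union> T2" for s
    using that special_letter[OF that sub(2)] special_letter[of s T0] sub \<iota>\<kappa>[of "\<sigma> s"] T by (auto simp: f_def)
  have f_hom: "(\<sigma> s \<otimes> \<sigma> t \<in> carrier ?A \<and> f s \<otimes>\<^bsub>?P\<^esub> f t = \<iota> (\<sigma> s \<otimes> \<sigma> t)) \<or>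
      (\<sigma> s \<otimes> \<sigma> t \<in> carrier ?B \<and> f s \<otimes>\<^bsub>?P\<^esub> f t = \<kappa> (\<sigma> s \<otimes> \<sigma> t))"
    if "{s, t} \<subseteq> T0 \<union> T1 \<or> {s, t} \<subseteq> T0 \<union> T2" for s t
    using that hom_mult[OF \<iota>, of "\<sigma> s" "\<sigma> t"] hom_mult[OF \<kappa>, of "\<sigma> s" "\<sigma> t"]
      f1[of s] f1[of t] f2[of s] f2[of t] A.m_closed[of "\<sigma> s" "\<sigma> t"] B.m_closed[of "\<sigma> s" "\<sigma> t"]
    by auto
  have fc: "f s \<in> carrier ?P" if "s \<in> S" for s
    using that f1[of s] f2[of s] hom_in_carrier[OF \<iota>] hom_in_carrier[OF \<kappa>] sub(4) by auto
  have one: "\<iota> \<one> = \<one>\<^bsub>?P\<^esub>" "\<kappa> \<one> = \<one>\<^bsub>?P\<^esub>"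
    using hom_one[OF \<iota> A.is_group P.is_group] hom_one[OF \<kappa> B.is_group P.is_group] by auto
  have sq: "f s \<otimes>\<^bsub>?P\<^esub> f s = \<one>\<^bsub>?P\<^esub>" if "s \<in> S" for s
    using f_hom[of s s] that one sub(4) by auto
  have comm: "f s \<otimes>\<^bsub>?P\<^esub> f t = f t \<otimes>\<^bsub>?P\<^esub> f s" if "adj s t" for s t
  proof -
    have "{s, t} \<subseteq> T0 \<union> T1 \<or> {s, t} \<subseteq> T0 \<union> T2"
      using adjD[OF that] nadj that adj_sym sub(4) by blast
    then show ?thesis
    proof
      assume *: "{s, t} \<subseteq> T0 \<union> T1"
      then show ?thesis
        using hom_mult[OF \<iota>, of "\<sigma> s" "\<sigma> t"] hom_mult[OF \<iota>, of "\<sigma> t" "\<sigma> s"] f1[of s] f1[of t]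
          \<sigma>_commute[OF that] by simp
    next
      assume *: "{s, t} \<subseteq> T0 \<union> T2"
      then show ?thesis
        using hom_mult[OF \<kappa>, of "\<sigma> s" "\<sigma> t"] hom_mult[OF \<kappa>, of "\<sigma> t" "\<sigma> s"] f2[of s] f2[of t]
          \<sigma>_commute[OF that] by simp
    qed
  qed
  obtain K where K: "K \<in> hom G ?P" "\<And>s. s \<in> S \<Longrightarrow> K (\<sigma> s) = f s"
    using hom_extend[where f = f, OF P.is_group fc sq comm] by blast
  have K1: "K \<one> = \<one>\<^bsub>?P\<^esub>"
    by (rule hom_one[OF K(1) is_group P.is_group])
  have K\<iota>: "K a = \<iota> a" if a: "a \<in> carrier ?A" for a
  proof -
    have "K (ev xs) = \<iota> (ev xs)" if "set xs \<subseteq> T0 \<union> T1" for xs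
      using that
    proof (induction xs)
      case (Cons x xs)
      have x: "x \<in> T0 \<union> T1" "x \<in> S" "set xs \<subseteq> T0 \<union> T1" "set xs \<subseteq> S"
        using Cons.prems sub(4) by auto
      then show ?case
        using hom_mult[OF \<iota>, of "\<sigma> x" "ev xs"] hom_mult[OF K(1), of "\<sigma> x" "ev xs"] K(2)[of x]
          f1[OF x(1)] Cons.IH by simp
    qed (simp add: K1 one)
    then show ?thesis
      using a by (auto elim: specialE)
  qed
  have K\<kappa>: "K b = \<kappa> b" if b: "b \<in> carrier ?B" for b
  proof -
    have "K (ev xs) = \<kappa> (ev xs)" if "set xs \<subseteq> T0 \<union> T2" for xs
      using that
    proof (induction xs)
      case (Cons x xs)
      have x: "x \<in> T0 \<union> T2" "x \<in> S" "set xs \<subseteq> T0 \<union> T2" "set xs \<subseteq> S"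
        using Cons.prems sub(4) by auto
      then show ?case
        using hom_mult[OF \<kappa>, of "\<sigma> x" "ev xs"] hom_mult[OF K(1), of "\<sigma> x" "ev xs"] K(2)[of x]
          f2[OF x(1)] Cons.IH by simp
    qed (simp add: K1 one)
    then show ?thesis
      using b by (auto elim: specialE)
  qed
  define e :: "'a + 'a \<Rightarrow> 'a" where "e = case_sum id id"
  have e: "e x \<in> carrier G" if "x \<in> L" for x
    using that special_closed[OF sub(1)] special_closed[OF sub(2)]
    by (auto simp: e_def L_def)
  have relc: "a \<otimes> (b \<otimes> inv (a \<otimes> b)) = \<one>" if "a \<in> carrier G" "b \<in> carrier G" for a b
    using that by (simp add: inv_mult_group)
  have "word_value G e r = \<one>" if "r \<in> R" for r
    using that unfolding R_def
  proof (elim UnE)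
    assume "r \<in> table_relators Inl ?A"
    then obtain a b where "a \<in> carrier ?A" "b \<in> carrier ?A"
      "r = [(Inl a, True), (Inl b, True), (Inl (a \<otimes> b), False)]"
      by (auto simp: table_relators_def)
    then show ?thesis
      using relc special_closed[OF sub(1)] by (simp add: e_def)
  next
    assume "r \<in> table_relators Inr ?B"
    then obtain a b where "a \<in> carrier ?B" "b \<in> carrier ?B"
      "r = [(Inr a, True), (Inr b, True), (Inr (a \<otimes> b), False)]"
      by (auto simp: table_relators_def)
    then show ?thesis
      using relc special_closed[OF sub(2)] by (simp add: e_def)
  next
    assume "r \<in> {[(Inl (id c), True), (Inr (id c), False)] | c. c \<in> carrier ?C}"
    then obtain c where "c \<in> carrier ?C" "r = [(Inl c, True), (Inr c, False)]"
      by auto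
    then show ?thesis
      using special_closed[OF sub(3)] by (simp add: e_def)
  qed
  then obtain F where F: "F \<in> hom ?P G" "\<And>u. u \<in> words L \<Longrightarrow> F (?cl u) = word_value G e u"
    using presented_group_lift[OF is_group, of L e R] e by blast
  have FK: "F (K g) = g" if g: "g \<in> carrier G" for g
  proof -
    have "(F \<circ> K) g = id g"
    proof (rule hom_eqI[OF is_group _ _ _ g])
      show "F \<circ> K \<in> hom G G"
        using K(1) F(1) by (rule Group.hom_compose)
      show "id \<in> hom G G"
        by (simp add: hom_def)
      show "(F \<circ> K) (\<sigma> s) = id (\<sigma> s)" if s: "s \<in> S" for s
      proof (cases "s \<in> T0 \<union> T1")
        case True
        then show ?thesis
          using f1[OF True] K(2)[OF s] F(2)[of "[(Inl (\<sigma> s), True)]"] s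
          by (simp add: \<iota>_def e_def InlI)
      next
        case False
        then have "s \<in> T0 \<union> T2"
          using s sub(4) by blast
        from f2[OF this] show ?thesis
          using K(2)[OF s] F(2)[of "[(Inr (\<sigma> s), True)]"] s
          by (simp add: \<kappa>_def e_def InrI)
      qed
    qed
    then show ?thesis by simp
  qed
  have KFl: "K (F (?cl [x])) = ?cl [x]" if "fst x \<in> L" for x
  proof -
    have pos: "K (F (?cl [(y, True)])) = ?cl [(y, True)]" if "y \<in> L" for y
      using that F(2)[of "[(y, True)]"] e[OF that] K\<iota> K\<kappa>
      by (cases y) (simp_all add: e_def \<iota>_def \<kappa>_def)
    interpret FH: group_hom ?P G F
      using F(1) by unfold_locales
    interpret KH: group_hom G ?P K
      using K(1) by unfold_locales
    obtain y b where x: "x = (y, b)"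
      by fastforce
    show ?thesis
    proof (cases b)
      case True
      then show ?thesis using pos that x by simp
    next
      case False
      then show ?thesis
        using pos[of y] presented_inv_letter[of y L R] that x
          presented_class_closed[of "[(y, True)]" L R] by simp
    qed
  qed
  have KF: "K (F X) = X" if X: "X \<in> carrier ?P" for X
  proof -
    have "K (F (?cl u)) = ?cl u" if "u \<in> words L" for u
      using that
    proof (induction u)
      case Nil
      then show ?case
        using F(2)[of "[]"] K1 presented_one[of L R] by simp
    next
      case (Cons x u)
      have split: "?cl (x # u) = ?cl [x] \<otimes>\<^bsub>?P\<^esub> ?cl u"
        using presented_mult[of "[x]" L u R] Cons.prems by simp
      have c: "?cl [x] \<in> carrier ?P" "?cl u \<in> carrier ?P"
        using Cons.prems by (auto intro!: presented_class_closed)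
      then show ?case
        unfolding split using hom_mult[OF F(1) c] KFl[of x] Cons
          hom_mult[OF K(1), of "F (?cl [x])" "F (?cl u)"] hom_in_carrier[OF F(1)] by simp
    qed
    then show ?thesis
      using presented_class_cases[OF X] by metis
  qed
  have "bij_betw K (carrier G) (carrier ?P)"
    by (rule bij_betwI[of _ _ _ F])
      (use FK KF hom_in_carrier[OF F(1)] hom_in_carrier[OF K(1)] in auto)
  then show ?thesis
    unfolding amalgamated_product_def is_iso_def iso_def
    unfolding L_def[symmetric] R_def[symmetric] using K(1) by blast
qed

text \<open>A clique generates a finite edge group, and any members of \<open>T1\<close> and
  \<open>T2\<close> witness that both factors are strictly larger than it.\<close>

lemma one_ended_no_separating_clique:
  assumes "one_ended G"
  shows no_separating_clique
  unfolding no_separating_clique_def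
proof (intro allI impI notI, elim conjE)
  fix T1 T2 assume T: "T1 \<subseteq> S" "T2 \<subseteq> S" "T1 \<noteq> {}" "T2 \<noteq> {}" "T1 \<inter> T2 = {}"
    "\<forall>s\<in>T1. \<forall>t\<in>T2. \<not> adj s t" and clique: "clique (S - T1 - T2)"
  let ?T0 = "S - T1 - T2"
  obtain s t where st: "s \<in> T1" "t \<in> T2"
    using T by blast
  have fin: "finite S"
    using finite_generators assms by (simp add: one_ended_def)
  have "G \<cong> amalgamated_product (special (?T0 \<union> T1)) (special (?T0 \<union> T2)) (special ?T0) id id"
    using T by (intro separating_clique_amalgam) auto
  moreover have "group (special (?T0 \<union> T1))" "group (special (?T0 \<union> T2))" "group (special ?T0)"
    using T by (auto intro!: group_special)
  moreover have "finite (carrier (special ?T0))"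
    using clique fin by (intro finite_special_clique) auto
  moreover have "id \<in> hom (special ?T0) (special (?T0 \<union> T1))" "id \<in> hom (special ?T0) (special (?T0 \<union> T2))"
    using T by (auto intro!: special_hom_incl)
  moreover have "id ` carrier (special ?T0) \<noteq> carrier (special (?T0 \<union> T1))"
    "id ` carrier (special ?T0) \<noteq> carrier (special (?T0 \<union> T2))"
    using special_proper[of ?T0 "?T0 \<union> T1" s] special_proper[of ?T0 "?T0 \<union> T2" t] st T by auto
  ultimately have "splits_as_amalgam_over_finite G"
    unfolding splits_as_amalgam_over_finite_def using inj_on_id by blast
  then show False
    using assms by (simp add: one_ended_def)
qed

end


section \<open>Commuting infinite dihedral groups and hyperbolicity\<close>

context group
begin

lemma foldr_mult_closed: "set xs \<subseteq> carrier G \<Longrightarrow> foldr (\<otimes>) xs \<one> \<in> carrier G"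
  by (induction xs) auto

lemma foldr_mult_append:
  "set xs \<subseteq> carrier G \<Longrightarrow> set ys \<subseteq> carrier G \<Longrightarrow>
    foldr (\<otimes>) (xs @ ys) \<one> = foldr (\<otimes>) xs \<one> \<otimes> foldr (\<otimes>) ys \<one>"
  by (induction xs) (auto simp: m_assoc foldr_mult_closed simp del: foldr_append)

lemma foldr_mult_inv:
  "set xs \<subseteq> carrier G \<Longrightarrow> foldr (\<otimes>) (rev (map (m_inv G) xs)) \<one> = inv (foldr (\<otimes>) xs \<one>)"
proof (induction xs)
  case (Cons x xs)
  then have "set (rev (map (m_inv G) xs)) \<subseteq> carrier G" "set [inv x] \<subseteq> carrier G"
    by auto
  then have "foldr (\<otimes>) (rev (map (m_inv G) xs) @ [inv x]) \<one>
      = foldr (\<otimes>) (rev (map (m_inv G) xs)) \<one> \<otimes> foldr (\<otimes>) [inv x] \<one>"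
    by (rule foldr_mult_append)
  then show ?case
    using Cons foldr_mult_closed[of xs] by (simp add: inv_mult_group del: foldr_append)
qed simp

lemma letters_closed: "X \<subseteq> carrier G \<Longrightarrow> X \<union> m_inv G ` X \<subseteq> carrier G"
  by auto

lemma generate_word:
  assumes "X \<subseteq> carrier G" "g \<in> generate G X"
  shows "\<exists>xs. set xs \<subseteq> X \<union> m_inv G ` X \<and> foldr (\<otimes>) xs \<one> = g"
  using assms(2)
proof induction
  case one
  then show ?case by (intro exI[of _ "[]"]) simp
next
  case (incl h)
  then show ?case using assms(1) by (intro exI[of _ "[h]"]) auto
next
  case (inv h)
  then show ?case using assms(1) by (intro exI[of _ "[inv h]"]) auto
next
  case (eng g h)
  then obtain xs ys where xs: "set xs \<subseteq> X \<union> m_inv G ` X" "foldr (\<otimes>) xs \<one> = g"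
    and ys: "set ys \<subseteq> X \<union> m_inv G ` X" "foldr (\<otimes>) ys \<one> = h"
    by blast
  have "set xs \<subseteq> carrier G" "set ys \<subseteq> carrier G"
    using xs(1) ys(1) letters_closed[OF assms(1)] by (blast dest: subset_trans)+
  then have "foldr (\<otimes>) (xs @ ys) \<one> = g \<otimes> h"
    using foldr_mult_append[of xs ys] xs(2) ys(2) by simp
  then show ?case
    using xs ys by (intro exI[of _ "xs @ ys"]) auto
qed

end

section \<open>Word length for a generating set and the four-point condition\<close>

locale generated_group = group G for G :: "('a, 'b) monoid_scheme" (structure) +
  fixes X :: "'a set"
  assumes X: "X \<subseteq> carrier G" "generate G X = carrier G"
begin

abbreviation L :: "'a \<Rightarrow> nat" where "L \<equiv> word_length G X"

lemma L_witness:
  assumes "g \<in> carrier G"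
  obtains xs where "length xs = L g" "set xs \<subseteq> X \<union> m_inv G ` X" "foldr (\<otimes>) xs \<one> = g"
proof -
  have "\<exists>n xs. length xs = n \<and> set xs \<subseteq> X \<union> m_inv G ` X \<and> foldr (\<otimes>) xs \<one> = g"
    using generate_word[of X g] X assms by blast
  then have "\<exists>xs. length xs = L g \<and> set xs \<subseteq> X \<union> m_inv G ` X \<and> foldr (\<otimes>) xs \<one> = g"
    unfolding word_length_def by (rule LeastI_ex)
  then show ?thesis
    using that by blast
qed

lemma L_le: "set xs \<subseteq> X \<union> m_inv G ` X \<Longrightarrow> L (foldr (\<otimes>) xs \<one>) \<le> length xs"
  unfolding word_length_def by (rule Least_le) auto

lemma letters_foldr_closed: "set xs \<subseteq> X \<union> m_inv G ` X \<Longrightarrow> foldr (\<otimes>) xs \<one> \<in> carrier G"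
  using letters_closed[OF X(1)] by (intro foldr_mult_closed) blast

lemma letters_foldr_append:
  "set xs \<subseteq> X \<union> m_inv G ` X \<Longrightarrow> set ys \<subseteq> X \<union> m_inv G ` X \<Longrightarrow>
    foldr (\<otimes>) (xs @ ys) \<one> = foldr (\<otimes>) xs \<one> \<otimes> foldr (\<otimes>) ys \<one>"
  using letters_closed[OF X(1)] by (intro foldr_mult_append) blast+

lemma L_mult:
  assumes "g \<in> carrier G" "h \<in> carrier G"
  shows "L (g \<otimes> h) \<le> L g + L h"
proof -
  obtain xs ys where "length xs = L g" "set xs \<subseteq> X \<union> m_inv G ` X" "foldr (\<otimes>) xs \<one> = g"
    and "length ys = L h" "set ys \<subseteq> X \<union> m_inv G ` X" "foldr (\<otimes>) ys \<one> = h"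
    using L_witness assms by metis
  then show ?thesis
    using L_le[of "xs @ ys"] letters_foldr_append[of xs ys] by simp
qed

lemma L_inv_le:
  assumes "g \<in> carrier G"
  shows "L (inv g) \<le> L g"
proof -
  obtain xs where xs: "length xs = L g" "set xs \<subseteq> X \<union> m_inv G ` X" "foldr (\<otimes>) xs \<one> = g"
    using L_witness[OF assms] .
  have "set xs \<subseteq> carrier G"
    using xs(2) letters_closed[OF X(1)] by blast
  then have "foldr (\<otimes>) (rev (map (m_inv G) xs)) \<one> = inv g"
    using foldr_mult_inv xs(3) by blast
  moreover have "set (rev (map (m_inv G) xs)) \<subseteq> X \<union> m_inv G ` X"
  proof
    fix y assume "y \<in> set (rev (map (m_inv G) xs))"
    then obtain x where "x \<in> set xs" "y = inv x"
      by auto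
    moreover from this have "x \<in> X \<union> m_inv G ` X"
      using xs(2) by blast
    then have "inv x \<in> X \<union> m_inv G ` X"
      using X(1) by (auto simp: subset_iff)
    ultimately show "y \<in> X \<union> m_inv G ` X"
      by simp
  qed
  ultimately show ?thesis
    using L_le[of "rev (map (m_inv G) xs)"] xs(1) by simp
qed

lemma L_inv: "g \<in> carrier G \<Longrightarrow> L (inv g) = L g"
  using L_inv_le[of g] L_inv_le[of "inv g"] by simp

lemma L_cj_le: "g \<in> carrier G \<Longrightarrow> x \<in> carrier G \<Longrightarrow> L (cj g x) \<le> L x + 2 * L g"
  using L_mult[of "g \<otimes> x" "inv g"] L_mult[of g x] by (simp add: cj_def L_inv)

lemma four_point_rearrange:
  fixes a b P D \<delta> :: real
  assumes "min ((b + D - a) / 2) ((D + a - b) / 2) - \<delta> \<le> (b + a - P) / 2"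
  shows "P + D \<le> 2 * max a b + 2 * \<delta>"
proof (cases "a \<le> b")
  case True
  then have "min ((b + D - a) / 2) ((D + a - b) / 2) = (D + a - b) / 2"
    by (intro min_absorb2) simp
  then show ?thesis
    using assms True by (simp add: field_simps)
next
  case False
  then have "min ((b + D - a) / 2) ((D + a - b) / 2) = (b + D - a) / 2"
    by (intro min_absorb1) simp
  then show ?thesis
    using assms False by (simp add: field_simps)
qed

text \<open>The points \<open>\<one>\<close>, \<open>a\<close>, \<open>a \<otimes> b\<close>,
  \<open>b\<close> form a parallelogram because \<open>a\<close> and \<open>b\<close> commute. Its
  sides have lengths \<open>L a\<close> and \<open>L b\<close>, its diagonals
  \<open>L (a \<otimes> b)\<close> and \<open>L (inv a \<otimes> b)\<close>; the Gromov products are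
  taken at the base point \<open>b\<close>.\<close>

lemma four_point:
  assumes hyp: "\<forall>w\<in>carrier G. \<forall>x\<in>carrier G. \<forall>y\<in>carrier G. \<forall>z\<in>carrier G.
      gromov_product (word_dist G X) w x z
        \<ge> min (gromov_product (word_dist G X) w x y) (gromov_product (word_dist G X) w y z) - \<delta>"
    and a: "a \<in> carrier G" and b: "b \<in> carrier G" and ab: "a \<otimes> b = b \<otimes> a"
  shows "real (L (a \<otimes> b)) + real (L (inv a \<otimes> b)) \<le> 2 * max (real (L a)) (real (L b)) + 2 * \<delta>"
proof -
  let ?d = "word_dist G X"
  have "gromov_product ?d b \<one> (a \<otimes> b)
      \<ge> min (gromov_product ?d b \<one> a) (gromov_product ?d b a (a \<otimes> b)) - \<delta>"
    using hyp a b by simp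
  moreover have "?d \<one> b = L b" "?d \<one> a = L a" "?d \<one> (a \<otimes> b) = L (a \<otimes> b)" "?d a b = L (inv a \<otimes> b)"
    "?d a (a \<otimes> b) = L b"
    using a b by (simp_all add: word_dist_def)
  moreover have "?d (a \<otimes> b) b = L a"
  proof -
    have "inv (a \<otimes> b) \<otimes> b = inv a"
      using a b ab by (simp add: inv_mult_group m_assoc)
    then show ?thesis
      using a L_inv by (simp add: word_dist_def)
  qed
  ultimately show ?thesis
    unfolding gromov_product_def using four_point_rearrange[of "L b" "L (inv a \<otimes> b)" "L a" \<delta> "L (a \<otimes> b)"]
    by simp
qed

text \<open>
  The inverting element \<open>r\<close> makes the two diagonals of the parallelogram spanned by \<open>a\<close> and \<open>b\<close>
  nearly equal; the four-point condition for the parallelogram and for the one spanned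
  by its diagonals then gives the claim.
\<close>
lemma dihedral_four_point:
  assumes hyp: "\<forall>w\<in>carrier G. \<forall>x\<in>carrier G. \<forall>y\<in>carrier G. \<forall>z\<in>carrier G.
      gromov_product (word_dist G X) w x z
        \<ge> min (gromov_product (word_dist G X) w x y) (gromov_product (word_dist G X) w y z) - \<delta>"
    and a: "a \<in> carrier G" and b: "b \<in> carrier G" and r: "r \<in> carrier G"
    and ab: "a \<otimes> b = b \<otimes> a" and ra: "cj r a = inv a" and rb: "cj r b = b"
  shows "real (L (a \<otimes> a)) + real (L (b \<otimes> b))
    \<le> 2 * max (real (L a)) (real (L b)) + 4 * \<delta> + 6 * real (L r)"
proof -
  have ab': "inv a \<otimes> b = b \<otimes> inv a"
    using ab a b by (metis inv_closed inv_solve_left inv_solve_right m_assoc m_closed)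
  have cj: "cj r (a \<otimes> b) = inv a \<otimes> b" "cj r (inv a \<otimes> b) = a \<otimes> b"
  proof -
    show 1: "cj r (a \<otimes> b) = inv a \<otimes> b"
      using a b r ra rb by (simp add: cj_distrib)
    have "cj r (inv a) = inv (cj r a)"
      using a r by (simp add: cj_def inv_mult_group m_assoc)
    then show "cj r (inv a \<otimes> b) = a \<otimes> b"
      using a b r ra rb by (simp add: cj_distrib)
  qed
  have near: "L (inv a \<otimes> b) \<le> L (a \<otimes> b) + 2 * L r" "L (a \<otimes> b) \<le> L (inv a \<otimes> b) + 2 * L r"
    using L_cj_le[of r "a \<otimes> b"] L_cj_le[of r "inv a \<otimes> b"] cj a b r by simp_all
  have 1: "real (L (a \<otimes> b)) + real (L (inv a \<otimes> b)) \<le> 2 * max (real (L a)) (real (L b)) + 2 * \<delta>"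
    using four_point[OF hyp a b ab] .
  \<comment> \<open>The parallelogram spanned by \<open>a \<otimes> b\<close> and
    \<open>inv a \<otimes> b\<close> has diagonals given by \<open>b \<otimes> b\<close> and the
    inverse of \<open>a \<otimes> a\<close>.\<close>
  have m1: "(a \<otimes> b) \<otimes> (inv a \<otimes> b) = b \<otimes> b"
    using a b by (metis ab' ab inv_cancel_left(2) inv_closed m_assoc m_closed)
  have m2: "(inv a \<otimes> b) \<otimes> (a \<otimes> b) = b \<otimes> b"
    using a b by (metis ab inv_cancel_left(1) inv_closed m_assoc m_closed)
  have m3: "inv (a \<otimes> b) \<otimes> (inv a \<otimes> b) = inv (a \<otimes> a)"
  proof -
    have "inv (a \<otimes> b) \<otimes> (inv a \<otimes> b) = inv a \<otimes> inv b \<otimes> (b \<otimes> inv a)"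
      using a b ab ab' by (simp add: inv_mult_group)
    then show ?thesis
      using a b by (simp add: inv_mult_group m_assoc)
  qed
  have "real (L (b \<otimes> b)) + real (L (a \<otimes> a))
      \<le> 2 * max (real (L (a \<otimes> b))) (real (L (inv a \<otimes> b))) + 2 * \<delta>"
    using four_point[OF hyp, of "a \<otimes> b" "inv a \<otimes> b"] m1 m2 m3 a b L_inv[of "a \<otimes> a"] by simp
  \<comment> \<open>Twice the longer diagonal exceeds the sum of both by at most their difference,
    which is at most \<open>2 * L r\<close>; each use of the four-point condition adds
    \<open>2 * \<delta>\<close>. The coefficient 6 leaves slack.\<close>
  then show ?thesis
    using 1 near by (simp add: max_def split: if_splits)
qed

end

context racg
begin

section \<open>Counting walls as a lower bound for word length\<close>

definition walls :: "'a \<Rightarrow> 'a set" where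
  "walls g = {r \<in> reflections. side r g}"

lemma finite_walls: "g \<in> carrier G \<Longrightarrow> finite (walls g)"
proof (induction rule: racg_induct)
  case (step w s)
  have "walls (w \<otimes> \<sigma> s) \<subseteq> insert (cj w (\<sigma> s)) (walls w)"
    using step side_step by (auto simp: walls_def)
  then show ?case
    using step finite_subset by blast
qed (simp add: walls_def)

text \<open>A wall separating \<open>\<one>\<close> from \<open>g \<otimes> h\<close> separates
  \<open>\<one>\<close> from \<open>g\<close>, or \<open>g\<close> from
  \<open>g \<otimes> h\<close>; in the second case it is the translate by \<open>g\<close> of a wall
  of \<open>h\<close>.\<close>

lemma card_walls_mult:
  assumes "g \<in> carrier G" "h \<in> carrier G"
  shows "card (walls (g \<otimes> h)) \<le> card (walls g) + card (walls h)"
proof -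
  have "walls (g \<otimes> h) \<subseteq> walls g \<union> cj g ` walls h"
  proof
    fix r assume r: "r \<in> walls (g \<otimes> h)"
    then have rr: "r \<in> reflections"
      by (simp add: walls_def)
    have "side r g \<or> side (cj (inv g) r) h"
      using side_mult[of h g r] r rr assms by (auto simp: walls_def)
    moreover have "r = cj g (cj (inv g) r)"
      using assms rr by simp
    ultimately show "r \<in> walls g \<union> cj g ` walls h"
      using rr assms by (auto simp: walls_def intro!: image_eqI[of r "cj g" "cj (inv g) r"])
  qed
  then have "card (walls (g \<otimes> h)) \<le> card (walls g \<union> cj g ` walls h)"
    using assms by (intro card_mono) (auto simp: finite_walls)
  also have "\<dots> \<le> card (walls g) + card (cj g ` walls h)"
    by (rule card_Un_le)
  also have "\<dots> \<le> card (walls g) + card (walls h)"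
    using card_image_le[OF finite_walls[OF assms(2)]] by simp
  finally show ?thesis .
qed

lemma side_equivariant:
  assumes "r \<in> carrier G" "h \<in> carrier G" "y \<in> carrier G" "z \<in> carrier G"
  shows "side (cj h r) (h \<otimes> y) = side (cj h r) (h \<otimes> z) \<longleftrightarrow> side r y = side r z"
  using side_mult[of y h "cj h r"] side_mult[of z h "cj h r"] assms by auto

lemma empty_quadrant:
  assumes "r \<in> reflections" "t \<in> reflections" "r \<otimes> t \<noteq> t \<otimes> r"
  shows "\<exists>a b. \<forall>y\<in>carrier G. \<not> (side r y = a \<and> side t y = b)"
proof (rule ccontr)
  assume "\<not> ?thesis"
  then have *: "\<exists>y\<in>carrier G. side r y = a \<and> side t y = b" for a b
    by blast
  obtain x1 x2 x3 x4 where "x1 \<in> carrier G" "side r x1" "side t x1"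
    "x2 \<in> carrier G" "side r x2" "\<not> side t x2" "x3 \<in> carrier G" "\<not> side r x3" "\<not> side t x3"
    "x4 \<in> carrier G" "\<not> side r x4" "side t x4"
    using *[of True True] *[of True False] *[of False False] *[of False True] by auto
  then have "crossing r t"
    using assms by (intro four_quadrants_crossing[of r t x1 x2 x3 x4]) auto
  then show False
    using assms crossing_iff by simp
qed

text \<open>The walls do not cross, so some quadrant is empty. The two ends of an edge on the wall
  of \<open>r\<close> agree about \<open>t\<close>, and one of them lies in the opposite quadrant;
  every point shares a side with it for at least one wall.\<close>

lemma point_between:
  assumes r: "r \<in> reflections" and t: "t \<in> reflections" and nc: "r \<otimes> t \<noteq> t \<otimes> r"
  obtains x where "x \<in> carrier G" "\<And>y. y \<in> carrier G \<Longrightarrow> side r y = side r x \<or> side t y = side t x"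
proof -
  obtain a b where ab: "\<And>y. y \<in> carrier G \<Longrightarrow> \<not> (side r y = a \<and> side t y = b)"
    using empty_quadrant[OF assms] by blast
  obtain w s where w: "w \<in> carrier G" "s \<in> S" "r = cj w (\<sigma> s)"
    using r by (elim reflectionsE)
  have "r \<noteq> t"
    using nc by auto
  then have same: "side t (r \<otimes> w) = side t w"
    using side_step[of w s t] cj_mult_right[of w "\<sigma> s"] w by auto
  have "\<exists>x\<in>carrier G. side r x \<noteq> a \<and> side t x \<noteq> b"
  proof (cases "side r w = a")
    case True
    then show ?thesis
      using ab[OF w(1)] same r w by (intro bexI[of _ "r \<otimes> w"]) auto
  next
    case False
    then show ?thesis
      using ab[of "r \<otimes> w"] same r w by (intro bexI[of _ w]) auto
  qed
  then show ?thesis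
    using that ab by metis
qed

text \<open>
  The product of two reflections with disjoint walls moves a half-space properly into itself, and
  its iterates are bounded by \<open>n\<close> distinct walls between \<open>x\<close> and \<open>(rt)\<^sup>n x\<close>.
\<close>
lemma reflection_product_growth:
  assumes r: "r \<in> reflections" and t: "t \<in> reflections" and nc: "r \<otimes> t \<noteq> t \<otimes> r"
  shows "\<exists>c. \<forall>n. n \<le> card (walls ((r \<otimes> t) [^] (n::nat))) + c"
proof -
  obtain x where x: "x \<in> carrier G"
    "\<And>y. y \<in> carrier G \<Longrightarrow> side r y = side r x \<or> side t y = side t x"
    using point_between[OF assms] by blast
  define g where "g = r \<otimes> t"
  have g: "g \<in> carrier G"
    using r t by (simp add: g_def)
  define A where "A = {y \<in> carrier G. side r y \<noteq> side r x}"
  \<comment> \<open>\<open>t\<close> moves \<open>y\<close> across its wall, where all points lie on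
    the side of \<open>r\<close> that contains \<open>x\<close>; then \<open>r\<close> moves the
    result into \<open>A\<close>.\<close>
  have gA: "g \<otimes> y \<in> A" if "y \<in> carrier G" "side t y = side t x" for y
  proof -
    have "side t (t \<otimes> y) \<noteq> side t x"
      using that t by auto
    then have "side r (t \<otimes> y) = side r x"
      using x(2)[of "t \<otimes> y"] that t by auto
    then show ?thesis
      using that r t by (auto simp: A_def g_def m_assoc)
  qed
  have AA: "g \<otimes> y \<in> A" if "y \<in> A" for y
    using that x(2)[of y] by (intro gA) (auto simp: A_def)
  have pos: "g [^] Suc k \<otimes> x \<in> A" for k :: nat
  proof (induction k)
    case 0
    then show ?case using gA[of x] x g by simp
  next
    case (Suc k)
    have "g [^] Suc (Suc k) \<otimes> x = g \<otimes> (g [^] Suc k \<otimes> x)"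
      using g x by (metis m_assoc nat_pow_Suc2 nat_pow_closed)
    then show ?case
      using AA[OF Suc] by simp
  qed
  have AAk: "g [^] k \<otimes> y \<in> A" if "y \<in> A" for y and k :: nat
  proof (induction k)
    case 0
    then show ?case using that by (simp add: A_def)
  next
    case (Suc k)
    have "y \<in> carrier G"
      using that by (simp add: A_def)
    then have "g [^] Suc k \<otimes> y = g \<otimes> (g [^] k \<otimes> y)"
      using g by (metis m_assoc nat_pow_Suc2 nat_pow_closed)
    then show ?case
      using AA[OF Suc] by simp
  qed
  have neg: "inv (g [^] k) \<otimes> x \<notin> A" for k :: nat
  proof
    assume "inv (g [^] k) \<otimes> x \<in> A"
    then have "g [^] k \<otimes> (inv (g [^] k) \<otimes> x) \<in> A"
      by (rule AAk)
    then show False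
      using g x by (simp add: A_def)
  qed
  \<comment> \<open>The wall of \<open>cj (g [^] i) r\<close> bounds the translate of
    \<open>A\<close> by \<open>g [^] i\<close>, which never contains \<open>x\<close> and contains
    \<open>g [^] n \<otimes> x\<close> exactly when \<open>i < n\<close>. The boundary case
    \<open>i = n\<close> serves to tell the walls for different exponents apart.\<close>
  have sep: "side (cj (g [^] i) r) x \<noteq> side (cj (g [^] i) r) (g [^] (n::nat) \<otimes> x) \<longleftrightarrow> i < n"
    if "i \<le> n" for i n :: nat
  proof -
    define k where "k = n - i"
    have n: "g [^] n \<otimes> x = g [^] i \<otimes> (g [^] k \<otimes> x)"
      using g x that nat_pow_mult[of g i k] by (simp add: k_def flip: m_assoc)
    have "side (cj (g [^] i) r) x = side (cj (g [^] i) r) (g [^] n \<otimes> x) \<longleftrightarrow>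
        side r (inv (g [^] i) \<otimes> x) = side r (g [^] k \<otimes> x)"
      using side_equivariant[of r "g [^] i" "inv (g [^] i) \<otimes> x" "g [^] k \<otimes> x"] g x r
      unfolding n by simp
    moreover have "side r (inv (g [^] i) \<otimes> x) = side r x"
      using neg[of i] g x by (simp add: A_def)
    moreover have "side r (g [^] k \<otimes> x) \<noteq> side r x \<longleftrightarrow> k \<noteq> 0"
      using pos[of "k - 1"] g x by (cases k) (auto simp: A_def)
    ultimately show ?thesis
      using that by (auto simp: k_def)
  qed
  \<comment> \<open>Translation by \<open>inv x\<close> moves the base point to
    \<open>\<one>\<close>, where \<open>walls\<close> counts. Its cost, the number of walls of
    \<open>x\<close> and of \<open>inv x\<close>, is the constant \<open>c\<close>.\<close>
  define f where "f i = cj (inv x) (cj (g [^] i) r)" for i :: nat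
  have inj: "inj f"
  proof (rule linorder_injI)
    fix i j :: nat assume "i < j"
    then have "cj (g [^] i) r \<noteq> cj (g [^] j) r"
      using sep[of i j] sep[of j j] by auto
    then show "f i \<noteq> f j"
      using g x r by (simp add: f_def)
  qed
  have bound: "n \<le> card (walls (inv x \<otimes> (g [^] n \<otimes> x)))" for n :: nat
  proof -
    have "f ` {..<n} \<subseteq> walls (inv x \<otimes> (g [^] n \<otimes> x))"
    proof (rule image_subsetI)
      fix i assume "i \<in> {..<n}"
      then have "side (cj (g [^] i) r) x \<noteq> side (cj (g [^] i) r) (x \<otimes> (inv x \<otimes> (g [^] n \<otimes> x)))"
        using sep[of i n] g x by simp
      then have "side (f i) (inv x \<otimes> (g [^] n \<otimes> x))"
        using side_mult[of "inv x \<otimes> (g [^] n \<otimes> x)" x "cj (g [^] i) r"] g x r by (auto simp: f_def)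
      then show "f i \<in> walls (inv x \<otimes> (g [^] n \<otimes> x))"
        using g x r by (simp add: walls_def f_def)
    qed
    moreover have "finite (walls (inv x \<otimes> (g [^] n \<otimes> x)))"
      using g x by (intro finite_walls) simp
    ultimately have "card (f ` {..<n}) \<le> card (walls (inv x \<otimes> (g [^] n \<otimes> x)))"
      by (rule card_mono[rotated])
    moreover have "inj_on f {..<n}"
      using inj by (rule inj_on_subset) simp
    ultimately show ?thesis
      by (simp add: card_image)
  qed
  have "n \<le> card (walls (g [^] n)) + (card (walls (inv x)) + card (walls x))" for n :: nat
    using bound[of n] card_walls_mult[of "inv x" "g [^] n \<otimes> x"] card_walls_mult[of "g [^] n" x] g x
    by simp
  then show ?thesis
    unfolding g_def by blast
qed

lemma cj_reflection_power:
  assumes r: "r \<in> reflections" and t: "t \<in> reflections"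
  shows "cj r ((r \<otimes> t) [^] (n::nat)) = inv ((r \<otimes> t) [^] n)"
proof -
  have "cj r (r \<otimes> t) = inv (r \<otimes> t)"
    using r t by (simp add: cj_def inv_mult_group m_assoc)
  moreover have "cj r (g [^] n) = cj r g [^] n" if "g \<in> carrier G" for g
    using that r by (induction n) (auto simp: cj_distrib)
  ultimately show ?thesis
    using r t by (simp add: nat_pow_inv)
qed

lemma word_length_lower_bound:
  assumes gen: "finite X" "X \<subseteq> carrier G" "generate G X = carrier G"
  obtains \<kappa> where "\<kappa> > 0" "\<And>g. g \<in> carrier G \<Longrightarrow> card (walls g) \<le> \<kappa> * word_length G X g"
proof -
  interpret generated_group G X
    using gen(2,3) by unfold_locales
  let ?Y = "X \<union> m_inv G ` X"
  \<comment> \<open>The sum bounds the count of each single letter, and \<open>Suc\<close> makes the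
    constant positive.\<close>
  define \<kappa> where "\<kappa> = Suc (\<Sum>y\<in>?Y. card (walls y))"
  have \<kappa>: "card (walls y) \<le> \<kappa>" if "y \<in> ?Y" for y
  proof -
    have "card (walls y) \<le> (\<Sum>y\<in>?Y. card (walls y))"
      using gen(1) that by (intro member_le_sum) auto
    then show ?thesis
      by (simp add: \<kappa>_def)
  qed
  have fold: "card (walls (foldr (\<otimes>) xs \<one>)) \<le> \<kappa> * length xs" if "set xs \<subseteq> ?Y" for xs
    using that
  proof (induction xs)
    case (Cons y ys)
    have "y \<in> carrier G"
      using Cons.prems X by auto
    then show ?case
      using card_walls_mult[of y "foldr (\<otimes>) ys \<one>"] letters_foldr_closed[of ys] \<kappa>[of y] Cons by simp
  qed (simp add: walls_def)
  have "card (walls g) \<le> \<kappa> * word_length G X g" if g: "g \<in> carrier G" for g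
  proof -
    obtain xs where "length xs = L g" "set xs \<subseteq> ?Y" "foldr (\<otimes>) xs \<one> = g"
      using L_witness[OF g] .
    then show ?thesis
      using fold[of xs] by simp
  qed
  then show ?thesis
    using that[of \<kappa>] by (simp add: \<kappa>_def)
qed

end

text \<open>The quantity \<open>(M k + C) / 2 ^ k\<close> drops by at least
  \<open>\<epsilon>\<close> in every step, so it cannot stay nonnegative.\<close>

lemma doubling_recursion_contradiction:
  fixes M :: "nat \<Rightarrow> real"
  assumes "\<And>k. M k \<ge> 0" "\<epsilon> > 0" "C \<ge> 0" and step: "\<And>k. M (Suc k) + \<epsilon> * 2 ^ Suc k \<le> 2 * M k + C"
  shows False
proof -
  have bound: "M k \<le> 2 ^ k * (M 0 + C - real k * \<epsilon>) - C" for k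
  proof (induction k)
    case (Suc k)
    have "M (Suc k) \<le> 2 * (2 ^ k * (M 0 + C - real k * \<epsilon>) - C) + C - \<epsilon> * 2 ^ Suc k"
      using step[of k] Suc by simp
    also have "\<dots> = 2 ^ Suc k * (M 0 + C - real (Suc k) * \<epsilon>) - C"
      by (simp add: algebra_simps)
    finally show ?case .
  qed simp
  obtain k :: nat where "real k * \<epsilon> > M 0 + C"
    using ex_less_of_nat_mult[OF assms(2)] by blast
  then have "2 ^ k * (M 0 + C - real k * \<epsilon>) < 0"
    by (simp add: mult_pos_neg)
  then show False
    using bound[of k] assms(1)[of k] assms(3) by simp
qed

context racg
begin

text \<open>The two commuting products of reflections have powers of at least linear length. By the
  four-point condition the lengths of both powers at a doubled exponent add up to at most twice the
  previous maximum and a constant, which leaves too little room for the shorter one to grow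
  linearly.\<close>

lemma hyperbolic_no_reflection_flat:
  assumes "hyperbolic_group G"
  shows no_reflection_flat
  unfolding no_reflection_flat_def
proof (intro ballI impI, elim conjE, rule ccontr)
  fix a0 a1 b0 b1
  assume refl: "a0 \<in> reflections" "a1 \<in> reflections" "b0 \<in> reflections" "b1 \<in> reflections"
    and comm: "a0 \<otimes> b0 = b0 \<otimes> a0" "a0 \<otimes> b1 = b1 \<otimes> a0" "a1 \<otimes> b0 = b0 \<otimes> a1" "a1 \<otimes> b1 = b1 \<otimes> a1"
    and "\<not> (a0 \<otimes> a1 = a1 \<otimes> a0 \<or> b0 \<otimes> b1 = b1 \<otimes> b0)"
  then have nc: "a0 \<otimes> a1 \<noteq> a1 \<otimes> a0" "b0 \<otimes> b1 \<noteq> b1 \<otimes> b0"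
    by auto
  obtain X \<delta> where gen: "finite X" "X \<subseteq> carrier G" "generate G X = carrier G" and \<delta>: "\<delta> \<ge> 0"
    and hyp: "\<forall>w\<in>carrier G. \<forall>x\<in>carrier G. \<forall>y\<in>carrier G. \<forall>z\<in>carrier G.
      gromov_product (word_dist G X) w x z
        \<ge> min (gromov_product (word_dist G X) w x y) (gromov_product (word_dist G X) w y z) - \<delta>"
    using assms unfolding hyperbolic_group_def gromov_hyperbolic_space_def by blast
  interpret generated_group G X
    using gen(2,3) by unfold_locales
  obtain \<kappa> where \<kappa>: "\<kappa> > 0" "\<And>g. g \<in> carrier G \<Longrightarrow> card (walls g) \<le> \<kappa> * L g"
    using word_length_lower_bound[OF gen] by blast
  obtain c1 where c1: "\<And>n. n \<le> card (walls ((a0 \<otimes> a1) [^] (n::nat))) + c1"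
    using reflection_product_growth[OF refl(1,2) nc(1)] by blast
  obtain c2 where c2: "\<And>n. n \<le> card (walls ((b0 \<otimes> b1) [^] (n::nat))) + c2"
    using reflection_product_growth[OF refl(3,4) nc(2)] by blast
  define g where "g n = (a0 \<otimes> a1) [^] n" for n :: nat
  define h where "h n = (b0 \<otimes> b1) [^] n" for n :: nat
  have gh: "g n \<in> carrier G" "h n \<in> carrier G" for n
    using refl by (simp_all add: g_def h_def)
  have double: "g (2 ^ Suc k) = g (2 ^ k) \<otimes> g (2 ^ k)" "h (2 ^ Suc k) = h (2 ^ k) \<otimes> h (2 ^ k)" for k
    using refl by (simp_all add: g_def h_def nat_pow_mult mult_2)
  have ab: "(a0 \<otimes> a1) \<otimes> b = b \<otimes> (a0 \<otimes> a1)"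
    if "b \<in> carrier G" "a0 \<otimes> b = b \<otimes> a0" "a1 \<otimes> b = b \<otimes> a1" for b
    using that refl by (metis m_assoc reflections_closed)
  have a0h: "a0 \<otimes> h n = h n \<otimes> a0" "a1 \<otimes> h n = h n \<otimes> a1" for n
  proof -
    have "a \<otimes> h n = h n \<otimes> a" if "a \<in> carrier G" "a \<otimes> b0 = b0 \<otimes> a" "a \<otimes> b1 = b1 \<otimes> a" for a
    proof -
      have "(b0 \<otimes> b1) \<otimes> a = a \<otimes> (b0 \<otimes> b1)"
        using that refl by (metis m_assoc reflections_closed)
      then show ?thesis
        using group_commutes_pow[of "b0 \<otimes> b1" a n] that refl by (simp add: h_def)
    qed
    then show "a0 \<otimes> h n = h n \<otimes> a0" "a1 \<otimes> h n = h n \<otimes> a1"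
      using comm refl by auto
  qed
  have ghc: "g n \<otimes> h n = h n \<otimes> g n" for n
    using group_commutes_pow[of "a0 \<otimes> a1" "h n" n] ab[OF gh(2) a0h] refl gh by (simp add: g_def)
  define M where "M k = max (real (L (g (2 ^ k)))) (real (L (h (2 ^ k))))" for k
  have low: "real n - real c1 \<le> \<kappa> * real (L (g n))" "real n - real c2 \<le> \<kappa> * real (L (h n))" for n
  proof -
    have "n \<le> \<kappa> * L (g n) + c1" "n \<le> \<kappa> * L (h n) + c2"
      using c1[of n] c2[of n] \<kappa>(2)[OF gh(1), of n] \<kappa>(2)[OF gh(2), of n] by (simp_all add: g_def h_def)
    then have "real n \<le> real (\<kappa> * L (g n) + c1)" "real n \<le> real (\<kappa> * L (h n) + c2)"
      by (simp_all only: of_nat_le_iff)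
    then show "real n - real c1 \<le> \<kappa> * real (L (g n))" "real n - real c2 \<le> \<kappa> * real (L (h n))"
      by simp_all
  qed
  define \<epsilon> where "\<epsilon> = 1 / real \<kappa>"
  define c where "c = real (max c1 c2) / real \<kappa>"
  have low': "\<epsilon> * real n - c \<le> min (real (L (g n))) (real (L (h n)))" for n
  proof -
    have "real n - real (max c1 c2) \<le> \<kappa> * min (real (L (g n))) (real (L (h n)))"
      using low[of n] by (auto simp: min_def max_def)
    then have "(real n - real (max c1 c2)) / \<kappa> \<le> min (real (L (g n))) (real (L (h n)))"
      using \<kappa>(1) by (simp only: divide_le_eq mult.commute of_nat_0_less_iff) simp
    then show ?thesis
      by (simp add: \<epsilon>_def c_def diff_divide_distrib)
  qed
  \<comment> \<open>The first two terms come from \<open>dihedral_four_point\<close> with the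
    inverting reflection \<open>a0\<close>, the last one from the error in
    \<open>low'\<close>.\<close>
  define C where "C = 4 * \<delta> + 6 * real (L a0) + c"
  have "M (Suc k) + \<epsilon> * 2 ^ Suc k \<le> 2 * M k + C" for k
  proof -
    have "real (L (g (2 ^ k) \<otimes> g (2 ^ k))) + real (L (h (2 ^ k) \<otimes> h (2 ^ k)))
        \<le> 2 * M k + 4 * \<delta> + 6 * real (L a0)"
      unfolding M_def
    proof (rule dihedral_four_point[OF hyp gh _ ghc])
      show "a0 \<in> carrier G"
        using refl by simp
      show "cj a0 (g (2 ^ k)) = inv (g (2 ^ k))"
        unfolding g_def using refl by (intro cj_reflection_power)
      show "cj a0 (h (2 ^ k)) = h (2 ^ k)"
        using refl gh a0h by (intro cj_commute) auto
    qed
    then have "real (L (g (2 ^ Suc k))) + real (L (h (2 ^ Suc k))) \<le> 2 * M k + 4 * \<delta> + 6 * real (L a0)"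
      by (simp only: double)
    \<comment> \<open>The sum of the two lengths is their maximum, \<open>M (Suc k)\<close>, plus
      their minimum, to which \<open>low'\<close> applies.\<close>
    then show ?thesis
      using low'[of "2 ^ Suc k"] by (simp add: M_def C_def max_def min_def split: if_splits)
  qed
  moreover have "M k \<ge> 0" for k
    by (simp add: M_def)
  moreover have "\<epsilon> > 0" "C \<ge> 0"
    using \<kappa>(1) \<delta> by (simp_all add: \<epsilon>_def C_def c_def)
  ultimately show False
    using doubling_recursion_contradiction[of M \<epsilon> C] by blast
qed

end


section \<open>First-order types\<close>

definition exs :: "nat list \<Rightarrow> group_formula \<Rightarrow> group_formula" where
  "exs is \<phi> = foldr (\<lambda>i \<psi>. Neg (All i (Neg \<psi>))) is \<phi>"

definition conjs :: "group_formula list \<Rightarrow> group_formula" where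
  "conjs \<phi>s = foldr Conj \<phi>s (Eq One One)"

lemma sat_conjs [simp]: "sat G e (conjs \<phi>s) \<longleftrightarrow> (\<forall>\<phi>\<in>set \<phi>s. sat G e \<phi>)"
  by (induction \<phi>s) (auto simp: conjs_def)

lemma free_vars_conjs [simp]: "free_vars (conjs \<phi>s) = (\<Union>\<phi>\<in>set \<phi>s. free_vars \<phi>)"
  by (induction \<phi>s) (auto simp: conjs_def)

lemma free_vars_exs [simp]: "free_vars (exs is \<phi>) = free_vars \<phi> - set is"
  by (induction "is") (auto simp: exs_def)

lemma sat_exs:
  "sat G e (exs is \<phi>) \<longleftrightarrow>
    (\<exists>e'. (\<forall>i\<in>set is. e' i \<in> carrier G) \<and> (\<forall>i. i \<notin> set is \<longrightarrow> e' i = e i) \<and> sat G e' \<phi>)"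
proof (induction "is" arbitrary: e)
  case Nil
  have "sat G e \<phi> \<longleftrightarrow> (\<exists>e'. (\<forall>i. e' i = e i) \<and> sat G e' \<phi>)"
    by (metis ext)
  then show ?case
    by (simp add: exs_def)
next
  case (Cons j "is")
  have "sat G e (exs (j # is) \<phi>) \<longleftrightarrow> (\<exists>x\<in>carrier G. sat G (e(j := x)) (exs is \<phi>))"
    by (simp add: exs_def)
  also have "\<dots> \<longleftrightarrow> (\<exists>x\<in>carrier G. \<exists>e'. (\<forall>i\<in>set is. e' i \<in> carrier G) \<and>
      (\<forall>i. i \<notin> set is \<longrightarrow> e' i = (e(j := x)) i) \<and> sat G e' \<phi>)"
    by (simp only: Cons.IH)
  also have "\<dots> \<longleftrightarrow> (\<exists>e'. (\<forall>i\<in>set (j # is). e' i \<in> carrier G) \<and>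
      (\<forall>i. i \<notin> set (j # is) \<longrightarrow> e' i = e i) \<and> sat G e' \<phi>)"
    (is "?l \<longleftrightarrow> ?r")
  proof
    assume ?l
    then obtain x e' where e': "x \<in> carrier G" "\<forall>i\<in>set is. e' i \<in> carrier G"
      "\<forall>i. i \<notin> set is \<longrightarrow> e' i = (e(j := x)) i" "sat G e' \<phi>"
      by blast
    then have "e' j \<in> carrier G"
      by (cases "j \<in> set is") auto
    then show ?r
      using e' by (intro exI[of _ e']) auto
  next
    assume ?r
    then obtain e' where "\<forall>i\<in>set (j # is). e' i \<in> carrier G"
      "\<forall>i. i \<notin> set (j # is) \<longrightarrow> e' i = e i" "sat G e' \<phi>"
      by blast
    then show ?l
      by (intro bexI[of _ "e' j"] exI[of _ e']) auto
  qed
  finally show ?case .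
qed

text \<open>The conjunction of \<open>\<Phi>\<close>, with the variables from \<open>k\<close> up to
  \<open>k + n\<close> (exclusive) quantified existentially, lies in the type of \<open>as\<close>
  with witnesses \<open>x\<close>. It therefore lies in the type of \<open>bs\<close>, and its
  witnesses there form \<open>e\<close>.\<close>

lemma tp_transfer:
  assumes fin: "finite \<Phi>" and fv: "\<And>\<phi>. \<phi> \<in> \<Phi> \<Longrightarrow> free_vars \<phi> \<subseteq> {..<k + n}"
    and tp: "tp G as = tp G bs" and k: "length as = k" "length bs = k"
    and x: "\<And>i. i < n \<Longrightarrow> x i \<in> carrier G"
    and sat: "\<And>\<phi>. \<phi> \<in> \<Phi> \<Longrightarrow> sat G (\<lambda>i. if k \<le> i \<and> i < k + n then x (i - k) else as ! i) \<phi>"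
  obtains e where "\<And>i. i < k \<Longrightarrow> e i = bs ! i" "\<And>i. k \<le> i \<Longrightarrow> i < k + n \<Longrightarrow> e i \<in> carrier G"
    "\<And>\<phi>. \<phi> \<in> \<Phi> \<Longrightarrow> sat G e \<phi>"
proof -
  obtain \<phi>s where \<phi>s: "set \<phi>s = \<Phi>"
    using finite_list[OF fin] by blast
  define \<theta> where "\<theta> = exs [k..<k + n] (conjs \<phi>s)"
  have "free_vars \<theta> \<subseteq> {..<k}"
    using fv \<phi>s by (fastforce simp: \<theta>_def)
  moreover have "sat G (\<lambda>i. as ! i) \<theta>"
    unfolding \<theta>_def sat_exs
    by (rule exI[of _ "\<lambda>i. if k \<le> i \<and> i < k + n then x (i - k) else as ! i"]) (use sat \<phi>s x in auto)
  ultimately have "\<theta> \<in> tp G bs"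
    unfolding tp[symmetric] using k by (simp add: tp_def)
  then have "sat G (\<lambda>i. bs ! i) \<theta>"
    by (simp add: tp_def)
  then obtain e where "\<forall>i\<in>set [k..<k + n]. e i \<in> carrier G"
    "\<forall>i. i \<notin> set [k..<k + n] \<longrightarrow> e i = bs ! i" "sat G e (conjs \<phi>s)"
    unfolding \<theta>_def sat_exs by blast
  then show ?thesis
    using \<phi>s by (intro that[of e]) auto
qed

definition word_term :: "('s \<Rightarrow> nat) \<Rightarrow> 's list \<Rightarrow> group_term" where
  "word_term idx xs = foldr (\<lambda>s t. Mul (Var (idx s)) t) xs One"

lemma term_vars_word [simp]: "term_vars (word_term idx xs) = idx ` set xs"
  by (induction xs) (auto simp: word_term_def)

lemma term_value_word:
  "term_value G e (word_term idx xs) = foldr (\<lambda>s g. e (idx s) \<otimes>\<^bsub>G\<^esub> g) xs \<one>\<^bsub>G\<^esub>"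
  by (induction xs) (auto simp: word_term_def)

context racg
begin

lemma term_value_hom:
  assumes "f \<in> hom G G" "\<And>s. s \<in> S \<Longrightarrow> e (idx s) = f (\<sigma> s)" "set xs \<subseteq> S"
  shows "term_value G e (word_term idx xs) = f (ev xs)"
  using assms(3)
proof (induction xs)
  case Nil
  then show ?case
    using hom_one[OF assms(1) is_group is_group] by (simp add: term_value_word)
next
  case (Cons s xs)
  then show ?case
    using assms(2)[of s] hom_mult[OF assms(1), of "\<sigma> s" "ev xs"] by (simp add: term_value_word)
qed

text \<open>
  The formula says that \<open>as\<close> is obtained by given words from some \<open>x\<^sub>s\<close> that satisfy the
  defining relations and for which representatives of the classes of involutions have pairwise
  non-conjugate images under \<open>s \<mapsto> x\<^sub>s\<close>.
\<close>
theorem homogeneous_if_rigid: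
  assumes fin: "finite S" and sep: no_separating_clique and flat: no_reflection_flat
  shows "homogeneous G"
  unfolding homogeneous_def
proof (intro allI impI, elim conjE)
  fix as bs :: "'a list"
  assume as: "set as \<subseteq> carrier G" and bs: "set bs \<subseteq> carrier G"
    and len: "length as = length bs" and tp: "tp G as = tp G bs"
  define k where "k = length as"
  define n where "n = card S"
  obtain h where h: "bij_betw h S {0..<n}"
    using ex_bij_betw_finite_nat[OF fin] by (auto simp: n_def)
  define idx where "idx s = k + h s" for s
  have hn: "h s < n" if "s \<in> S" for s
    using h that by (force simp: bij_betw_def)
  have idx: "k \<le> idx s" "idx s < k + n" if "s \<in> S" for s
    using hn[OF that] by (simp_all add: idx_def)
  obtain R where R: "finite R" "R \<subseteq> carrier G" "\<And>x. x \<in> R \<Longrightarrow> x \<otimes> x = \<one>"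
    "\<And>x. x \<in> carrier G \<Longrightarrow> x \<otimes> x = \<one> \<Longrightarrow> \<exists>y\<in>R. conjugate y x"
    "\<And>x y. x \<in> R \<Longrightarrow> y \<in> R \<Longrightarrow> conjugate x y \<Longrightarrow> x = y"
    using involution_representatives[OF fin] by blast
  have "\<forall>g\<in>carrier G. \<exists>xs. set xs \<subseteq> S \<and> ev xs = g"
    using ev_surj by metis
  then obtain w where w: "\<And>g. g \<in> carrier G \<Longrightarrow> set (w g) \<subseteq> S \<and> ev (w g) = g"
    by metis
  have asG: "as ! j \<in> carrier G" if "j < k" for j
    using as that by (auto simp: k_def)
  let ?v = "\<lambda>s. Var (idx s)" and ?w = "\<lambda>g. word_term idx (w g)"
  \<comment> \<open>Indices below \<open>k\<close> name the tuple and the next \<open>n\<close> the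
    images of the generators; \<open>?z\<close> is the first free index, so quantifying over the
    conjugator captures nothing.\<close>
  let ?z = "k + n"
  define \<Phi> where "\<Phi> = (\<lambda>s. Eq (Mul (?v s) (?v s)) One) ` S
    \<union> (\<lambda>(s, t). Eq (Mul (?v s) (?v t)) (Mul (?v t) (?v s))) ` {(s, t) \<in> S \<times> S. adj s t}
    \<union> (\<lambda>j. Eq (Var j) (?w (as ! j))) ` {..<k}
    \<union> (\<lambda>(x, y). All ?z (Neg (Eq (?w y) (Mul (Mul (Var ?z) (?w x)) (Inv (Var ?z)))))) `
        {(x, y) \<in> R \<times> R. x \<noteq> y}"
  have "finite {(s, t) \<in> S \<times> S. adj s t}" "finite {(x, y) \<in> R \<times> R. x \<noteq> y}"
    using fin R(1) by (auto intro: finite_subset[of _ "S \<times> S"] finite_subset[of _ "R \<times> R"])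
  then have \<Phi>_fin: "finite \<Phi>"
    using fin by (simp add: \<Phi>_def)
  have wv: "idx ` set (w g) \<subseteq> {..<k + n}" if "g \<in> carrier G" for g
    using w[OF that] idx by auto
  have \<Phi>_fv: "free_vars \<phi> \<subseteq> {..<k + n}" if "\<phi> \<in> \<Phi>" for \<phi>
    using that unfolding \<Phi>_def
  proof (elim UnE imageE)
    fix s assume "\<phi> = Eq (Mul (?v s) (?v s)) One" "s \<in> S"
    then show ?thesis using idx by simp
  next
    fix st assume "\<phi> = (\<lambda>(s, t). Eq (Mul (?v s) (?v t)) (Mul (?v t) (?v s))) st"
      "st \<in> {(s, t) \<in> S \<times> S. adj s t}"
    then show ?thesis using idx by auto
  next
    fix j assume "\<phi> = Eq (Var j) (?w (as ! j))" "j \<in> {..<k}"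
    then show ?thesis using wv[OF asG[of j]] by auto
  next
    fix xy assume "\<phi> = (\<lambda>(x, y). All ?z (Neg (Eq (?w y) (Mul (Mul (Var ?z) (?w x)) (Inv (Var ?z)))))) xy"
      "xy \<in> {(x, y) \<in> R \<times> R. x \<noteq> y}"
    moreover from this obtain a b where "xy = (a, b)" "a \<in> carrier G" "b \<in> carrier G"
      using R(2) by auto
    ultimately show ?thesis
      using wv[of a] wv[of b] by auto
  qed
  have id: "id \<in> hom G G"
    by (simp add: hom_def)
  have val: "term_value G e (?w g) = f g \<and> term_value G (e(?z := c)) (?w g) = f g"
    if "f \<in> hom G G" "\<And>s. s \<in> S \<Longrightarrow> e (idx s) = f (\<sigma> s)" "g \<in> carrier G" for f e g c
  proof -
    have "(e(?z := c)) (idx s) = f (\<sigma> s)" if "s \<in> S" for s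
      using idx[OF that] \<open>\<And>s. s \<in> S \<Longrightarrow> e (idx s) = f (\<sigma> s)\<close>[OF that] by simp
    then show ?thesis
      using term_value_hom[OF that(1), of _ idx "w g"] that(2) w[OF that(3)] by simp
  qed
  define x where "x i = \<sigma> (the_inv_into S h i)" for i
  have xh: "x (h s) = \<sigma> s" if "s \<in> S" for s
    using h that by (simp add: x_def bij_betw_def the_inv_into_f_f)
  have xG: "x i \<in> carrier G" if "i < n" for i
  proof -
    have "i \<in> h ` S"
      using h that by (simp add: bij_betw_def)
    then obtain s where "s \<in> S" "h s = i"
      by blast
    then show ?thesis
      using xh[of s] by simp
  qed
  \<comment> \<open>The standard assignment interprets each generator variable by the generator
    itself; it satisfies \<open>\<Phi>\<close> because the identity endomorphism has all the
    required properties.\<close>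
  define e0 where "e0 i = (if k \<le> i \<and> i < k + n then x (i - k) else as ! i)" for i
  have e0: "e0 (idx s) = id (\<sigma> s)" if "s \<in> S" for s
    using idx[OF that] xh[OF that] by (simp add: e0_def idx_def)
  have sat0: "sat G e0 \<phi>" if "\<phi> \<in> \<Phi>" for \<phi>
    using that unfolding \<Phi>_def
  proof (elim UnE imageE)
    fix s assume "\<phi> = Eq (Mul (?v s) (?v s)) One" "s \<in> S"
    then show ?thesis using e0 by simp
  next
    fix st assume "\<phi> = (\<lambda>(s, t). Eq (Mul (?v s) (?v t)) (Mul (?v t) (?v s))) st"
      "st \<in> {(s, t) \<in> S \<times> S. adj s t}"
    then show ?thesis using e0 \<sigma>_commute by auto
  next
    fix j assume "\<phi> = Eq (Var j) (?w (as ! j))" "j \<in> {..<k}"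
    moreover from this have "term_value G e0 (?w (as ! j)) = as ! j" "e0 j = as ! j"
      using val[OF id e0 asG] by (simp, simp add: e0_def)
    ultimately show ?thesis
      by simp
  next
    fix xy assume \<phi>: "\<phi> = (\<lambda>(x, y). All ?z (Neg (Eq (?w y) (Mul (Mul (Var ?z) (?w x)) (Inv (Var ?z)))))) xy"
      "xy \<in> {(x, y) \<in> R \<times> R. x \<noteq> y}"
    obtain a b where ab: "xy = (a, b)" "a \<in> R" "b \<in> R" "a \<noteq> b"
      using \<phi>(2) by auto
    have "b \<noteq> c \<otimes> a \<otimes> inv c" if "c \<in> carrier G" for c
      using R(5)[of a b] ab that by (auto simp: conjugate_def cj_def)
    moreover have "a \<in> carrier G" "b \<in> carrier G"
      using ab R(2) by auto
    ultimately show ?thesis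
      using val[OF id e0] \<phi>(1) ab(1) by simp
  qed
  have kb: "length bs = k"
    using len by (simp add: k_def)
  obtain e where e: "\<And>i. i < k \<Longrightarrow> e i = bs ! i" "\<And>i. k \<le> i \<Longrightarrow> i < k + n \<Longrightarrow> e i \<in> carrier G"
    "\<And>\<phi>. \<phi> \<in> \<Phi> \<Longrightarrow> sat G e \<phi>"
    using tp_transfer[where x = x, OF \<Phi>_fin \<Phi>_fv tp k_def[symmetric] kb xG sat0[unfolded e0_def]]
    by blast
  have c: "e (idx s) \<in> carrier G" if "s \<in> S" for s
    using e(2) idx[OF that] by blast
  have sq: "e (idx s) \<otimes> e (idx s) = \<one>" if "s \<in> S" for s
    using e(3)[of "Eq (Mul (?v s) (?v s)) One"] that unfolding \<Phi>_def by auto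
  have comm: "e (idx s) \<otimes> e (idx t) = e (idx t) \<otimes> e (idx s)" if "adj s t" for s t
  proof -
    have "Eq (Mul (?v s) (?v t)) (Mul (?v t) (?v s)) \<in> \<Phi>"
      unfolding \<Phi>_def using that adjD[OF that]
      by (intro UnI1 UnI2 image_eqI[of _ _ "(s, t)"]) auto
    from e(3)[OF this] show ?thesis by simp
  qed
  \<comment> \<open>The witnesses satisfy the Coxeter relations, so they are the images of the
    generators under an endomorphism. Word terms then evaluate to images under \<open>f\<close>,
    which lets the remaining formulas speak about \<open>f\<close>.\<close>
  obtain f where f: "f \<in> hom G G" "\<And>s. s \<in> S \<Longrightarrow> f (\<sigma> s) = e (idx s)"
    using hom_extend[where f = "\<lambda>s. e (idx s)", OF is_group c sq comm] by blast
  have valf: "term_value G e (?w g) = f g" "term_value G (e(?z := c)) (?w g) = f g"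
    if "g \<in> carrier G" for g c
    using val[OF f(1) _ that, of e] f(2) by auto
  have ab: "f (as ! j) = bs ! j" if "j < k" for j
  proof -
    have "Eq (Var j) (?w (as ! j)) \<in> \<Phi>"
      unfolding \<Phi>_def using that by (intro UnI1 UnI2 imageI) auto
    from e(3)[OF this] show ?thesis
      using valf(1)[OF asG[OF that]] e(1)[OF that] by simp
  qed
  have "a = b" if R': "a \<in> R" "b \<in> R" and conj: "conjugate (f a) (f b)" for a b
  proof (rule ccontr)
    assume "a \<noteq> b"
    then have "All ?z (Neg (Eq (?w b) (Mul (Mul (Var ?z) (?w a)) (Inv (Var ?z))))) \<in> \<Phi>"
      unfolding \<Phi>_def using R' by (intro UnI2 image_eqI[of _ _ "(a, b)"]) auto
    moreover have "a \<in> carrier G" "b \<in> carrier G"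
      using R' R(2) by auto
    ultimately have "\<not> (\<exists>c\<in>carrier G. f b = cj c (f a))"
      using e(3)[of "All ?z (Neg (Eq (?w b) (Mul (Mul (Var ?z) (?w a)) (Inv (Var ?z)))))"] valf(2)
      by (simp add: cj_def)
    then show False
      using conj by (auto simp: conjugate_def)
  qed
  then have "bij_betw f (carrier G) (carrier G)"
    using involution_class_injective_bij[OF fin sep flat f(1) R(1-4)] by blast
  then have "f \<in> iso G G"
    using f(1) by (simp add: iso_def)
  moreover have "map f as = bs"
    using ab len by (intro nth_equalityI) (auto simp: k_def)
  ultimately show "\<exists>\<sigma>\<in>iso G G. map \<sigma> as = bs"
    by blast
qed

end

text \<open>Each word goes to the image of its class under an isomorphism onto \<open>G\<close>;
  injectivity of the isomorphism makes equality in \<open>G\<close> the same as equivalence of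
  words.\<close>

lemma coxeter_group_racg:
  fixes G :: "('a, 'b) monoid_scheme"
  assumes "group G" and ra: "right_angled_coxeter_matrix S m" and iso: "G \<cong> coxeter_group S m"
  obtains p where "racg G S m p"
proof -
  let ?R = "coxeter_relators S m"
  let ?cl = "\<lambda>u. pres_rel S ?R `` {u}"
  have "coxeter_group S m \<cong> G"
    using group.iso_sym[OF assms(1) iso] .
  then obtain h where h: "h \<in> hom (presented_group S ?R) G"
    "bij_betw h (carrier (presented_group S ?R)) (carrier G)"
    by (auto simp: is_iso_def iso_def coxeter_group_def)
  have "racg G S m (\<lambda>u. h (?cl u))"
  proof (intro racg.intro racg_axioms.intro assms)
    show "h (?cl u) \<in> carrier G" if "u \<in> words S" for u
      using hom_in_carrier[OF h(1) presented_class_closed[OF that]] .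
    show "\<exists>u\<in>words S. h (?cl u) = g" if "g \<in> carrier G" for g
    proof -
      have "g \<in> h ` carrier (presented_group S ?R)"
        using bij_betw_imp_surj_on[OF h(2)] \<open>g \<in> carrier G\<close> by simp
      then obtain X where X: "X \<in> carrier (presented_group S ?R)" "g = h X"
        by (rule imageE)
      obtain u where "u \<in> words S" "X = ?cl u"
        using X(1) by (rule presented_class_cases)
      then show ?thesis
        using X(2) by (intro bexI[of _ u]) simp_all
    qed
    show "h (?cl (u @ v)) = h (?cl u) \<otimes>\<^bsub>G\<^esub> h (?cl v)" if "u \<in> words S" "v \<in> words S" for u v
      using hom_mult[OF h(1) presented_class_closed presented_class_closed, OF that]
        presented_mult[OF that] by simp
    show "h (?cl u) = h (?cl v) \<longleftrightarrow> pres_eq S ?R u v" if "u \<in> words S" "v \<in> words S" for u v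
    proof -
      have "h (?cl u) = h (?cl v) \<longleftrightarrow> ?cl u = ?cl v"
        using bij_betw_imp_inj_on[OF h(2)] presented_class_closed that by (intro inj_on_eq_iff)
      also have "\<dots> \<longleftrightarrow> pres_eq S ?R u v"
        using eq_equiv_class_iff[OF equiv_pres_rel that] by (simp add: pres_rel_def)
      finally show ?thesis .
    qed
  qed
  then show ?thesis
    by (rule that)
qed

theorem theorem1p5:
  fixes G :: "('a, 'b) monoid_scheme"
    and S :: "'s set"
    and m :: "'s \<Rightarrow> 's \<Rightarrow> enat"
  assumes "group G"
    and "right_angled_coxeter_matrix S m"
    and "G \<cong> coxeter_group S m"
    and "hyperbolic_group G"
    and "one_ended G"
  shows "homogeneous G"
proof -
  obtain p where "racg G S m p"
    using coxeter_group_racg[OF assms(1-3)] .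
  then interpret racg G S m p .
  have "finitely_generated G"
    using assms(5) by (simp add: one_ended_def)
  from finite_generators[OF this] show ?thesis
    using one_ended_no_separating_clique[OF assms(5)] hyperbolic_no_reflection_flat[OF assms(4)]
    by (rule homogeneous_if_rigid)
qed

end
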